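(* Let $n\ge 1$. The representation of the spin type B nilHecke algebra ${}^{B}\mathrm{NH}_n^-$ on $\mathrm{Pol}_n^-$ is faithful. Moreover, one has the graded rank formulas $$\mathrm{rk}_{q,\pi}({}^{B}\mathrm{NC}_n^-)=(\pi q)^{-n^2}[2n]_\pi!!,\qquad \mathrm{rk}_{q,\pi}({}^{B}\mathrm{NH}_n^-)=\frac{(\pi q)^{-n^2}[2n]_\pi!!}{(1-\pi q^2)^n}.$$
   Context: $\mathrm{Pol}_n^-$ is the unital $\mathbb{Z}$-algebra generated by $x_1,\dots,x_n$ subject to $x_ix_j+x_jx_i=0$ for all $i\ne j$. The spin type B nilHecke algebra ${}^{B}\mathrm{NH}_n^-$ is the unital $\mathbb{Z}$-algebra generated by $x_1,\dots,x_n$, $\partial_1^-,\dots,\partial_{n-1}^-$, $\partial_n^B$ subject to $x_ix_j+x_jx_i=0$ ($i\neq j$) and, for $1\le i\le n-1$ (whenever the indices make sense): $(\partial_i^-)^2=0$; $\partial_i^-\partial_{i+1}^-\partial_i^-=\partial_{i+1}^-\partial_i^-\partial_{i+1}^-$; $\partial_i^-\partial_j^-+\partial_j^-\partial_i^-=0$ for $|i-j|>1$; $x_i\partial_i^-+\partial_i^-x_{i+1}=1$; $\partial_i^-x_i+x_{i+1}\partial_i^-=1$; $\partial_i^-x_j+x_j\partial_i^-=0$ for $j\ne i,i+1$; and $(\partial_n^B)^2=0$; $\partial_n^B\partial_{n-1}^-\partial_n^B\partial_{n-1}^-=-\partial_{n-1}^-\partial_n^B\partial_{n-1}^-\partial_n^B$;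 $\partial_n^B\partial_i^-+\partial_i^-\partial_n^B=0$ for $1\le i\le n-2$; $\partial_n^Bx_n+x_n\partial_n^B=1$; $\partial_n^Bx_i+x_i\partial_n^B=0$ for $1\le i\le n-1$. The spin type B nilCoxeter algebra ${}^{B}\mathrm{NC}_n^-$ is its subalgebra generated by $\partial_1^-,\dots,\partial_{n-1}^-,\partial_n^B$. The algebra is $\mathbb{Z}$-graded by $|x_i|=2$, $|\partial_i^-|=|\partial_n^B|=-2$, and $\mathbb{Z}_2$-graded by declaring all generators to have parity $p=1$. It acts on $\mathrm{Pol}_n^-$ as follows. The $x_i$ act by left multiplication. For $1\le i\le n-1$ let $s_i$ be the algebra endomorphism of $\mathrm{Pol}_n^-$ with $s_i(x_i)=-x_{i+1}$, $s_i(x_{i+1})=-x_i$, $s_i(x_j)=-x_j$ for $j\ne i,i+1$, and let $s_n^B$ be the algebra endomorphism with $s_n^B(x_j)=-x_j$ for all $j$. Then $\partial_i^-$ and $\partial_n^B$ act as the $\mathbb{Z}$-linear operators that kill $1$ and satisfy: $\partial_i^-(x_j)=1$ if $j\in\{i,i+1\}$ and $0$ otherwise; $\partial_n^B(x_j)=1$ if $j=n$ and $0$ otherwise; $\partial_i^-(fg)=\partial_i^-(f)g+s_i(f)\partial_i^-(g)$, $\partial_n^B(fg)=\partial_n^B(f)g+s_n^B(f)\partial_n^B(g)$. For a $\mathbb{Z}\times\mathbb{Z}_2$-graded algebra $A$ with homogeneous $\mathbb{Z}$-basis $\mathfrak B$, $\mathrm{rk}_{q,\pi}(A)=\sum_{b\in\mathfrak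 B}q^{|b|}\pi^{p(b)}$, where $\pi^2=1$. Also $[m]_\pi=\frac{\pi^mq^m-q^{-m}}{\pi q-q^{-1}}$ and $[2n]_\pi!!=[2n]_\pi[2n-2]_\pi\cdots[4]_\pi[2]_\pi$. *)

theory Defs
  imports
    "HOL-Computational_Algebra.Formal_Laurent_Series"
    "HOL-Library.Poly_Mapping"
    "HOL-Algebra.QuotRing"
    "HOL-Algebra.Generated_Rings"
begin

section \<open>Algebras given by generators and relations\<close>

datatype 'g free_monoid = FM (letters: "'g list")

instantiation free_monoid :: (type) monoid_add
begin

definition zero_free_monoid :: "'a free_monoid" where
  "0 = FM []"

definition plus_free_monoid :: "'a free_monoid \<Rightarrow> 'a free_monoid \<Rightarrow> 'a free_monoid" where
  "v + w = FM (letters v @ letters w)"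

instance
  by standard (simp_all add: zero_free_monoid_def plus_free_monoid_def)

end

text \<open>
  The multiplication of \<^typ>\<open>'g free_monoid \<Rightarrow>\<^sub>0 int\<close> is convolution along concatenation of words, so
  this is the underlying type of the free unital ring on the letters.
\<close>

type_synonym 'g free_ring = "'g free_monoid \<Rightarrow>\<^sub>0 int"

definition gen :: "'g \<Rightarrow> 'g free_ring" where
  "gen g = Poly_Mapping.single (FM [g]) 1"

definition free_alg :: "'g set \<Rightarrow> 'g free_ring ring" where
  "free_alg S =
     \<lparr>carrier = {f. \<forall>w\<in>Poly_Mapping.keys f. set (letters w) \<subseteq> S},
      mult = (*), one = 1, zero = 0, add = (+)\<rparr>"

definition presented_alg :: "'g set \<Rightarrow> 'g free_ring set \<Rightarrow> 'g free_ring set ring" where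
  "presented_alg S R = free_alg S Quot (Idl\<^bsub>free_alg S\<^esub> R)"

definition residue_class :: "'g set \<Rightarrow> 'g free_ring set \<Rightarrow> 'g free_ring \<Rightarrow> 'g free_ring set" where
  "residue_class S R f = (Idl\<^bsub>free_alg S\<^esub> R) +>\<^bsub>free_alg S\<^esub> f"


section \<open>Skew polynomials and the spin type B nilHecke algebra\<close>

text \<open>
  \<open>GX i\<close> stands for $x_i$, \<open>GD i\<close> for $\partial_i^-$, and \<open>GB\<close> for $\partial_n^B$.
\<close>

datatype letter = GX nat | GD nat | GB

abbreviation gx :: "nat \<Rightarrow> letter free_ring" where "gx i \<equiv> gen (GX i)"
abbreviation gd :: "nat \<Rightarrow> letter free_ring" where "gd i \<equiv> gen (GD i)"
abbreviation gB :: "letter free_ring" where "gB \<equiv> gen GB"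

definition pol_gens :: "nat \<Rightarrow> letter set" where
  "pol_gens n = GX ` {1..n}"

definition pol_rels :: "nat \<Rightarrow> letter free_ring set" where
  "pol_rels n = {gx i * gx j + gx j * gx i | i j. i \<in> {1..n} \<and> j \<in> {1..n} \<and> i \<noteq> j}"

definition Pol :: "nat \<Rightarrow> letter free_ring set ring" where
  "Pol n = presented_alg (pol_gens n) (pol_rels n)"

definition pol_x :: "nat \<Rightarrow> nat \<Rightarrow> letter free_ring set" where
  "pol_x n i = residue_class (pol_gens n) (pol_rels n) (gx i)"

definition nc_gens :: "nat \<Rightarrow> letter set" where
  "nc_gens n = GD ` {1..<n} \<union> {GB}"

definition nh_gens :: "nat \<Rightarrow> letter set" where
  "nh_gens n = pol_gens n \<union> nc_gens n"

definition nh_rels :: "nat \<Rightarrow> letter free_ring set" where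
  "nh_rels n =
     pol_rels n
   \<union> {gd i * gd i | i. i \<in> {1..<n}}
   \<union> {gd i * gd (i+1) * gd i - gd (i+1) * gd i * gd (i+1) | i. i \<in> {1..<n} \<and> i + 1 \<in> {1..<n}}
   \<union> {gd i * gd j + gd j * gd i | i j. i \<in> {1..<n} \<and> j \<in> {1..<n} \<and> \<bar>int i - int j\<bar> > 1}
   \<union> {gx i * gd i + gd i * gx (i+1) - 1 | i. i \<in> {1..<n}}
   \<union> {gd i * gx i + gx (i+1) * gd i - 1 | i. i \<in> {1..<n}}
   \<union> {gd i * gx j + gx j * gd i | i j. i \<in> {1..<n} \<and> j \<in> {1..n} \<and> j \<noteq> i \<and> j \<noteq> i + 1}
   \<union> {gB * gB}
   \<union> {gB * gd i * gB * gd i + gd i * gB * gd i * gB | i. i \<in> {1..<n} \<and> i + 1 = n}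
   \<union> {gB * gd i + gd i * gB | i. i \<in> {1..<n} \<and> i + 2 \<le> n}
   \<union> {gB * gx n + gx n * gB - 1}
   \<union> {gB * gx i + gx i * gB | i. i \<in> {1..<n}}"

definition NH :: "nat \<Rightarrow> letter free_ring set ring" where
  "NH n = presented_alg (nh_gens n) (nh_rels n)"

definition nh :: "nat \<Rightarrow> letter free_ring \<Rightarrow> letter free_ring set" where
  "nh n f = residue_class (nh_gens n) (nh_rels n) f"

definition NC :: "nat \<Rightarrow> letter free_ring set ring" where
  "NC n = (NH n)\<lparr>carrier := generate_ring (NH n) ((\<lambda>g. nh n (gen g)) ` nc_gens n)\<rparr>"


section \<open>The polynomial representation\<close>

text \<open>
  The ring of additive (that is, \<open>\<int>\<close>-linear) endomorphisms of a ring; its elements are taken to be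
  extensional functions, so that they are equal iff they agree on the carrier.
\<close>

definition End_ring :: "('a, 'm) ring_scheme \<Rightarrow> ('a \<Rightarrow> 'a) ring" where
  "End_ring M =
     \<lparr>carrier = hom (add_monoid M) (add_monoid M) \<inter> extensional (carrier M),
      mult = (\<lambda>f g. compose (carrier M) f g),
      one = (\<lambda>a\<in>carrier M. a),
      zero = (\<lambda>a\<in>carrier M. \<zero>\<^bsub>M\<^esub>),
      add = (\<lambda>f g. \<lambda>a\<in>carrier M. f a \<oplus>\<^bsub>M\<^esub> g a)\<rparr>"

definition is_s :: "nat \<Rightarrow> nat \<Rightarrow> (letter free_ring set \<Rightarrow> letter free_ring set) \<Rightarrow> bool" where
  "is_s n i s \<longleftrightarrow>
     s \<in> ring_hom (Pol n) (Pol n) \<and>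
     s (pol_x n i) = \<ominus>\<^bsub>Pol n\<^esub> pol_x n (i+1) \<and>
     s (pol_x n (i+1)) = \<ominus>\<^bsub>Pol n\<^esub> pol_x n i \<and>
     (\<forall>j\<in>{1..n} - {i, i+1}. s (pol_x n j) = \<ominus>\<^bsub>Pol n\<^esub> pol_x n j)"

definition is_sB :: "nat \<Rightarrow> (letter free_ring set \<Rightarrow> letter free_ring set) \<Rightarrow> bool" where
  "is_sB n s \<longleftrightarrow>
     s \<in> ring_hom (Pol n) (Pol n) \<and>
     (\<forall>j\<in>{1..n}. s (pol_x n j) = \<ominus>\<^bsub>Pol n\<^esub> pol_x n j)"

text \<open>
  \<open>D\<close> is the \<open>s\<close>-twisted derivation which kills 1, maps $x_j$ to 1 for \<open>j \<in> J\<close> and maps the other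
  variables to 0.
\<close>

definition is_twisted_derivation ::
  "nat \<Rightarrow> (letter free_ring set \<Rightarrow> letter free_ring set) \<Rightarrow> nat set \<Rightarrow>
   (letter free_ring set \<Rightarrow> letter free_ring set) \<Rightarrow> bool" where
  "is_twisted_derivation n s J D \<longleftrightarrow>
     D \<in> hom (add_monoid (Pol n)) (add_monoid (Pol n)) \<and>
     D \<one>\<^bsub>Pol n\<^esub> = \<zero>\<^bsub>Pol n\<^esub> \<and>
     (\<forall>j\<in>{1..n}. D (pol_x n j) = (if j \<in> J then \<one>\<^bsub>Pol n\<^esub> else \<zero>\<^bsub>Pol n\<^esub>)) \<and>
     (\<forall>f\<in>carrier (Pol n). \<forall>g\<in>carrier (Pol n).
        D (f \<otimes>\<^bsub>Pol n\<^esub> g) = (D f \<otimes>\<^bsub>Pol n\<^esub> g) \<oplus>\<^bsub>Pol n\<^esub> (s f \<otimes>\<^bsub>Pol n\<^esub> D g))"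

definition is_pol_rep ::
  "nat \<Rightarrow> (letter free_ring set \<Rightarrow> letter free_ring set \<Rightarrow> letter free_ring set) \<Rightarrow> bool" where
  "is_pol_rep n \<rho> \<longleftrightarrow>
     \<rho> \<in> ring_hom (NH n) (End_ring (Pol n)) \<and>
     (\<forall>i\<in>{1..n}. \<forall>f\<in>carrier (Pol n). \<rho> (nh n (gx i)) f = pol_x n i \<otimes>\<^bsub>Pol n\<^esub> f) \<and>
     (\<forall>i\<in>{1..<n}. \<exists>s. is_s n i s \<and> is_twisted_derivation n s {i, i+1} (\<rho> (nh n (gd i)))) \<and>
     (\<exists>s. is_sB n s \<and> is_twisted_derivation n s {n} (\<rho> (nh n gB)))"


section \<open>Gradings\<close>

fun letter_deg :: "letter \<Rightarrow> int" where
  "letter_deg (GX i) = 2"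
| "letter_deg (GD i) = -2"
| "letter_deg GB = -2"

text \<open>
  The component of degree \<open>d\<close> and parity \<open>p \<in> {0, 1}\<close>.  All generators are odd, so the parity of a
  word is its length modulo 2.
\<close>

definition NH_comp :: "nat \<Rightarrow> int \<Rightarrow> nat \<Rightarrow> letter free_ring set set" where
  "NH_comp n d p =
     generate (add_monoid (NH n))
       {nh n (Poly_Mapping.single w 1) | w.
          set (letters w) \<subseteq> nh_gens n \<and>
          (\<Sum>g\<leftarrow>letters w. letter_deg g) = d \<and> length (letters w) mod 2 = p}"

definition NC_comp :: "nat \<Rightarrow> int \<Rightarrow> nat \<Rightarrow> letter free_ring set set" where
  "NC_comp n d p = carrier (NC n) \<inter> NH_comp n d p"

definition is_Z_basis :: "('a, 'm) ring_scheme \<Rightarrow> 'a set \<Rightarrow> bool" where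
  "is_Z_basis A B \<longleftrightarrow>
     B \<subseteq> carrier A \<and>
     (\<forall>a\<in>carrier A. \<exists>!c :: 'a \<Rightarrow>\<^sub>0 int.
        Poly_Mapping.keys c \<subseteq> B \<and>
        a = (\<Oplus>\<^bsub>A\<^esub>b\<in>Poly_Mapping.keys c. [Poly_Mapping.lookup c b] \<cdot>\<^bsub>A\<^esub> b))"

definition is_homogeneous_Z_basis ::
  "('a, 'm) ring_scheme \<Rightarrow> (int \<Rightarrow> nat \<Rightarrow> 'a set) \<Rightarrow> 'a set \<Rightarrow> bool" where
  "is_homogeneous_Z_basis A C B \<longleftrightarrow>
     is_Z_basis A B \<and> (\<forall>b\<in>B. \<exists>d. \<exists>p\<in>{0, 1}. b \<in> C d p)"


section \<open>Graded ranks\<close>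

text \<open>The ring $\mathbb{Z}[\pi]/(\pi^2-1)$: \<open>ZPi a b\<close> stands for $a + b\pi$.\<close>

datatype zpi = ZPi (zpi0: int) (zpi1: int)

lemma zpi_eq_iff: "u = v \<longleftrightarrow> zpi0 u = zpi0 v \<and> zpi1 u = zpi1 v"
  by (cases u; cases v) simp

instantiation zpi :: comm_ring_1
begin

definition "0 = ZPi 0 0"
definition "1 = ZPi 1 0"
definition "u + v = ZPi (zpi0 u + zpi0 v) (zpi1 u + zpi1 v)"
definition "- u = ZPi (- zpi0 u) (- zpi1 u)"
definition "u - v = ZPi (zpi0 u - zpi0 v) (zpi1 u - zpi1 v)"
definition "u * v = ZPi (zpi0 u * zpi0 v + zpi1 u * zpi1 v) (zpi0 u * zpi1 v + zpi1 u * zpi0 v)"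

instance
  by standard
    (simp_all add: zpi_eq_iff zero_zpi_def one_zpi_def plus_zpi_def uminus_zpi_def minus_zpi_def
      times_zpi_def algebra_simps)

end

text \<open>
  Inverses of units; the value 0 at non-units is a dummy.  The library's division of Laurent series
  inverts the leading coefficient, and every denominator below has a unit as its leading coefficient.
\<close>

instantiation zpi :: inverse
begin

definition inverse_zpi :: "zpi \<Rightarrow> zpi" where
  "inverse_zpi u = (if u dvd 1 then (THE v. u * v = 1) else 0)"

definition divide_zpi :: "zpi \<Rightarrow> zpi \<Rightarrow> zpi" where
  "divide_zpi u v = u * inverse v"

instance ..

end

definition zpi_pi :: zpi where
  "zpi_pi = ZPi 0 1"

text \<open>Laurent series in $q$ over that ring.\<close>

abbreviation qq :: "zpi fls" where "qq \<equiv> fls_X"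

definition ppi :: "zpi fls" where
  "ppi = fls_const zpi_pi"

definition qint :: "nat \<Rightarrow> zpi fls" where
  "qint m = (ppi ^ m * qq ^ m - qq powi (- int m)) / (ppi * qq - inverse qq)"

definition qint_even_dfact :: "nat \<Rightarrow> zpi fls" where
  "qint_even_dfact n = (\<Prod>k=1..n. qint (2 * k))"

text \<open>
  \<open>F\<close> is the series $\sum_{b \in B} q^{|b|} \pi^{p(b)}$, the sum being taken coefficientwise in \<open>q\<close>.
  Finiteness is required explicitly because a sum over an infinite set is 0 by convention.
\<close>

definition is_rank_series ::
  "(int \<Rightarrow> nat \<Rightarrow> 'a set) \<Rightarrow> 'a set \<Rightarrow> zpi fls \<Rightarrow> bool" where
  "is_rank_series C B F \<longleftrightarrow>
     (\<forall>d. (\<forall>p\<in>{0, 1}. finite (B \<inter> C d p)) \<and>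
          fls_nth F d = (\<Sum>p\<in>{0, 1}. \<Sum>b\<in>B \<inter> C d p. zpi_pi ^ p))"

text \<open>
  The graded rank exists, does not depend on the choice of a homogeneous basis, and equals \<open>F\<close>.
\<close>

definition has_graded_rank ::
  "('a, 'm) ring_scheme \<Rightarrow> (int \<Rightarrow> nat \<Rightarrow> 'a set) \<Rightarrow> zpi fls \<Rightarrow> bool" where
  "has_graded_rank A C F \<longleftrightarrow>
     (\<exists>B. is_homogeneous_Z_basis A C B) \<and>
     (\<forall>B. is_homogeneous_Z_basis A C B \<longrightarrow> is_rank_series C B F)"

end

theory Submission
  imports Defs "HOL-Algebra.Free_Abelian_Groups"
begin

text \<open>
  Write $t_j = \partial_j^-$ for $j < n$ and $t_n = \partial_n^B$, so that $t_1, \dots, t_n$ satisfy the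
  braid relations of type $B_n$ up to sign, and $t_j^2 = 0$.  Everything rests on one family of
  elements of the algebra, the products $x^a t_w$ of a sorted monomial $x^a$ and a normal form $t_w$,
  where $w$ runs over the $2^n n!$ elements of the Weyl group of type $B_n$.  The word $t_w$ is built
  along the chain $B_n \supset B_{n-1} \supset \dots \supset B_1$: it is a product
  $c_1 c_2 \cdots c_n$, where $c_k$ is a suffix of the word $t_k \cdots t_n \cdots t_k$, and $w$ is
  recorded by its code, the list of the lengths of these suffixes.

  These products span.  The mixed relations move every $t_j$ to the right of every $x_i$, at the price
  of a shorter word (\<open>t_mult_span\<close>).  For words in the $t_j$ alone signs do not matter, and the key point
  is that $t_j c_k$ is zero, or the next longer suffix, or $\pm c_k t_{j'}$ with $j' > k$
  (\<open>straighten\<close>).  The letter $t_{j'}$ is then absorbed by the remaining factors $c_{k+1} \cdots c_n$.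

  They act independently.  The operators are extended to the free ring on the variables, where all
  relations between them hold exactly; whether an operator identity holds can be tested on $1$ because
  both sides commute with the variables in the same way.  If a code $v$ and a monomial $x^w$ are such
  that $t_v x^w \neq 0$, then comparing degrees in $x_k, \dots, x_n$ for each $k$ shows that every
  suffix of $v$ has at most the sum of the corresponding suffix of $w$; and $t_w x^w = \pm 1$
  (\<open>ders_nf_word_xmon\<close>).  So the matrix of the $t_v$ on the monomials $x^w$ is unitriangular for
  a suitable order.  Applied to the monomial of a minimal code, a linear relation between the
  $x^a t_v$ reduces to one between the sorted monomials, which are independent in the ring of skew
  polynomials (\<open>nh_words_independent\<close>).

  Hence the $x^a t_w$ form a basis, the $t_w$ a basis of the nilCoxeter subalgebra, and an
  element that acts as zero is zero.  Every representation in question is determined by its values on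
  the generators (\<open>pol_rep_unique\<close>), so faithfulness holds for all of them.  The defining relations
  are homogeneous, whence the part of any homogeneous basis that lies in a given component freely
  generates this component; its cardinality is therefore the same for all homogeneous bases
  (\<open>component_eqpoll\<close>) and may be counted with the $x^a t_w$.  The codes contribute the factors
  $1 + \pi q^{-2} + \dots + (\pi q^{-2})^{2k-1}$, which are the $[2k]_\pi$ up to powers of $\pi q$, and
  each variable contributes a factor $1 / (1 - \pi q^2)$.
\<close>


section \<open>Free rings, ideals given by generators, and residue classes\<close>

abbreviation word :: "'g list \<Rightarrow> 'g free_ring" where
  "word w \<equiv> frag_of (FM w)"

abbreviation words :: "'g set \<Rightarrow> 'g free_monoid set" where
  "words S \<equiv> {w. set (letters w) \<subseteq> S}"

definition elems :: "'g set \<Rightarrow> 'g free_ring set" where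
  "elems S = {f. Poly_Mapping.keys f \<subseteq> words S}"

abbreviation idl :: "'g set \<Rightarrow> 'g free_ring set \<Rightarrow> 'g free_ring set" where
  "idl S R \<equiv> Idl\<^bsub>free_alg S\<^esub> R"

lemma word_Nil: "word [] = 1"
  by (simp add: single_one[symmetric] zero_free_monoid_def)

lemma word_append: "word (u @ v) = word u * word v"
  by (simp add: mult_single plus_free_monoid_def)

lemma word_Cons: "word (l # w) = gen l * word w"
  by (simp add: gen_def mult_single plus_free_monoid_def)

lemma carrier_free_alg: "carrier (free_alg S) = elems S"
  by (auto simp: free_alg_def elems_def)

lemma free_alg_simps [simp]:
  "a \<otimes>\<^bsub>free_alg S\<^esub> b = a * b" "a \<oplus>\<^bsub>free_alg S\<^esub> b = a + b"
  "\<one>\<^bsub>free_alg S\<^esub> = 1" "\<zero>\<^bsub>free_alg S\<^esub> = 0"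
  by (simp_all add: free_alg_def)

lemma elems_word [simp]: "word w \<in> elems S \<longleftrightarrow> set w \<subseteq> S"
  by (simp add: elems_def)

lemma elems_gen [simp]: "gen l \<in> elems S \<longleftrightarrow> l \<in> S"
  by (simp add: gen_def elems_def)

lemma elems_0 [simp]: "0 \<in> elems S"
  by (simp add: elems_def)

lemma elems_1 [simp]: "1 \<in> elems S"
  using elems_word[of "[]" S] by (simp add: word_Nil)

lemma elems_add [simp]: "a \<in> elems S \<Longrightarrow> b \<in> elems S \<Longrightarrow> a + b \<in> elems S"
  using keys_add[of a b] unfolding elems_def by blast

lemma elems_minus [simp]: "a \<in> elems S \<Longrightarrow> - a \<in> elems S"
  by (simp add: elems_def)

lemma elems_diff [simp]: "a \<in> elems S \<Longrightarrow> b \<in> elems S \<Longrightarrow> a - b \<in> elems S"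
  using keys_diff[of a b] unfolding elems_def by blast

lemma elems_mult [simp]:
  assumes "a \<in> elems S" "b \<in> elems S"
  shows "a * b \<in> elems S"
proof -
  have "u + v \<in> words S" if "u \<in> words S" "v \<in> words S" for u v :: "'a free_monoid"
    using that by (simp add: plus_free_monoid_def)
  then show ?thesis
    using keys_mult[of a b] assms unfolding elems_def by blast
qed

lemma elems_mono: "S \<subseteq> S' \<Longrightarrow> f \<in> elems S \<Longrightarrow> f \<in> elems S'"
  unfolding elems_def by blast

lemma elems_cmul [simp]: "a \<in> elems S \<Longrightarrow> frag_cmul c a \<in> elems S"
  using keys_cmul[of c a] unfolding elems_def by blast

lemma frag_cmul_eq_mult: "frag_cmul c x = of_int c * x"
  for x :: "'g free_ring"
proof -
  have "frag_cmul c x = Poly_Mapping.single 0 c * x"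
    using subset_UNIV
  proof (induction x rule: frag_induction)
    case (one x)
    show ?case by (rule poly_mapping_eqI) (simp add: mult_single lookup_single when_def)
  next
    case (diff a b)
    then show ?case
      using frag_cmul_distrib2[of c "a - b" b] by (simp add: right_diff_distrib diff_eq_eq)
  qed simp
  then show ?thesis by (simp flip: single_of_int)
qed

lemma frag_cmul_mult: "frag_cmul c a * b = frag_cmul c (a * b)"
  and mult_frag_cmul: "a * frag_cmul c b = frag_cmul c (a * b)"
  for a b :: "'g free_ring"
  using mult_of_int_commute[of c a] by (simp_all add: frag_cmul_eq_mult flip: mult.assoc)

lemma elems_induct [consumes 1, case_names zero word diff]:
  assumes "f \<in> elems S" and "P 0" and "\<And>w. set w \<subseteq> S \<Longrightarrow> P (word w)"
    and "\<And>a b. a \<in> elems S \<Longrightarrow> b \<in> elems S \<Longrightarrow> P a \<Longrightarrow> P b \<Longrightarrow> P (a - b)"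
  shows "P f"
proof -
  have "f \<in> elems S \<and> P f"
    using assms(1)[unfolded elems_def mem_Collect_eq]
  proof (induction f rule: frag_induction)
    case (one w)
    then show ?case using assms(3)[of "letters w"] by (simp add: elems_def)
  next
    case (diff a b)
    then show ?case using assms(4) elems_diff[of a S b] by blast
  qed (use assms in auto)
  then show ?thesis ..
qed

lemma ring_free_alg: "ring (free_alg S)"
proof (rule ringI)
  show "abelian_group (free_alg S)"
  proof (rule abelian_groupI, unfold carrier_free_alg free_alg_simps)
    fix x assume "x \<in> elems S"
    then show "\<exists>y\<in>elems S. y + x = 0"
      by (intro bexI[of _ "- x"] elems_minus) simp_all
  qed (rule elems_add elems_0 add.assoc add.commute add_0_left; assumption?)+
  show "Group.monoid (free_alg S)"
    by (rule monoidI, unfold carrier_free_alg free_alg_simps)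
      (rule elems_mult elems_1 mult.assoc mult_1_left mult_1_right; assumption?)+
qed (unfold free_alg_simps, rule distrib_right, rule distrib_left)

lemma a_inv_free_alg [simp]: "a \<in> elems S \<Longrightarrow> \<ominus>\<^bsub>free_alg S\<^esub> a = - a"
proof -
  interpret ring "free_alg S" by (rule ring_free_alg)
  assume "a \<in> elems S"
  then show ?thesis
    using minus_equality[of "- a" a] by (simp add: carrier_free_alg)
qed

context
  fixes S :: "'g set" and R :: "'g free_ring set"
  assumes R: "R \<subseteq> elems S"
begin

interpretation F: ring "free_alg S" by (rule ring_free_alg)

lemma ideal_idl: "ideal (idl S R) (free_alg S)"
  using F.genideal_ideal R by (simp add: carrier_free_alg)

interpretation I: ideal "idl S R" "free_alg S" by (rule ideal_idl)

lemma idl_elems: "f \<in> idl S R \<Longrightarrow> f \<in> elems S"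
  using I.Icarr by (simp add: carrier_free_alg)

lemma idl_0: "0 \<in> idl S R"
  using I.zero_closed by simp

lemma idl_add: "a \<in> idl S R \<Longrightarrow> b \<in> idl S R \<Longrightarrow> a + b \<in> idl S R"
  using I.a_closed by simp

lemma idl_minus: "a \<in> idl S R \<Longrightarrow> - a \<in> idl S R"
  using I.a_inv_closed[of a] idl_elems[of a] by simp

lemma idl_diff: "a \<in> idl S R \<Longrightarrow> b \<in> idl S R \<Longrightarrow> a - b \<in> idl S R"
  using idl_add[of a "- b"] idl_minus by simp

lemma idl_mult_left: "a \<in> elems S \<Longrightarrow> b \<in> idl S R \<Longrightarrow> a * b \<in> idl S R"
  using I.I_l_closed by (simp add: carrier_free_alg)

lemma idl_mult_right: "a \<in> elems S \<Longrightarrow> b \<in> idl S R \<Longrightarrow> b * a \<in> idl S R"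
  using I.I_r_closed by (simp add: carrier_free_alg)

lemma idl_rel: "r \<in> R \<Longrightarrow> r \<in> idl S R"
  using F.genideal_self R by (auto simp: carrier_free_alg)

text \<open>
  For a property that is stable under differences, the elements $f$ such that $u f v$ has it for all
  words $u$, $v$ form an ideal, because every element is a combination of words.  So it is enough to
  treat the elements $u r v$ with $r$ a relation.
\<close>

lemma idl_induct_raw:
  assumes "f \<in> idl S R" and "P 0"
    and "\<And>a b. a \<in> elems S \<Longrightarrow> b \<in> elems S \<Longrightarrow> P a \<Longrightarrow> P b \<Longrightarrow> P (a - b)"
    and "\<And>u r v. set u \<subseteq> S \<Longrightarrow> set v \<subseteq> S \<Longrightarrow> r \<in> R \<Longrightarrow> P (word u * r * word v)"
  shows "P f"
proof -
  define J where "J = {f \<in> elems S. \<forall>u v. set u \<subseteq> S \<longrightarrow> set v \<subseteq> S \<longrightarrow> P (word u * f * word v)}"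
  have uv: "word u * f * word v \<in> elems S" if "set u \<subseteq> S" "set v \<subseteq> S" "f \<in> elems S" for u v f
    using that by simp
  have J_diff: "a - b \<in> J" if "a \<in> J" "b \<in> J" for a b
    using that assms(3)[OF uv uv]
    by (simp add: J_def right_diff_distrib left_diff_distrib)
  have J_0: "0 \<in> J" using assms(2) by (simp add: J_def)
  have J_minus: "- a \<in> J" if "a \<in> J" for a using J_diff[OF J_0 that] by simp
  have J_add: "a + b \<in> J" if "a \<in> J" "b \<in> J" for a b using J_diff[OF that(1) J_minus[OF that(2)]] by simp
  have J_elems: "J \<subseteq> elems S" unfolding J_def by blast
  have word_J: "word w * a \<in> J \<and> a * word w \<in> J" if "a \<in> J" "set w \<subseteq> S" for a w
  proof -
    have "P (word u * (word w * a) * word v) \<and> P (word u * (a * word w) * word v)"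
      if "set u \<subseteq> S" "set v \<subseteq> S" for u v
    proof -
      have "P (word (u @ w) * a * word v)" "P (word u * a * word (w @ v))"
        using that \<open>a \<in> J\<close> \<open>set w \<subseteq> S\<close> unfolding J_def by simp_all
      then show ?thesis by (simp only: word_append mult.assoc)
    qed
    then show ?thesis
      using that J_elems by (auto simp: J_def subset_iff[of _ "elems S"])
  qed
  have "ideal J (free_alg S)"
  proof (rule idealI)
    show "ring (free_alg S)" by (rule ring_free_alg)
    show "subgroup J (add_monoid (free_alg S))"
    proof (rule F.add.subgroupI)
      show "J \<subseteq> carrier (free_alg S)" using J_elems by (simp add: carrier_free_alg)
    next
      fix a assume a: "a \<in> J"
      then have "a \<in> elems S" using J_elems by blast
      then show "\<ominus>\<^bsub>free_alg S\<^esub> a \<in> J" using J_minus[OF a] by simp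
    qed (use J_0 J_add in auto)
    fix a x assume a: "a \<in> J" and "x \<in> carrier (free_alg S)"
    then have "x \<in> elems S" by (simp add: carrier_free_alg)
    then have "x * a \<in> J \<and> a * x \<in> J"
    proof (induction x rule: elems_induct)
      case (diff b c)
      then show ?case using J_diff[of "b * a" "c * a"] J_diff[of "a * b" "a * c"]
        by (simp add: right_diff_distrib left_diff_distrib)
    qed (use word_J[OF a] J_0 in auto)
    then show "x \<otimes>\<^bsub>free_alg S\<^esub> a \<in> J" "a \<otimes>\<^bsub>free_alg S\<^esub> x \<in> J" by auto
  qed
  moreover have "R \<subseteq> J" using R assms(4) by (auto simp: J_def)
  ultimately have "f \<in> J" using F.genideal_minimal assms(1) by blast
  then have "P (word [] * f * word [])" unfolding J_def using empty_subsetI by fastforce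
  then show ?thesis by (simp add: word_Nil)
qed

lemma ring_presented_alg: "ring (presented_alg S R)"
  unfolding presented_alg_def by (rule I.quotient_is_ring)

lemma carrier_presented_alg: "carrier (presented_alg S R) = residue_class S R ` elems S"
  by (auto simp: presented_alg_def FactRing_def A_RCOSETS_def' residue_class_def carrier_free_alg)

lemma residue_class_hom: "residue_class S R \<in> ring_hom (free_alg S) (presented_alg S R)"
  using I.rcos_ring_hom unfolding presented_alg_def residue_class_def by simp

lemma residue_class_mult:
  "a \<in> elems S \<Longrightarrow> b \<in> elems S \<Longrightarrow>
   residue_class S R a \<otimes>\<^bsub>presented_alg S R\<^esub> residue_class S R b = residue_class S R (a * b)"
  using ring_hom_mult[OF residue_class_hom] by (simp add: carrier_free_alg)

lemma residue_class_add:
  "a \<in> elems S \<Longrightarrow> b \<in> elems S \<Longrightarrow>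
   residue_class S R a \<oplus>\<^bsub>presented_alg S R\<^esub> residue_class S R b = residue_class S R (a + b)"
  using ring_hom_add[OF residue_class_hom] by (simp add: carrier_free_alg)

lemma residue_class_one: "\<one>\<^bsub>presented_alg S R\<^esub> = residue_class S R 1"
  using ring_hom_one[OF residue_class_hom] by simp

lemma residue_class_zero: "\<zero>\<^bsub>presented_alg S R\<^esub> = residue_class S R 0"
  using ring_hom_zero[OF residue_class_hom ring_free_alg ring_presented_alg] by simp

lemma residue_class_closed: "a \<in> elems S \<Longrightarrow> residue_class S R a \<in> carrier (presented_alg S R)"
  by (simp add: carrier_presented_alg)

lemma residue_class_minus:
  assumes "a \<in> elems S"
  shows "\<ominus>\<^bsub>presented_alg S R\<^esub> residue_class S R a = residue_class S R (- a)"
proof -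
  interpret Q: ring "presented_alg S R" by (rule ring_presented_alg)
  show ?thesis
    using assms residue_class_add[of "- a" a]
    by (intro Q.minus_equality) (simp_all add: residue_class_closed residue_class_zero)
qed

lemma residue_class_eq_iff:
  assumes "a \<in> elems S" "b \<in> elems S"
  shows "residue_class S R a = residue_class S R b \<longleftrightarrow> a - b \<in> idl S R"
proof -
  have "a \<ominus>\<^bsub>free_alg S\<^esub> b = a - b" using assms by (simp add: a_minus_def)
  then show ?thesis
    using F.quotient_eq_iff_same_a_r_cos[OF ideal_idl, of a b] assms
    by (simp add: carrier_free_alg residue_class_def)
qed

end

lemmas idl_induct = idl_induct_raw [consumes 2, case_names zero diff rel]

section \<open>Words up to sign: sorting and straightening\<close>

text \<open>
  The intended reading is that the words \<open>u \<sim> v\<close> agree up to sign in the algebra and that a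
  vanishing word is zero there.  The relations used to rewrite words consist of two words with
  coefficients $\pm 1$ or of a single word, so that signs need not be tracked.
\<close>

locale word_congruence =
  fixes sim :: "'a list \<Rightarrow> 'a list \<Rightarrow> bool" (infix "\<sim>" 50) and vanishing :: "'a list \<Rightarrow> bool"
  assumes sim_refl [simp]: "u \<sim> u"
    and sim_sym: "u \<sim> v \<Longrightarrow> v \<sim> u"
    and sim_trans [trans]: "u \<sim> v \<Longrightarrow> v \<sim> w \<Longrightarrow> u \<sim> w"
    and sim_context: "u \<sim> v \<Longrightarrow> a @ u @ b \<sim> a @ v @ b"
    and vanishing_context: "vanishing u \<Longrightarrow> vanishing (a @ u @ b)"
    and vanishing_sim: "u \<sim> v \<Longrightarrow> vanishing v \<Longrightarrow> vanishing u"
begin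

lemma sim_append_right: "u \<sim> v \<Longrightarrow> u @ b \<sim> v @ b"
  using sim_context[of u v "[]" b] by simp

lemma sim_append_left: "u \<sim> v \<Longrightarrow> a @ u \<sim> a @ v"
  using sim_context[of u v a "[]"] by simp

lemma sim_Cons: "u \<sim> v \<Longrightarrow> x # u \<sim> x # v"
  using sim_append_left[of u v "[x]"] by simp

lemma move_letter: "(\<And>x. x \<in> set u \<Longrightarrow> [j, x] \<sim> [x, j]) \<Longrightarrow> j # u \<sim> u @ [j]"
proof (induction u)
  case (Cons x u)
  have "j # x # u \<sim> x # j # u"
    using sim_append_right[OF Cons.prems[of x], of u] by simp
  also have "\<dots> \<sim> x # u @ [j]"
    using Cons by (intro sim_Cons) simp
  finally show ?case by simp
qed simp

end

subsection \<open>Sorted monomials\<close>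

fun xword :: "nat \<Rightarrow> nat list \<Rightarrow> nat list" where
  "xword k [] = []"
| "xword k (a # as) = replicate a k @ xword (Suc k) as"

lemma set_xword: "set (xword k as) \<subseteq> {k..<k + length as}"
  by (induction k as rule: xword.induct) (auto simp: subset_iff)

lemma xword_zeros: "xword k (replicate m 0) = []"
  by (induction m arbitrary: k) auto

text \<open>
  Insertion of a letter into a sorted word; together with induction this is insertion sort.
\<close>

lemma (in word_congruence) sort_xword:
  fixes f :: "nat \<Rightarrow> 'a"
  assumes comm: "\<And>i j. i \<noteq> j \<Longrightarrow> [f i, f j] \<sim> [f j, f i]"
  shows "j \<in> {k..<k + length as} \<Longrightarrow>
    \<exists>as'. length as' = length as \<and> f j # map f (xword k as) \<sim> map f (xword k as')"
proof (induction k as rule: xword.induct)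
  case (2 k a as)
  show ?case
  proof (cases "j = k")
    case True
    then show ?thesis by (intro exI[of _ "Suc a # as"]) simp
  next
    case False
    with 2 obtain as' where as': "length as' = length as"
      "f j # map f (xword (Suc k) as) \<sim> map f (xword (Suc k) as')"
      by auto
    have "f j # replicate a (f k) \<sim> replicate a (f k) @ [f j]"
      by (rule move_letter) (use comm False in auto)
    then have "f j # map f (xword k (a # as)) \<sim> replicate a (f k) @ f j # map f (xword (Suc k) as)"
      using sim_append_right[of "f j # replicate a (f k)" "replicate a (f k) @ [f j]" "map f (xword (Suc k) as)"]
      by simp
    also have "\<dots> \<sim> map f (xword k (a # as'))"
      using sim_append_left[OF as'(2)] by simp
    finally show ?thesis using as'(1) by (intro exI[of _ "a # as'"]) simp
  qed
qed simp

subsection \<open>Normal forms of type B words\<close>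

text \<open>
  For \<open>n = k + d\<close> and \<open>m \<le> 2 * d + 1\<close> this is the suffix of length \<open>m\<close> of
  $t_k \cdots t_n \cdots t_k$.  These suffixes are reduced words of the shortest representatives of
  the left cosets of the Weyl group generated by $t_{k+1}, \dots, t_n$ in the one generated by
  $t_k, \dots, t_n$.
\<close>

fun coset_word :: "nat \<Rightarrow> nat \<Rightarrow> nat \<Rightarrow> nat list" where
  "coset_word 0 k m = (if m = 0 then [] else [k])"
| "coset_word (Suc d) k m =
     (if m = 0 then [] else if m \<le> 2 * Suc d then coset_word d (Suc k) (m - 1) @ [k]
      else k # coset_word d (Suc k) (m - 2) @ [k])"

fun nf_word :: "nat \<Rightarrow> nat list \<Rightarrow> nat list" where
  "nf_word k [] = []"
| "nf_word k (m # ms) = coset_word (length ms) k m @ nf_word (Suc k) ms"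

text \<open>
  The bounds on the entries are those of the suffixes in \<^const>\<open>coset_word\<close>, hence the codes of
  length $n$ are in bijection with the Weyl group of type $B_n$.
\<close>

fun is_code :: "nat list \<Rightarrow> bool" where
  "is_code [] \<longleftrightarrow> True"
| "is_code (m # ms) \<longleftrightarrow> m \<le> 2 * length ms + 1 \<and> is_code ms"

lemma coset_word_0 [simp]: "coset_word d k 0 = []"
  by (cases d) auto

lemma set_coset_word: "set (coset_word d k m) \<subseteq> {k..k + d}"
  by (induction d k m rule: coset_word.induct) (auto simp: subset_iff Suc_le_eq less_imp_le_nat)

lemma length_coset_word: "m \<le> 2 * d + 1 \<Longrightarrow> length (coset_word d k m) = m"
  by (induction d k m rule: coset_word.induct) auto

lemma set_nf_word: "set (nf_word k ms) \<subseteq> {k..<k + length ms}"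
proof (induction k ms rule: nf_word.induct)
  case (2 k m ms)
  then show ?case using set_coset_word[of "length ms" k m] by (force simp: subset_iff)
qed simp

lemma length_nf_word: "is_code ms \<Longrightarrow> length (nf_word k ms) = sum_list ms"
  by (induction k ms rule: nf_word.induct) (auto simp: length_coset_word)

locale type_B_words = word_congruence sim vanishing
  for sim :: "nat list \<Rightarrow> nat list \<Rightarrow> bool" (infix "\<sim>" 50) and vanishing +
  fixes n :: nat
  assumes square: "i \<in> {1..n} \<Longrightarrow> vanishing [i, i]"
    and far: "i \<in> {1..n} \<Longrightarrow> j \<in> {1..n} \<Longrightarrow> Suc i < j \<Longrightarrow> [i, j] \<sim> [j, i]"
    and braid3: "1 \<le> i \<Longrightarrow> Suc i < n \<Longrightarrow> [i, Suc i, i] \<sim> [Suc i, i, Suc i]"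
    and braid4: "1 \<le> i \<Longrightarrow> Suc i = n \<Longrightarrow> [Suc i, i, Suc i, i] \<sim> [i, Suc i, i, Suc i]"
begin

lemma move_far: "1 \<le> k \<Longrightarrow> k \<le> n \<Longrightarrow> set u \<subseteq> {Suc (Suc k)..n} \<Longrightarrow> k # u \<sim> u @ [k]"
  by (intro move_letter far) (auto simp: subset_iff)

text \<open>
  If $c$ is a shortest coset representative, then $t_j c$ is longer and again one, or it is shorter
  and the product vanishes, or it lies in the coset of $c$ and equals $c\,t_{j'}$.  The induction
  strips the outer letters $t_k$ from the suffix, which leaves a suffix for $k + 1$.
\<close>

lemma straighten:
  assumes "n = k + d" "1 \<le> k" "j \<in> {k..n}" "m \<le> 2 * d + 1"
  shows "vanishing (j # coset_word d k m) \<or>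
    (m < 2 * d + 1 \<and> j # coset_word d k m \<sim> coset_word d k (Suc m)) \<or>
    (\<exists>j'\<in>{k<..n}. j # coset_word d k m \<sim> coset_word d k m @ [j'])"
  using assms
proof (induction d arbitrary: k m j)
  case 0
  then show ?case using square[of k] by (cases m) auto
next
  case (Suc d)
  let ?v = "coset_word d (Suc k)"
  have n: "n = Suc k + d" and k: "1 \<le> k" "1 \<le> Suc k" and sd: "\<And>m. set (?v m) \<subseteq> {Suc k..n}"
    using Suc.prems set_coset_word[of d "Suc k"] by auto
  consider "m = 0" | "1 \<le> m" "m \<le> 2 * Suc d" | "m = 2 * Suc d + 1"
    using Suc.prems by linarith
  then show ?case
  proof cases
    case 1
    show ?thesis
    proof (cases "j = k")
      case False
      then show ?thesis using 1 Suc.prems by (intro disjI2 bexI[of _ j]) auto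
    qed (use 1 in simp)
  next
    case 2
    then have w: "coset_word (Suc d) k m = ?v (m - 1) @ [k]" by simp
    show ?thesis
    proof (cases "j = k")
      case False
      with Suc.prems have j: "j \<in> {Suc k..n}" by simp
      from 2 have "m - 1 \<le> 2 * d + 1" by simp
      from Suc.IH[OF n k(2) j this] consider "vanishing (j # ?v (m - 1))"
        | "m - 1 < 2 * d + 1" "j # ?v (m - 1) \<sim> ?v (Suc (m - 1))"
        | j' where "j' \<in> {Suc k<..n}" "j # ?v (m - 1) \<sim> ?v (m - 1) @ [j']"
        by blast
      then show ?thesis
      proof cases
        case 1
        then show ?thesis using vanishing_context[of _ "[]" "[k]"] w by fastforce
      next
        assume m: "m - 1 < 2 * d + 1" and next_word: "j # ?v (m - 1) \<sim> ?v (Suc (m - 1))"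
        have "Suc m \<le> 2 * Suc d" using m 2 by arith
        then have "coset_word (Suc d) k (Suc m) = ?v (Suc (m - 1)) @ [k]" using 2 by simp
        then show ?thesis
          using sim_append_right[OF next_word, of "[k]"] \<open>Suc m \<le> _\<close> w by simp
      next
        case (3 j')
        have "j # ?v (m - 1) @ [k] \<sim> ?v (m - 1) @ [j', k]"
          using sim_append_right[OF 3(2), of "[k]"] by simp
        also have "\<dots> \<sim> ?v (m - 1) @ [k, j']"
          using 3(1) k Suc.prems by (intro sim_append_left sim_sym[OF far]) auto
        finally show ?thesis using 3(1) w by auto
      qed
    next
      case True
      \<comment> \<open>Unless it is extended or squared, \<open>k\<close> meets \<open>Suc k\<close> and a braid relation turns it into \<open>Suc k\<close>.\<close>
      consider "m = 2 * Suc d" | "m = 1" | "2 \<le> m" "m < 2 * Suc d" using 2 by linarith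
      then show ?thesis
      proof cases
        case 1
        then show ?thesis using True w by simp
      next
        case 2
        then show ?thesis using True w square[of k] Suc.prems by simp
      next
        case 3
        then obtain d' where d: "d = Suc d'" by (cases d) auto
        let ?u = "coset_word d' (Suc (Suc k)) (m - 2)"
        have v: "?v (m - 1) = ?u @ [Suc k]" using 3 d by (simp add: numeral_2_eq_2)
        have "k # ?u @ [Suc k, k] \<sim> ?u @ [k, Suc k, k]"
          using sim_append_right[OF move_far[of k ?u], of "[Suc k, k]"] k n d
            set_coset_word[of d' "Suc (Suc k)" "m - 2"] by simp
        also have "\<dots> \<sim> ?u @ [Suc k, k, Suc k]"
          using k n d by (intro sim_append_left braid3) auto
        finally have "j # coset_word (Suc d) k m \<sim> coset_word (Suc d) k m @ [Suc k]"
          using w v True by simp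
        then show ?thesis using n by auto
      qed
    qed
  next
    case 3
    let ?f = "?v (2 * d + 1)"
    have w: "coset_word (Suc d) k m = k # ?f @ [k]" using 3 by simp
    consider "j = k" | "j = Suc k" | "Suc k < j" using Suc.prems by fastforce
    then show ?thesis
    proof cases
      case 1
      then show ?thesis
        using w vanishing_context[OF square[of k], of "[]" "?f @ [k]"] Suc.prems by simp
    next
      case 3
      then have j: "j \<in> {Suc k..n}" using Suc.prems by simp
      have "[j, k] \<sim> [k, j]" using 3 k Suc.prems by (intro sim_sym[OF far]) auto
      then have jk: "j # k # ?f @ [k] \<sim> k # j # ?f @ [k]"
        using sim_append_right[of "[j, k]" "[k, j]" "?f @ [k]"] by simp
      from Suc.IH[OF n k(2) j order_refl] consider "vanishing (j # ?f)"
        | j' where "j' \<in> {Suc k<..n}" "j # ?f \<sim> ?f @ [j']"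
        by blast
      then show ?thesis
      proof cases
        case 1
        then have "vanishing (k # j # ?f @ [k])" using vanishing_context[of _ "[k]" "[k]"] by fastforce
        then show ?thesis using vanishing_sim[OF jk] w by simp
      next
        case (2 j')
        have "k # j # ?f @ [k] \<sim> k # ?f @ [j', k]"
          using sim_context[OF 2(2), of "[k]" "[k]"] by simp
        also have "\<dots> \<sim> k # ?f @ [k, j']"
          using 2(1) k Suc.prems by (intro sim_Cons sim_append_left sim_sym[OF far]) auto
        finally show ?thesis
          unfolding w using sim_trans[OF jk] 2(1) by (intro disjI2 bexI[of _ j']) auto
      qed
    next
      case 2
      \<comment> \<open>The longest suffix starts and ends with \<open>k\<close>: a braid relation is used at each end, or the one of length four if the ends meet.\<close>
      have "Suc k # k # ?f @ [k] \<sim> k # ?f @ [k, Suc k]"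
      proof (cases d)
        case 0
        then show ?thesis using braid4[of k] k n by simp
      next
        case (Suc d')
        let ?u = "coset_word d' (Suc (Suc k)) (2 * d' + 1)"
        have v: "?f = Suc k # ?u @ [Suc k]" using Suc by simp
        have b: "[k, Suc k, k] \<sim> [Suc k, k, Suc k]"
          using k n Suc by (intro braid3) auto
        have "[Suc k, k, Suc k] @ ?u @ [Suc k, k] \<sim> [k, Suc k, k] @ ?u @ [Suc k, k]"
          using sim_append_right[OF sim_sym[OF b]] by fast
        also have "\<dots> \<sim> [k, Suc k] @ ?u @ [k, Suc k, k]"
          using sim_context[OF move_far[of k ?u], of "[k, Suc k]" "[Suc k, k]"] k n Suc
            set_coset_word[of d' "Suc (Suc k)"] by simp
        also have "\<dots> \<sim> [k, Suc k] @ ?u @ [Suc k, k, Suc k]"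
          using sim_append_left[OF b, of "[k, Suc k] @ ?u"] by simp
        finally show ?thesis using v by simp
      qed
      then show ?thesis
        unfolding w using 2 n by (intro disjI2 bexI[of _ "Suc k"]) auto
    qed
  qed
qed

text \<open>
  A letter that passes the first factor has an index larger than \<open>k\<close>, as needed for the induction
  on the remaining factors.
\<close>

lemma straighten_nf_word:
  assumes "n + 1 = k + length ms" "1 \<le> k" "j \<in> {k..n}" "is_code ms"
  shows "vanishing (j # nf_word k ms) \<or>
    (\<exists>ms'. length ms' = length ms \<and> is_code ms' \<and> j # nf_word k ms \<sim> nf_word k ms')"
  using assms
proof (induction ms arbitrary: k j)
  case Nil
  then show ?case by simp
next
  case (Cons m ms)
  let ?c = "coset_word (length ms) k" and ?r = "nf_word (Suc k) ms"
  from Cons.prems have *: "n = k + length ms" "1 \<le> k" "j \<in> {k..n}" "m \<le> 2 * length ms + 1" by auto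
  from straighten[OF *] consider "vanishing (j # ?c m)"
    | "m < 2 * length ms + 1" "j # ?c m \<sim> ?c (Suc m)"
    | j' where "j' \<in> {k<..n}" "j # ?c m \<sim> ?c m @ [j']"
    by blast
  then show ?case
  proof cases
    case 1
    then show ?thesis using vanishing_context[of _ "[]" ?r] by fastforce
  next
    case 2
    then show ?thesis using sim_append_right[OF 2(2), of ?r] Cons.prems
      by (intro disjI2 exI[of _ "Suc m # ms"]) simp
  next
    case (3 j')
    have s: "j # ?c m @ ?r \<sim> ?c m @ j' # ?r"
      using sim_append_right[OF 3(2), of ?r] by simp
    have "vanishing (j' # ?r) \<or> (\<exists>ms'. length ms' = length ms \<and> is_code ms' \<and> j' # ?r \<sim> nf_word (Suc k) ms')"
      using Cons.prems 3(1) by (intro Cons.IH) auto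
    then show ?thesis
    proof (elim disjE exE conjE)
      assume "vanishing (j' # ?r)"
      then show ?thesis using vanishing_sim[OF s] vanishing_context[of _ "?c m" "[]"] by simp
    next
      fix ms' assume ms': "length ms' = length ms" "is_code ms'" "j' # ?r \<sim> nf_word (Suc k) ms'"
      show ?thesis using sim_trans[OF s sim_append_left[OF ms'(3)]] ms' Cons.prems
        by (intro disjI2 exI[of _ "m # ms'"]) simp
    qed
  qed
qed

lemma word_nf:
  assumes "set w \<subseteq> {1..n}"
  shows "vanishing w \<or> (\<exists>ms. length ms = n \<and> is_code ms \<and> w \<sim> nf_word 1 ms)"
  using assms
proof (induction w)
  case Nil
  have "nf_word k (replicate l 0) = []" "is_code (replicate l 0)" for k l
    by (induction l arbitrary: k) auto
  then show ?case by (intro disjI2 exI[of _ "replicate n 0"]) simp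
next
  case (Cons j w)
  then consider "vanishing w" | ms where "length ms = n" "is_code ms" "w \<sim> nf_word 1 ms" by auto
  then show ?case
  proof cases
    case 1
    then show ?thesis using vanishing_context[of w "[j]" "[]"] by simp
  next
    case 2
    have s: "j # w \<sim> j # nf_word 1 ms" using 2(3) by (rule sim_Cons)
    show ?thesis
      using straighten_nf_word[of 1 ms j] Cons.prems 2 vanishing_sim[OF s] sim_trans[OF s] by auto
  qed
qed

end

section \<open>Twisted derivations of the free ring\<close>

text \<open>
  An index \<open>j < n\<close> stands for $\partial_j^-$ and the index \<open>n\<close> for $\partial_n^B$, which lets most
  arguments treat the two kinds of operators alike.  With this convention \<open>hits n j i\<close> says that the
  operator with index \<open>j\<close> maps $x_i$ to 1.
\<close>

definition swap_index :: "nat \<Rightarrow> nat \<Rightarrow> nat \<Rightarrow> nat" where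
  "swap_index n j i = (if j = n then i else if i = j then Suc j else if i = Suc j then j else i)"

definition hits :: "nat \<Rightarrow> nat \<Rightarrow> nat \<Rightarrow> bool" where
  "hits n j i \<longleftrightarrow> i = j \<or> (j \<noteq> n \<and> i = Suc j)"

fun hits_letter :: "nat \<Rightarrow> nat \<Rightarrow> letter \<Rightarrow> bool" where
  "hits_letter n j (GX i) \<longleftrightarrow> hits n j i"
| "hits_letter n j l \<longleftrightarrow> False"

fun swap_letter :: "nat \<Rightarrow> nat \<Rightarrow> letter \<Rightarrow> letter" where
  "swap_letter n j (GX i) = GX (swap_index n j i)"
| "swap_letter n j l = l"

fun der_word :: "nat \<Rightarrow> nat \<Rightarrow> letter list \<Rightarrow> letter free_ring" where
  "der_word n j [] = 0"
| "der_word n j (l # w) =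
     (if hits_letter n j l then word w else 0) - gen (swap_letter n j l) * der_word n j w"

text \<open>
  The operators are defined on the whole free ring instead of skew polynomials: the relations between
  them already hold there, as identities rather than congruences modulo an ideal.
\<close>

definition der :: "nat \<Rightarrow> nat \<Rightarrow> letter free_ring \<Rightarrow> letter free_ring" where
  "der n j f = frag_extend (\<lambda>w. der_word n j (letters w)) f"

definition twist :: "nat \<Rightarrow> nat \<Rightarrow> letter free_ring \<Rightarrow> letter free_ring" where
  "twist n j f = frag_extend
     (\<lambda>w. frag_cmul ((- 1) ^ length (letters w)) (word (map (swap_letter n j) (letters w)))) f"

lemma der_simps [simp]:
  "der n j 0 = 0" "der n j 1 = 0"
  "der n j (a + b) = der n j a + der n j b"
  "der n j (a - b) = der n j a - der n j b"
  "der n j (- a) = - der n j a"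
  by (simp_all add: der_def frag_extend_add frag_extend_diff frag_extend_minus flip: word_Nil)

lemma der_cmul: "der n j (frag_cmul c a) = frag_cmul c (der n j a)"
  by (simp add: der_def frag_extend_cmul)

lemma twist_simps [simp]:
  "twist n j 0 = 0" "twist n j 1 = 1"
  "twist n j (a + b) = twist n j a + twist n j b"
  "twist n j (a - b) = twist n j a - twist n j b"
  "twist n j (- a) = - twist n j a"
  by (simp_all add: twist_def frag_extend_add frag_extend_diff frag_extend_minus flip: word_Nil)

lemma elems_UNIV [simp]: "f \<in> elems UNIV"
  by (simp add: elems_def)

lemma gen_mult_word: "gen l * word w = word (l # w)"
  by (simp only: word_Cons)

lemma der_gen_mult:
  "der n j (gen l * f) = (if hits_letter n j l then f else 0) - gen (swap_letter n j l) * der n j f"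
  using elems_UNIV[of f]
proof (induction f rule: elems_induct)
  case (word w)
  show ?case by (simp add: gen_mult_word der_def)
qed (simp_all add: right_diff_distrib)

lemma der_x [simp]:
  "der n j (gx i * f) = (if hits n j i then f else 0) - gx (swap_index n j i) * der n j f"
  by (simp add: der_gen_mult)

lemma twist_gen_mult: "twist n j (gen l * f) = - gen (swap_letter n j l) * twist n j f"
  using elems_UNIV[of f]
proof (induction f rule: elems_induct)
  case (word w)
  have "word (map (swap_letter n j) (l # w)) = gen (swap_letter n j l) * word (map (swap_letter n j) w)"
    by (simp only: list.map word_Cons)
  then show ?case
    by (simp add: gen_mult_word twist_def mult_frag_cmul) (simp add: frag_cmul_eq_mult)
qed (simp_all add: right_diff_distrib)

lemma gen_eq_word: "gen l = word [l]"
  by (simp add: gen_def)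

lemma free_induct [case_names zero one gen diff]:
  fixes f :: "'g free_ring"
  assumes "P 0" "P 1" "\<And>l f. P f \<Longrightarrow> P (gen l * f)" "\<And>a b. P a \<Longrightarrow> P b \<Longrightarrow> P (a - b)"
  shows "P f"
  using elems_UNIV[of f]
proof (induction f rule: elems_induct)
  case (word w)
  show ?case
    by (induction w) (use assms in \<open>simp_all add: word_Nil word_Cons\<close>)
qed (use assms in auto)

lemma twist_mult: "twist n j (f * g) = twist n j f * twist n j g"
  by (induction f rule: free_induct)
    (simp_all add: twist_gen_mult mult.assoc left_diff_distrib)

lemma twist_x: "twist n j (gx i) = - gx (swap_index n j i)"
  using twist_gen_mult[of n j "GX i" 1] by simp

lemma der_mult: "der n j (f * g) = der n j f * g + twist n j f * der n j g"
  by (induction f rule: free_induct)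
    (simp_all add: twist_gen_mult der_gen_mult mult.assoc left_diff_distrib right_diff_distrib distrib_left)

lemma x_induct [consumes 1, case_names zero one x diff]:
  assumes "f \<in> elems (GX ` A)"
    and "P 0" "P 1" "\<And>i f. i \<in> A \<Longrightarrow> f \<in> elems (GX ` A) \<Longrightarrow> P f \<Longrightarrow> P (gx i * f)"
    and "\<And>a b. P a \<Longrightarrow> P b \<Longrightarrow> P (a - b)"
  shows "P f"
  using assms(1)
proof (induction f rule: elems_induct)
  case (word w)
  then show ?case
    by (induction w) (use assms in \<open>auto simp add: word_Nil word_Cons\<close>)
qed (use assms in auto)

lemma elems_der_twist:
  assumes "f \<in> elems S" "swap_letter n j ` S \<subseteq> S"
  shows "der n j f \<in> elems S \<and> twist n j f \<in> elems S"
  using assms(1)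
proof (induction f rule: elems_induct)
  case (word w)
  then show ?case
  proof (induction w)
    case (Cons l w)
    then show ?case using assms(2)
      by (auto simp add: word_Cons der_gen_mult twist_gen_mult)
  qed (simp add: word_Nil)
qed (use assms in auto)

lemma swap_letter_x: "1 \<le> k \<Longrightarrow> k \<le> j \<Longrightarrow> j \<le> n \<Longrightarrow> swap_letter n j ` GX ` {k..n} \<subseteq> GX ` {k..n}"
  by (auto simp: swap_index_def)

lemma elems_der [simp]: "1 \<le> k \<Longrightarrow> k \<le> j \<Longrightarrow> j \<le> n \<Longrightarrow> f \<in> elems (GX ` {k..n}) \<Longrightarrow> der n j f \<in> elems (GX ` {k..n})"
  and elems_twist [simp]: "1 \<le> k \<Longrightarrow> k \<le> j \<Longrightarrow> j \<le> n \<Longrightarrow> f \<in> elems (GX ` {k..n}) \<Longrightarrow> twist n j f \<in> elems (GX ` {k..n})"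
  using elems_der_twist swap_letter_x by blast+

lemma elems_der_range [simp]: "f \<in> elems (range GX) \<Longrightarrow> der n j f \<in> elems (range GX)"
  by (rule conjunct1[OF elems_der_twist]) auto

subsection \<open>The relations between the operators\<close>

text \<open>
  All relations have the same proof.  An operator built from the \<^const>\<open>der\<close> moves past $x_i$ at
  the cost of permuting the variables and of shorter correction terms; in the combination that a
  relation asserts to vanish the correction terms cancel.  As it kills 1, it kills all polynomials.
\<close>

lemma der_square: "f \<in> elems (range GX) \<Longrightarrow> der n j (der n j f) = 0"
proof (induction f rule: x_induct)
  case (x i f)
  have "swap_index n j (swap_index n j i) = i" "hits n j (swap_index n j i) = hits n j i"
    by (auto simp: swap_index_def hits_def)
  with x show ?case by simp
qed simp_all

lemma der_far:
  assumes "Suc i < j" "j \<le> n"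
  shows "f \<in> elems (range GX) \<Longrightarrow> der n i (der n j f) = - der n j (der n i f)"
proof (induction f rule: x_induct)
  case (x l f)
  consider "l = i" | "l = Suc i" | "l = j" | "l = Suc j" | "l \<noteq> i" "l \<noteq> Suc i" "l \<noteq> j" "l \<noteq> Suc j"
    by blast
  then show ?case
    by cases (use x.IH assms in \<open>simp_all add: swap_index_def hits_def right_diff_distrib\<close>)
qed simp_all

lemma der_braid3:
  assumes "Suc j < n"
  shows "f \<in> elems (range GX) \<Longrightarrow>
    der n j (der n (Suc j) (der n j f)) = der n (Suc j) (der n j (der n (Suc j) f))"
proof (induction f rule: x_induct)
  case (x l f)
  consider "l = j" | "l = Suc j" | "l = Suc (Suc j)" | "l \<noteq> j" "l \<noteq> Suc j" "l \<noteq> Suc (Suc j)"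
    by blast
  then show ?case
    by cases (use x assms in \<open>simp_all add: swap_index_def hits_def right_diff_distrib der_square\<close>)
qed simp_all

lemma der_braid4:
  assumes "n = Suc j"
  shows "f \<in> elems (range GX) \<Longrightarrow>
    der n n (der n j (der n n (der n j f))) = - der n j (der n n (der n j (der n n f)))"
proof (induction f rule: x_induct)
  case (x l f)
  consider "l = j" | "l = Suc j" | "l \<noteq> j" "l \<noteq> Suc j"
    by blast
  then show ?case
    by cases (use x assms in \<open>simp_all add: swap_index_def hits_def right_diff_distrib der_square\<close>)
qed simp_all

section \<open>The action of the free ring on skew polynomials\<close>

definition tletter :: "nat \<Rightarrow> nat \<Rightarrow> letter" where
  "tletter n j = (if j = n then GB else GD j)"

fun act_letter :: "nat \<Rightarrow> letter \<Rightarrow> letter free_ring \<Rightarrow> letter free_ring" where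
  "act_letter n (GX i) g = gx i * g"
| "act_letter n (GD j) g = der n j g"
| "act_letter n GB g = der n n g"

definition act :: "nat \<Rightarrow> letter free_ring \<Rightarrow> letter free_ring \<Rightarrow> letter free_ring" where
  "act n f g = frag_extend (\<lambda>w. foldr (act_letter n) (letters w) g) f"

lemma act_letter_tletter [simp]: "act_letter n (tletter n j) = der n j"
  by (rule ext) (simp add: tletter_def)

lemma act_letter_simps [simp]:
  "act_letter n l 0 = 0"
  "act_letter n l (a + b) = act_letter n l a + act_letter n l b"
  "act_letter n l (a - b) = act_letter n l a - act_letter n l b"
  "act_letter n l (- a) = - act_letter n l a"
  by (cases l; simp add: algebra_simps)+

lemma act_word: "act n (word w) g = foldr (act_letter n) w g"
  by (simp add: act_def)

lemma act_left_simps [simp]: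
  "act n 0 g = 0" "act n 1 g = g"
  "act n (a + b) g = act n a g + act n b g"
  "act n (a - b) g = act n a g - act n b g"
  "act n (- a) g = - act n a g"
  "act n (frag_cmul c a) g = frag_cmul c (act n a g)"
  by (simp_all add: act_def frag_extend_add frag_extend_diff frag_extend_minus frag_extend_cmul flip: word_Nil)

lemma act_gen_mult: "act n (gen l * f) g = act_letter n l (act n f g)"
  using elems_UNIV[of f]
proof (induction f rule: elems_induct)
  case (word w)
  show ?case by (simp add: gen_mult_word act_word)
qed (simp_all add: right_diff_distrib)

lemma act_gen [simp]: "act n (gen l) g = act_letter n l g"
  using act_gen_mult[of n l 1 g] by simp

lemma act_mult: "act n (f * f') g = act n f (act n f' g)"
  by (induction f rule: free_induct) (simp_all add: act_gen_mult mult.assoc left_diff_distrib)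

lemma act_right_simps [simp]:
  "act n f 0 = 0"
  "act n f (a - b) = act n f a - act n f b"
  by (induction f rule: free_induct; simp add: act_gen_mult)+

section \<open>Linear independence of the normal forms\<close>

subsection \<open>Degrees and signs\<close>

abbreviation ders :: "nat \<Rightarrow> nat list \<Rightarrow> letter free_ring \<Rightarrow> letter free_ring" where
  "ders n ts \<equiv> foldr (der n) ts"

lemma act_tword: "act n (word (map (tletter n) ts)) g = ders n ts g"
  by (simp add: act_word foldr_map comp_def)

lemma ders_simps [simp]:
  "ders n ts 0 = 0" "ders n ts (a + b) = ders n ts a + ders n ts b"
  "ders n ts (a - b) = ders n ts a - ders n ts b"
  "ders n ts (- a) = - ders n ts a"
  "ders n ts (frag_cmul c a) = frag_cmul c (ders n ts a)"
  by (induction ts) (simp_all add: der_cmul)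

lemma ders_sum: "ders n ts (sum f A) = (\<Sum>a\<in>A. ders n ts (f a))"
  by (induction A rule: infinite_finite_induct) simp_all

lemma elems_ders_range [simp]: "f \<in> elems (range GX) \<Longrightarrow> ders n ts f \<in> elems (range GX)"
  by (induction ts) auto

definition pm_eq :: "'a::ab_group_add \<Rightarrow> 'a \<Rightarrow> bool" where
  "pm_eq a b \<longleftrightarrow> a = b \<or> a = - b"

lemma pm_eq_refl [simp]: "pm_eq a a" and pm_eq_0 [simp]: "pm_eq a 0 \<longleftrightarrow> a = 0"
  and pm_eq_sym: "pm_eq a b \<Longrightarrow> pm_eq b a" and pm_eq_minus [simp]: "pm_eq (- a) b \<longleftrightarrow> pm_eq a b"
  by (auto simp: pm_eq_def)

lemma pm_eq_trans [trans]: "pm_eq a b \<Longrightarrow> pm_eq b c \<Longrightarrow> pm_eq a c"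
  by (auto simp: pm_eq_def)

lemma pm_eq_cmul: "pm_eq (frag_cmul ((- 1) ^ i) a) a"
  by (cases "even i") (simp_all add: pm_eq_def)

lemma pm_eq_ders: "pm_eq a b \<Longrightarrow> pm_eq (ders n ts a) (ders n ts b)"
  by (auto simp: pm_eq_def)

lemma pm_eq_mult_left: "pm_eq a b \<Longrightarrow> pm_eq (c * a) (c * b)"
  for a b c :: "'a::ring"
  by (auto simp: pm_eq_def)

definition homog :: "nat set \<Rightarrow> nat \<Rightarrow> letter free_ring set" where
  "homog A d = {f \<in> elems (GX ` A). \<forall>w\<in>Poly_Mapping.keys f. length (letters w) = d}"

lemma homog_simps [simp]:
  "0 \<in> homog A d"
  "word (map GX u) \<in> homog A d \<longleftrightarrow> set u \<subseteq> A \<and> length u = d"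
  by (auto simp: homog_def)

lemma homog_diff [simp]: "a \<in> homog A d \<Longrightarrow> b \<in> homog A d \<Longrightarrow> a - b \<in> homog A d"
  using keys_diff[of a b] unfolding homog_def by (auto dest!: subsetD)

lemma homog_induct [consumes 1, case_names zero word diff]:
  assumes "f \<in> homog A d" and "P 0" and "\<And>u. set u \<subseteq> A \<Longrightarrow> length u = d \<Longrightarrow> P (word (map GX u))"
    and "\<And>a b. P a \<Longrightarrow> P b \<Longrightarrow> P (a - b)"
  shows "P f"
proof -
  have "Poly_Mapping.keys f \<subseteq> {FM (map GX u) | u. set u \<subseteq> A \<and> length u = d}"
  proof
    fix w assume w: "w \<in> Poly_Mapping.keys f"
    then have "letters w \<in> lists (GX ` A)" and len: "length (letters w) = d"
      using assms(1) by (auto simp: homog_def elems_def)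
    then obtain u where "letters w = map GX u" "u \<in> lists A"
      unfolding lists_image by blast
    then have "w = FM (map GX u) \<and> set u \<subseteq> A \<and> length u = d"
      using len by (cases w) auto
    then show "w \<in> {FM (map GX u) | u. set u \<subseteq> A \<and> length u = d}" by blast
  qed
  then show ?thesis
    by (induction f rule: frag_induction) (use assms in auto)
qed

lemma homog_x: "f \<in> homog A d \<Longrightarrow> i \<in> A \<Longrightarrow> gx i * f \<in> homog A (Suc d)"
proof (induction f rule: homog_induct)
  case (word u)
  have "gx i * word (map GX u) = word (map GX (i # u))"
    by (simp add: gen_mult_word)
  then show ?case using word by (simp only: homog_simps) simp
qed (simp_all add: right_diff_distrib)

lemma homog_1: "1 \<in> homog A d \<longleftrightarrow> d = 0"
  using homog_simps(2)[of "[]" A d] by (simp add: word_Nil)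

lemma homog_xpow: "k \<in> A \<Longrightarrow> gx k ^ m \<in> homog A m"
  by (induction m) (simp_all add: homog_1 homog_x)

lemma homog_elems: "f \<in> homog A d \<Longrightarrow> f \<in> elems (GX ` A)"
  by (simp add: homog_def)

lemma homog_der:
  assumes "1 \<le> k" "k \<le> j" "j \<le> n"
  shows "f \<in> homog {k..n} (Suc d) \<Longrightarrow> der n j f \<in> homog {k..n} d"
    and "f \<in> homog {k..n} 0 \<Longrightarrow> der n j f = 0"
proof -
  have *: "der n j (word (map GX u)) \<in> homog {k..n} (length u - 1) \<and> (u = [] \<longrightarrow> der n j (word (map GX u)) = 0)"
    if "set u \<subseteq> {k..n}" for u
    using that
  proof (induction u)
    case (Cons i u)
    have i: "swap_index n j i \<in> {k..n}" using Cons assms by (auto simp: swap_index_def)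
    have "gx (swap_index n j i) * der n j (word (map GX u)) \<in> homog {k..n} (length u)"
      using Cons homog_x[OF _ i, of "der n j (word (map GX u))" "length u - 1"]
      by (cases "u = []") auto
    then show ?case
      using Cons.prems by (simp add: word_Cons)
  qed (simp add: word_Nil)
  show "f \<in> homog {k..n} (Suc d) \<Longrightarrow> der n j f \<in> homog {k..n} d"
    by (induction f rule: homog_induct) (use * in force)+
  show "f \<in> homog {k..n} 0 \<Longrightarrow> der n j f = 0"
    by (induction f rule: homog_induct) (use * in force)+
qed

lemma homog_ders:
  assumes "1 \<le> k" "f \<in> homog {k..n} d" "set ts \<subseteq> {k..n}"
  shows "(length ts \<le> d \<longrightarrow> ders n ts f \<in> homog {k..n} (d - length ts)) \<and>
         (d < length ts \<longrightarrow> ders n ts f = 0)"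
  using assms(3)
proof (induction ts)
  case (Cons j ts)
  then show ?case
  proof (cases "length ts < d")
    case True
    then have "d - length ts = Suc (d - length (j # ts))" by simp
    then show ?thesis using Cons homog_der(1)[of k j n "ders n ts f" "d - length (j # ts)"] assms(1) True
      by simp
  next
    case False
    then show ?thesis using Cons homog_der(2)[of k j n "ders n ts f"] assms(1)
      by (cases "length ts = d") auto
  qed
qed (use assms in simp)

text \<open>
  The operators of index larger than $k$ kill $x_k$, and their twists map $x_k$ to $-x_k$.
\<close>

lemma ders_xpow_mult:
  assumes "set ts \<subseteq> {Suc k..}"
  shows "pm_eq (ders n ts (gx k ^ b * f)) (gx k ^ b * ders n ts f)"
proof (induction b)
  case (Suc b)
  have "pm_eq (ders n ts (gx k * g)) (gx k * ders n ts g)" for g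
    using assms
  proof (induction ts)
    case (Cons j ts)
    then have "pm_eq (der n j (ders n ts (gx k * g))) (der n j (gx k * ders n ts g))"
      by (auto simp: pm_eq_def)
    also have "pm_eq (der n j (gx k * ders n ts g)) (gx k * der n j (ders n ts g))"
      using Cons.prems by (auto simp: hits_def swap_index_def)
    finally show ?case by simp
  qed simp
  then have "pm_eq (ders n ts (gx k ^ Suc b * f)) (gx k * ders n ts (gx k ^ b * f))"
    by (simp add: mult.assoc)
  also have "pm_eq \<dots> (gx k * (gx k ^ b * ders n ts f))"
    using Suc by (rule pm_eq_mult_left)
  finally show ?case by (simp add: mult.assoc)
qed simp

lemma der_xpow: "Suc k \<le> j \<Longrightarrow> der n j (gx k ^ e) = 0"
  by (induction e) (auto simp: hits_def)

lemma ders_mult_xpow: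
  "set ts \<subseteq> {Suc k..} \<Longrightarrow> ders n ts (f * gx k ^ e) = ders n ts f * gx k ^ e"
  by (induction ts) (auto simp: der_mult der_xpow)

subsection \<open>Normal forms applied to matching monomials\<close>

text \<open>
  The operators obey the rules of the word calculus, so products of them can be straightened.
\<close>

interpretation ders: type_B_words
  "\<lambda>u v. \<forall>f\<in>elems (range GX). pm_eq (ders n u f) (ders n v f)"
  "\<lambda>u. \<forall>f\<in>elems (range GX). ders n u f = 0" n for n
proof (unfold_locales, goal_cases)
  case (3 u v w)
  then show ?case using pm_eq_trans by blast
next
  case (4 u v a b)
  then show ?case by (auto intro!: pm_eq_ders)
next
  case (6 u v)
  then show ?case by fastforce
next
  case (7 i)
  then show ?case by (simp add: der_square)
next
  case (8 i j)
  then show ?case by (simp add: der_far)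
next
  case (9 i)
  then show ?case by (simp add: der_braid3)
next
  case (10 i)
  then show ?case using der_braid4[of n i] by simp
qed (auto intro: pm_eq_sym)

text \<open>
  If $c_i$ is the coefficient of $x_i$ in a linear form, then $t_j$ maps the form to $c_j + c_{j+1}$
  for $j < n$ and to $c_n$ for $j = n$.
\<close>

lemma homog_1_killed:
  assumes "1 \<le> k" "f \<in> homog {k..n} 1" "\<And>j. j \<in> {k..n} \<Longrightarrow> der n j f = 0"
  shows "f = 0"
proof -
  define c where "c g i = Poly_Mapping.lookup g (FM [GX i])" for g :: "letter free_ring" and i
  have der_f: "der n j g = frag_cmul (c g j + (if j = n then 0 else c g (Suc j))) 1"
    if "g \<in> homog {k..n} 1" for g j
    using that
  proof (induction g rule: homog_induct)
    case (word u)
    then obtain i where "u = [i]" by (auto simp: length_Suc_conv)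
    then show ?case using der_x[of n j i 1] by (auto simp: c_def hits_def gen_eq_word)
  next
    case (diff a b)
    then show ?case by (simp add: c_def lookup_minus frag_cmul_distrib frag_cmul_diff_distrib)
  qed (simp add: c_def)
  have c_0: "c f j + (if j = n then 0 else c f (Suc j)) = 0" if "j \<in> {k..n}" for j
    using der_f[OF assms(2), of j] assms(3)[OF that] by simp
  have "c f j = 0" if "j \<le> n" "k \<le> j" for j
    using that
  proof (induction j rule: inc_induct)
    case base
    then show ?case using c_0[of n] by simp
  next
    case (step j)
    then show ?case using c_0[of j] by simp
  qed
  moreover have "\<exists>i\<in>{k..n}. w = FM [GX i]" if "w \<in> Poly_Mapping.keys f" for w
  proof -
    have "set (letters w) \<subseteq> GX ` {k..n}" "length (letters w) = 1"
      using that assms(2) by (auto simp: homog_def elems_def)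
    then show ?thesis by (cases w) (auto simp: length_Suc_conv)
  qed
  ultimately have "w \<notin> Poly_Mapping.keys f" for w
    by (metis atLeastAtMost_iff c_def in_keys_iff)
  then have "Poly_Mapping.keys f = {}" by blast
  then show ?thesis by simp
qed

text \<open>
  The image is a linear form.  It is killed by all $t_j$: straightening the product of $t_j$ with
  the longest suffix $P$ gives zero or $\pm P\,t_{j'}$ with $j' > k$, and $t_{j'}$ kills powers of $x_k$.
\<close>

lemma longest_coset_word_xpow:
  assumes "n = k + d" "1 \<le> k"
  shows "ders n (coset_word d k (2 * d + 1)) (gx k ^ (2 * d + 2)) = 0"
proof -
  let ?w = "coset_word d k (2 * d + 1)" and ?x = "gx k ^ (2 * d + 2)"
  have x: "?x \<in> homog {k..n} (2 * d + 2)" using assms by (intro homog_xpow) simp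
  have w: "set ?w \<subseteq> {k..n}" using set_coset_word[of d k] assms by simp
  have "ders n ?w ?x \<in> homog {k..n} 1"
    using homog_ders[OF assms(2) x w] by (simp add: length_coset_word)
  moreover have "der n j (ders n ?w ?x) = 0" if j: "j \<in> {k..n}" for j
  proof -
    have xr: "?x \<in> elems (range GX)" by (rule elems_mono[OF _ homog_elems[OF x]]) auto
    consider "\<forall>f\<in>elems (range GX). ders n (j # ?w) f = 0"
      | j' where "j' \<in> {k<..n}" "\<forall>f\<in>elems (range GX). pm_eq (ders n (j # ?w) f) (ders n (?w @ [j']) f)"
      using ders.straighten[OF assms j order_refl] by blast
    then show ?thesis
    proof cases
      case 1
      from bspec[OF this xr] show ?thesis by simp
    next
      case (2 j')
      then have "der n j' ?x = 0" by (intro der_xpow) simp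
      then show ?thesis using bspec[OF 2(2) xr] by simp
    qed
  qed
  ultimately show ?thesis by (rule homog_1_killed[OF assms(2)])
qed

lemma der_xpow_self:
  assumes "k \<noteq> n"
  shows "der n k (gx k ^ m) = (\<Sum>i<m. frag_cmul ((- 1) ^ i) (gx (Suc k) ^ i * gx k ^ (m - 1 - i)))"
proof (induction m)
  case (Suc m)
  have "der n k (gx k ^ Suc m) = gx k ^ m - gx (Suc k) * der n k (gx k ^ m)"
    using assms by (simp add: hits_def swap_index_def)
  also have "gx (Suc k) * der n k (gx k ^ m) =
      (\<Sum>i<m. frag_cmul ((- 1) ^ i) (gx (Suc k) ^ Suc i * gx k ^ (m - 1 - i)))"
    by (simp add: Suc sum_distrib_left mult_frag_cmul mult.assoc)
  also have "gx k ^ m - \<dots> = (\<Sum>i<Suc m. frag_cmul ((- 1) ^ i) (gx (Suc k) ^ i * gx k ^ (Suc m - 1 - i)))"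
    unfolding sum.lessThan_Suc_shift by (simp add: sum_negf flip: minus_frag_cmul)
  finally show ?case .
qed simp

text \<open>
  The first operator gives $t_k x_k^m = \sum_i \pm x_{k+1}^i x_k^{m-1-i}$.  The following ones act on the
  powers of $x_{k+1}$ only, and for reasons of degree they kill all but the top term, which is covered
  by the induction hypothesis.  For the longest suffix two terms remain before the last operator is
  applied: the one with $x_k$, which yields $\pm 1$, and one that vanishes by
  \<open>longest_coset_word_xpow\<close>.
\<close>

lemma ders_coset_word:
  assumes "n = k + d" "1 \<le> k" "m \<le> 2 * d + 1"
  shows "pm_eq (ders n (coset_word d k m) (gx k ^ m)) 1"
  using assms
proof (induction d arbitrary: k m)
  case 0
  then have "m = 0 \<or> m = 1" by auto
  then show ?case using 0 der_x[of n n n 1] by (auto simp: hits_def)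
next
  case (Suc d)
  let ?v = "coset_word d (Suc k)"
  have n: "n = Suc k + d" and k: "k \<noteq> n" and k': "1 \<le> Suc k" using Suc.prems by auto
  have set_v: "set (?v p) \<subseteq> {Suc k..n}" for p using set_coset_word[of d "Suc k" p] n by simp
  have low: "ders n (?v p) (gx (Suc k) ^ i) = 0" if "i < p" "p \<le> 2 * d + 1" for i p
  proof -
    have "gx (Suc k) ^ i \<in> homog {Suc k..n} i" using n by (intro homog_xpow) simp
    then show ?thesis
      using homog_ders[OF k' _ set_v, of "gx (Suc k) ^ i" i p] that length_coset_word[of p d "Suc k"] by simp
  qed
  have expand: "ders n (?v p) (der n k (gx k ^ m)) =
      (\<Sum>i<m. frag_cmul ((- 1) ^ i) (ders n (?v p) (gx (Suc k) ^ i) * gx k ^ (m - 1 - i)))" for p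
    using set_v[of p] by (simp add: der_xpow_self[OF k] ders_sum ders_mult_xpow subset_iff)
  consider "m = 0" | "1 \<le> m" "m \<le> 2 * Suc d" | "m = 2 * Suc d + 1"
    using Suc.prems by linarith
  then show ?case
  proof cases
    case 1
    then show ?thesis by simp
  next
    case 2
    then obtain p where p: "m = Suc p" "p \<le> 2 * d + 1" by (cases m) auto
    have "ders n (coset_word (Suc d) k m) (gx k ^ m) = frag_cmul ((- 1) ^ p) (ders n (?v p) (gx (Suc k) ^ p))"
      using 2 p expand[of p] by (simp add: low del: power_Suc)
    then show ?thesis
      using Suc.IH[OF n k' p(2)] pm_eq_cmul pm_eq_trans by metis
  next
    case 3
    let ?p = "2 * d + 1"
    have m: "m = Suc (Suc ?p)" using 3 by simp
    have "ders n (?v ?p) (gx (Suc k) ^ Suc ?p) = 0"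
      using longest_coset_word_xpow[OF n k'] by simp
    then have "ders n (?v ?p) (der n k (gx k ^ m)) = frag_cmul ((- 1) ^ ?p) (ders n (?v ?p) (gx (Suc k) ^ ?p) * gx k)"
      unfolding expand unfolding m by (simp add: low del: power_Suc)
    moreover have "pm_eq (ders n (?v ?p) (gx (Suc k) ^ ?p)) 1"
      by (rule Suc.IH[OF n k']) simp
    ultimately have "pm_eq (ders n (?v ?p) (der n k (gx k ^ m))) (gx k)"
      by (auto simp: pm_eq_def)
    then have "pm_eq (der n k (ders n (?v ?p) (der n k (gx k ^ m)))) (der n k (gx k))"
      by (auto simp: pm_eq_def)
    moreover have "der n k (gx k) = 1" using der_x[of n k k 1] by (simp add: hits_def)
    moreover have "coset_word (Suc d) k m = k # ?v ?p @ [k]" using 3 by simp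
    ultimately show ?thesis by simp
  qed
qed

abbreviation xmon :: "nat \<Rightarrow> nat list \<Rightarrow> letter free_ring" where
  "xmon k as \<equiv> word (map GX (xword k as))"

lemma word_replicate: "word (replicate a l) = gen l ^ a"
  by (induction a) (simp_all add: word_Nil word_Cons)

lemma xmon_Cons: "xmon k (a # as) = gx k ^ a * xmon (Suc k) as"
  by (simp add: word_append word_replicate)

lemma length_xword: "length (xword k as) = sum_list as"
  by (induction k as rule: xword.induct) auto

lemma homog_xmon: "n + 1 = k + length as \<Longrightarrow> xmon k as \<in> homog {k..n} (sum_list as)"
  using set_xword[of k as] by (auto simp: length_xword)

text \<open>
  The order for which the matrix of normal forms on monomials is triangular.  The sum of all suffix
  sums is strictly monotone for it, which makes minimal elements available.
\<close>

fun suffix_le :: "nat list \<Rightarrow> nat list \<Rightarrow> bool" where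
  "suffix_le (v # vs) (w # ws) \<longleftrightarrow> v + sum_list vs \<le> w + sum_list ws \<and> suffix_le vs ws"
| "suffix_le _ _ \<longleftrightarrow> True"

fun suffix_total :: "nat list \<Rightarrow> nat" where
  "suffix_total [] = 0"
| "suffix_total (v # vs) = v + sum_list vs + suffix_total vs"

lemma suffix_le_antisym:
  assumes "length v = length w" "suffix_le v w" "suffix_total w \<le> suffix_total v"
  shows "v = w"
proof -
  have "suffix_total v \<le> suffix_total w \<and> (suffix_total w \<le> suffix_total v \<longrightarrow> v = w)"
    using assms(1,2)
  proof (induction v w rule: suffix_le.induct)
    case (1 v vs w ws)
    then have IH: "suffix_total vs \<le> suffix_total ws" "suffix_total ws \<le> suffix_total vs \<longrightarrow> vs = ws"
      and le: "v + sum_list vs \<le> w + sum_list ws" by auto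
    have "vs = ws" if "suffix_total (w # ws) \<le> suffix_total (v # vs)"
      using that IH le by simp
    then show ?case using IH(1) le by auto
  qed auto
  then show ?thesis using assms(3) by blast
qed

text \<open>
  The operators of index larger than $k$ commute with $x_k$ up to sign, so the first entry of the
  code can be split off: the later factors act on the later variables alone.  A suffix of the code
  with a sum that exceeds the degree of the corresponding part of the monomial therefore kills it.
\<close>

lemma ders_nf_word_xmon:
  assumes "n + 1 = k + length v" "1 \<le> k" "length v = length w" "is_code v"
  shows "\<not> suffix_le v w \<Longrightarrow> ders n (nf_word k v) (xmon k w) = 0"
    and "v = w \<Longrightarrow> pm_eq (ders n (nf_word k v) (xmon k w)) 1"
proof -
  have "(\<not> suffix_le v w \<longrightarrow> ders n (nf_word k v) (xmon k w) = 0) \<and>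
        (v = w \<longrightarrow> pm_eq (ders n (nf_word k v) (xmon k w)) 1)"
    using assms
  proof (induction v w arbitrary: k rule: suffix_le.induct)
    case (1 m ms b bs)
    let ?c = "coset_word (length ms) k m" and ?t = "nf_word (Suc k) ms"
    have n: "n = k + length ms" and k: "1 \<le> k" and m: "m \<le> 2 * length ms + 1" using 1 by auto
    have set_t: "set ?t \<subseteq> {Suc k..}" using set_nf_word[of "Suc k" ms] by auto
    have step: "pm_eq (ders n (nf_word k (m # ms)) (xmon k (b # bs))) (ders n ?c (gx k ^ b * ders n ?t (xmon (Suc k) bs)))"
      unfolding xmon_Cons nf_word.simps foldr_append comp_def
      by (intro pm_eq_ders ders_xpow_mult set_t)
    have IH: "(\<not> suffix_le ms bs \<longrightarrow> ders n ?t (xmon (Suc k) bs) = 0) \<and>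
        (ms = bs \<longrightarrow> pm_eq (ders n ?t (xmon (Suc k) bs)) 1)"
      using 1 by (intro "1.IH") auto
    show ?case
    proof (intro conjI impI)
      assume not_le: "\<not> suffix_le (m # ms) (b # bs)"
      show "ders n (nf_word k (m # ms)) (xmon k (b # bs)) = 0"
      proof (cases "suffix_le ms bs")
        case True
        then have lt: "sum_list (b # bs) < sum_list (m # ms)" using not_le by simp
        have "xmon k (b # bs) \<in> homog {k..n} (sum_list (b # bs))"
          using 1 by (intro homog_xmon) simp
        moreover have "set (nf_word k (m # ms)) \<subseteq> {k..n}"
          using set_nf_word[of k "m # ms"] n by auto
        moreover have "length (nf_word k (m # ms)) = sum_list (m # ms)"
          using 1 by (intro length_nf_word) simp
        ultimately show ?thesis using homog_ders[OF k] lt by metis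
      next
        case False
        then show ?thesis using step IH by simp
      qed
    next
      assume eq: "m # ms = b # bs"
      then have "pm_eq (gx k ^ b * ders n ?t (xmon (Suc k) bs)) (gx k ^ b * 1)"
        using IH by (intro pm_eq_mult_left) auto
      then have "pm_eq (ders n ?c (gx k ^ b * ders n ?t (xmon (Suc k) bs))) (ders n ?c (gx k ^ m))"
        using eq by (intro pm_eq_ders) simp
      then show "pm_eq (ders n (nf_word k (m # ms)) (xmon k (b # bs))) 1"
        using step ders_coset_word[OF n k m] pm_eq_trans by blast
    qed
  qed (auto simp: word_Nil)
  then show "\<not> suffix_le v w \<Longrightarrow> ders n (nf_word k v) (xmon k w) = 0"
    and "v = w \<Longrightarrow> pm_eq (ders n (nf_word k v) (xmon k w)) 1" by auto
qed

subsection \<open>Sorted monomials are independent in the ring of skew polynomials\<close>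

fun sort_sign :: "nat list \<Rightarrow> int" where
  "sort_sign [] = 1"
| "sort_sign (i # u) = (- 1) ^ length (filter (\<lambda>x. x < i) u) * sort_sign u"

primrec x_index :: "letter \<Rightarrow> nat" where
  "x_index (GX i) = i" | "x_index (GD i) = 0" | "x_index GB = 0"

text \<open>
  The coordinates of an element of the ring of skew polynomials in the basis of sorted monomials:
  a word is its sorted rearrangement times the sign of the number of inversions.
\<close>

definition exponents :: "letter free_ring \<Rightarrow> (nat \<Rightarrow> nat) \<Rightarrow>\<^sub>0 int" where
  "exponents f = frag_extend (\<lambda>w. let u = map x_index (letters w)
     in frag_cmul (sort_sign u) (frag_of (count_list u))) f"

lemma exponents_simps [simp]:
  "exponents 0 = 0" "exponents (a - b) = exponents a - exponents b" "exponents (a + b) = exponents a + exponents b"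
  "exponents (frag_cmul c a) = frag_cmul c (exponents a)"
  by (simp_all add: exponents_def frag_extend_diff frag_extend_add frag_extend_cmul)

lemma exponents_word: "exponents (word w) =
    frag_cmul (sort_sign (map x_index w)) (frag_of (count_list (map x_index w)))"
  by (simp add: exponents_def Let_def)

lemma sort_sign_swap: "i \<noteq> j \<Longrightarrow> sort_sign (a @ i # j # b) = - sort_sign (a @ j # i # b)"
proof (induction a)
  case Nil
  then show ?case by (cases "i < j") auto
qed simp

lemma pol_rels_elems: "pol_rels n \<subseteq> elems (pol_gens n)"
  by (auto simp: pol_rels_def pol_gens_def)

lemma exponents_idl_pol:
  assumes "f \<in> idl (pol_gens n) (pol_rels n)"
  shows "exponents f = 0"
  using pol_rels_elems assms
proof (induction f rule: idl_induct)
  case (rel u r v)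
  then obtain i j where ij: "r = gx i * gx j + gx j * gx i" "i \<noteq> j"
    by (auto simp: pol_rels_def)
  have "word u * r * word v = word (u @ GX i # GX j # v) + word (u @ GX j # GX i # v)"
    by (simp add: ij word_append word_Cons mult.assoc distrib_left distrib_right)
  moreover have "count_list (map x_index u @ i # j # map x_index v) = count_list (map x_index u @ j # i # map x_index v)"
    by (rule ext) simp
  ultimately show ?case
    using sort_sign_swap[OF ij(2), of "map x_index u" "map x_index v"]
    by (simp add: exponents_word flip: frag_cmul_distrib)
qed simp_all

lemma sort_sign_sorted: "sorted u \<Longrightarrow> sort_sign u = 1"
  by (induction u) (auto simp: filter_empty_conv not_less)

lemma sorted_xword: "sorted (xword k as)"
proof (induction k as rule: xword.induct)
  case (2 k a as)
  then show ?case using set_xword[of "Suc k" as] by (fastforce simp: sorted_append)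
qed simp

lemma count_list_xword: "i < length as \<Longrightarrow> count_list (xword k as) (k + i) = as ! i"
proof (induction k as arbitrary: i rule: xword.induct)
  case (2 k a as)
  have "k \<notin> set (xword (Suc k) as)" using set_xword[of "Suc k" as] by auto
  moreover have "count_list (replicate a k) j = (if j = k then a else 0)" for j
    by (induction a) auto
  ultimately show ?case using 2 by (cases i) auto
qed simp

lemma exponents_xmon: "exponents (xmon k as) = frag_of (count_list (xword k as))"
  by (simp add: exponents_word comp_def sort_sign_sorted sorted_xword)

lemma inj_xmon: "length as = length bs \<Longrightarrow> count_list (xword k as) = count_list (xword k bs) \<Longrightarrow> as = bs"
  by (metis count_list_xword nth_equalityI)

subsection \<open>The normal forms act independently\<close>

type_synonym index = "nat list \<times> nat list"

definition nh_index :: "nat \<Rightarrow> index set" where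
  "nh_index n = {(as, ms). length as = n \<and> length ms = n \<and> is_code ms}"

definition nh_word :: "nat \<Rightarrow> index \<Rightarrow> letter list" where
  "nh_word n b = map GX (xword 1 (fst b)) @ map (tletter n) (nf_word 1 (snd b))"

lemma act_xword: "act n (word (map GX u)) g = word (map GX u) * g"
  by (induction u) (simp_all add: word_Nil word_Cons act_gen_mult mult.assoc)

lemma act_nh_word: "act n (word (nh_word n b)) g = xmon 1 (fst b) * ders n (nf_word 1 (snd b)) g"
  by (simp add: nh_word_def word_append act_mult act_xword act_tword)

lemma act_sum: "act n (sum f A) g = (\<Sum>a\<in>A. act n (f a) g)"
  by (induction A rule: infinite_finite_induct) simp_all

lemma exponents_sum: "exponents (sum f A) = (\<Sum>a\<in>A. exponents (f a))"
  by (induction A rule: infinite_finite_induct) simp_all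

text \<open>
  On the monomial of a code \<open>w\<close> that minimises \<^const>\<open>suffix_total\<close> among those that occur, all normal
  forms with other codes vanish, and the one with code \<open>w\<close> gives $\pm 1$.  What remains is a linear
  relation between sorted monomials.
\<close>

lemma nh_words_independent:
  assumes keys: "Poly_Mapping.keys c \<subseteq> nh_index n"
    and kills: "\<And>g. g \<in> elems (pol_gens n) \<Longrightarrow>
      act n (frag_extend (word \<circ> nh_word n) c) g \<in> idl (pol_gens n) (pol_rels n)"
  shows "c = 0"
proof (rule ccontr)
  let ?K = "Poly_Mapping.keys c" and ?c = "Poly_Mapping.lookup c"
  assume "c \<noteq> 0"
  then have "?K \<noteq> {}" by simp
  then obtain b where b: "b \<in> ?K" and min: "\<And>b'. b' \<in> ?K \<Longrightarrow> suffix_total (snd b) \<le> suffix_total (snd b')"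
    using ex_min_if_finite[of "(suffix_total \<circ> snd) ` ?K"] by (force simp: not_less)
  let ?w = "snd b"
  define v where "v b' = ders n (nf_word 1 (snd b')) (xmon 1 ?w)" for b' :: index
  have index: "length (fst b') = n" "length (snd b') = n" "is_code (snd b')" if "b' \<in> ?K" for b'
    using that keys by (auto simp: nh_index_def)
  have v_0: "v b' = 0" if "b' \<in> ?K" "snd b' \<noteq> ?w" for b'
  proof -
    have "\<not> suffix_le (snd b') ?w"
      using suffix_le_antisym[of "snd b'" ?w] min[OF that(1)] that index b by metis
    then show ?thesis
      unfolding v_def using index that b by (intro ders_nf_word_xmon(1)) auto
  qed
  have v_1: "pm_eq (v b) 1"
    unfolding v_def using index b by (intro ders_nf_word_xmon(2)) auto
  define s where "s = (\<Sum>b'\<in>?K. frag_cmul (?c b') (if snd b' = ?w then xmon 1 (fst b') else 0))"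
  have "xmon 1 ?w \<in> elems (pol_gens n)"
    using set_xword[of 1 ?w] index b by (auto simp: pol_gens_def)
  then have "act n (frag_extend (word \<circ> nh_word n) c) (xmon 1 ?w) \<in> idl (pol_gens n) (pol_rels n)"
    by (rule kills)
  also have "act n (frag_extend (word \<circ> nh_word n) c) (xmon 1 ?w) =
      (\<Sum>b'\<in>?K. frag_cmul (?c b') (xmon 1 (fst b') * v b'))"
    by (simp add: frag_extend_def act_sum act_nh_word v_def)
  also have "\<dots> = (\<Sum>b'\<in>?K. frag_cmul (?c b') (if snd b' = ?w then xmon 1 (fst b') * v b else 0))"
    by (intro sum.cong refl) (use v_0 in \<open>auto simp: v_def\<close>)
  also have "\<dots> = s * v b"
    unfolding s_def sum_distrib_right
    by (intro sum.cong refl) (simp add: frag_cmul_mult)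
  finally have "s * v b \<in> idl (pol_gens n) (pol_rels n)" .
  then have "exponents (s * v b) = 0" by (rule exponents_idl_pol)
  then have "exponents s = 0"
    using v_1 exponents_simps(2)[of 0 s] by (auto simp: pm_eq_def)
  moreover have "exponents s = (\<Sum>b'\<in>?K. frag_cmul (?c b') (if snd b' = ?w then frag_of (count_list (xword 1 (fst b'))) else 0))"
    unfolding s_def exponents_sum by (intro sum.cong refl) (simp add: exponents_xmon)
  ultimately have "0 = Poly_Mapping.lookup (\<Sum>b'\<in>?K. frag_cmul (?c b')
      (if snd b' = ?w then frag_of (count_list (xword 1 (fst b'))) else 0)) (count_list (xword 1 (fst b)))"
    by simp
  also have "\<dots> = (\<Sum>b'\<in>?K. if b' = b then ?c b' else 0)"
    unfolding lookup_sum
  proof (intro sum.cong refl)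
    fix b' assume "b' \<in> ?K"
    then show "Poly_Mapping.lookup (frag_cmul (?c b') (if snd b' = ?w then frag_of (count_list (xword 1 (fst b'))) else 0))
        (count_list (xword 1 (fst b))) = (if b' = b then ?c b' else 0)"
      using inj_xmon[of "fst b" "fst b'" 1] index[of b'] index[OF b] prod_eqI[of b' b] by auto
  qed
  also have "\<dots> = ?c b" using b by simp
  finally show False using b by (simp add: in_keys_iff)
qed

section \<open>Relations, action and spanning set\<close>

abbreviation tgen :: "nat \<Rightarrow> nat \<Rightarrow> letter free_ring" where
  "tgen n j \<equiv> gen (tletter n j)"

abbreviation pol_idl :: "nat \<Rightarrow> letter free_ring set" where
  "pol_idl n \<equiv> idl (pol_gens n) (pol_rels n)"

abbreviation nh_idl :: "nat \<Rightarrow> letter free_ring set" where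
  "nh_idl n \<equiv> idl (nh_gens n) (nh_rels n)"

lemma nc_gens_eq: "1 \<le> n \<Longrightarrow> nc_gens n = tletter n ` {1..n}"
  by (force simp: nc_gens_def tletter_def)

lemma nh_gens_eq: "1 \<le> n \<Longrightarrow> nh_gens n = GX ` {1..n} \<union> tletter n ` {1..n}"
  by (simp add: nh_gens_def pol_gens_def nc_gens_eq)

lemma pol_gens_nh_gens: "pol_gens n \<subseteq> nh_gens n" and nc_gens_nh_gens: "nc_gens n \<subseteq> nh_gens n"
  by (auto simp: nh_gens_def)

lemma nh_gens_iff [simp]:
  "GX i \<in> nh_gens n \<longleftrightarrow> i \<in> {1..n}" "GD i \<in> nh_gens n \<longleftrightarrow> i \<in> {1..<n}" "GB \<in> nh_gens n"
  by (auto simp: nh_gens_def nc_gens_def pol_gens_def)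

lemma tletter_nh_gens: "j \<in> {1..n} \<Longrightarrow> tletter n j \<in> nh_gens n"
  by (auto simp: tletter_def)

lemma nh_rels_elems: "1 \<le> n \<Longrightarrow> nh_rels n \<subseteq> elems (nh_gens n)"
  using pol_rels_elems[of n] elems_mono[OF pol_gens_nh_gens]
  unfolding nh_rels_def by (auto simp: subset_iff)

text \<open>
  The mixed relations all have this shape.
\<close>

lemma rel_xt:
  assumes "i \<in> {1..n}" "j \<in> {1..n}"
  shows "tgen n j * gx i - (if hits n j i then 1 else 0) + gx (swap_index n j i) * tgen n j \<in> nh_rels n"
proof -
  consider "j = n" "i = n" | "j = n" "i < n" | "j < n" "i = j" | "j < n" "i = Suc j"
    | "j < n" "i \<noteq> j" "i \<noteq> Suc j"
    using assms by force
  then show ?thesis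
  proof cases
    case 1
    then have "tgen n j * gx i - (if hits n j i then 1 else 0) + gx (swap_index n j i) * tgen n j
      = gB * gx n + gx n * gB - 1"
      by (simp add: tletter_def hits_def swap_index_def)
    then show ?thesis unfolding nh_rels_def by blast
  next
    case 2
    then have "tgen n j * gx i - (if hits n j i then 1 else 0) + gx (swap_index n j i) * tgen n j
      = gB * gx i + gx i * gB \<and> i \<in> {1..<n}"
      using assms by (simp add: tletter_def hits_def swap_index_def)
    then show ?thesis unfolding nh_rels_def by blast
  next
    case 3
    then have "tgen n j * gx i - (if hits n j i then 1 else 0) + gx (swap_index n j i) * tgen n j
      = gd j * gx j + gx (j + 1) * gd j - 1 \<and> j \<in> {1..<n}"
      using assms by (simp add: tletter_def hits_def swap_index_def)
    then show ?thesis unfolding nh_rels_def by blast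
  next
    case 4
    then have "tgen n j * gx i - (if hits n j i then 1 else 0) + gx (swap_index n j i) * tgen n j
      = gx j * gd j + gd j * gx (j + 1) - 1 \<and> j \<in> {1..<n}"
      using assms by (simp add: tletter_def hits_def swap_index_def)
    then show ?thesis unfolding nh_rels_def by blast
  next
    case 5
    then have "tgen n j * gx i - (if hits n j i then 1 else 0) + gx (swap_index n j i) * tgen n j
      = gd j * gx i + gx i * gd j \<and> j \<in> {1..<n} \<and> i \<in> {1..n} \<and> i \<noteq> j \<and> i \<noteq> j + 1"
      using assms by (simp add: tletter_def hits_def swap_index_def)
    then show ?thesis unfolding nh_rels_def by blast
  qed
qed

lemma rel_square: "j \<in> {1..n} \<Longrightarrow> tgen n j * tgen n j \<in> nh_rels n"
  unfolding nh_rels_def tletter_def by (cases "j = n") (simp_all, force)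

lemma rel_far:
  assumes "i \<in> {1..n}" "j \<in> {1..n}" "Suc i < j"
  shows "tgen n i * tgen n j + tgen n j * tgen n i \<in> nh_rels n"
proof (cases "j = n")
  case True
  then have "tgen n i * tgen n j + tgen n j * tgen n i = gB * gd i + gd i * gB \<and> i \<in> {1..<n} \<and> i + 2 \<le> n"
    using assms by (simp add: tletter_def add.commute)
  then show ?thesis unfolding nh_rels_def by blast
next
  case False
  then have "tgen n i * tgen n j + tgen n j * tgen n i = gd i * gd j + gd j * gd i \<and> i \<in> {1..<n}
      \<and> j \<in> {1..<n} \<and> \<bar>int i - int j\<bar> > 1"
    using assms by (simp add: tletter_def)
  then show ?thesis unfolding nh_rels_def by blast
qed

lemma rel_braid3:
  assumes "1 \<le> i" "Suc i < n"
  shows "tgen n i * tgen n (Suc i) * tgen n i - tgen n (Suc i) * tgen n i * tgen n (Suc i) \<in> nh_rels n"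
proof -
  have "tgen n i * tgen n (Suc i) * tgen n i - tgen n (Suc i) * tgen n i * tgen n (Suc i) =
      gd i * gd (i+1) * gd i - gd (i+1) * gd i * gd (i+1) \<and> i \<in> {1..<n} \<and> i + 1 \<in> {1..<n}"
    using assms by (simp add: tletter_def)
  then show ?thesis unfolding nh_rels_def by blast
qed

lemma rel_braid4:
  assumes "1 \<le> i" "Suc i = n"
  shows "tgen n n * tgen n i * tgen n n * tgen n i + tgen n i * tgen n n * tgen n i * tgen n n \<in> nh_rels n"
proof -
  have "tgen n n * tgen n i * tgen n n * tgen n i + tgen n i * tgen n n * tgen n i * tgen n n =
      gB * gd i * gB * gd i + gd i * gB * gd i * gB \<and> i \<in> {1..<n} \<and> i + 1 = n"
    using assms by (simp add: tletter_def)
  then show ?thesis unfolding nh_rels_def by blast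
qed

subsection \<open>The ideals and the action\<close>

lemma swap_letter_pol: "j \<in> {1..n} \<Longrightarrow> swap_letter n j ` pol_gens n \<subseteq> pol_gens n"
  using swap_letter_x[of 1 j n] by (simp add: pol_gens_def)

text \<open>
  These two facts make the operators and their twists well defined on skew polynomials.
\<close>

lemma der_twist_pol_rels:
  assumes "r \<in> pol_rels n" "j \<in> {1..n}"
  shows "der n j r = 0" "twist n j r \<in> pol_rels n"
proof -
  obtain i i' where r: "r = gx i * gx i' + gx i' * gx i" "i \<in> {1..n}" "i' \<in> {1..n}" "i \<noteq> i'"
    using assms(1) by (auto simp: pol_rels_def)
  have x: "der n j (gx k) = (if hits n j k then 1 else 0)" for k
    using der_x[of n j k 1] by simp
  show "der n j r = 0"
    using r(4) by (auto simp: r(1) x hits_def swap_index_def)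
  have "twist n j r = gx (swap_index n j i) * gx (swap_index n j i') + gx (swap_index n j i') * gx (swap_index n j i)"
    by (simp add: r(1) twist_mult twist_x)
  moreover have "swap_index n j i \<noteq> swap_index n j i'" "swap_index n j i \<in> {1..n}" "swap_index n j i' \<in> {1..n}"
    using r assms(2) by (auto simp: swap_index_def)
  ultimately show "twist n j r \<in> pol_rels n"
    unfolding pol_rels_def by blast
qed

lemma der_twist_pol_idl:
  assumes "f \<in> pol_idl n" "j \<in> {1..n}"
  shows "der n j f \<in> pol_idl n \<and> twist n j f \<in> pol_idl n"
  using pol_rels_elems assms(1)
proof (induction f rule: idl_induct)
  case (rel u r v)
  have r: "der n j r = 0" "twist n j r \<in> pol_idl n" "r \<in> pol_idl n"
    using der_twist_pol_rels[OF rel(3) assms(2)] rel(3) by (auto intro: idl_rel[OF pol_rels_elems])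
  have w: "der n j (word w) \<in> elems (pol_gens n)" "twist n j (word w) \<in> elems (pol_gens n)"
    if "set w \<subseteq> pol_gens n" for w
    using elems_der_twist[OF _ swap_letter_pol[OF assms(2)], of "word w"] that by auto
  show ?case
    using r w[OF rel(1)] w[OF rel(2)] rel(1,2)
    by (simp add: der_mult twist_mult distrib_right idl_add[OF pol_rels_elems]
        idl_mult_left[OF pol_rels_elems] idl_mult_right[OF pol_rels_elems])
qed (simp_all add: idl_0[OF pol_rels_elems] idl_diff[OF pol_rels_elems])

lemma nh_gens_cases [consumes 2, case_names x t]:
  assumes "1 \<le> n" "l \<in> nh_gens n"
  obtains i where "i \<in> {1..n}" "l = GX i" | j where "j \<in> {1..n}" "l = tletter n j"
  using assms by (auto simp: nh_gens_eq)

lemma act_letter_pol: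
  assumes "1 \<le> n" "l \<in> nh_gens n"
  shows "g \<in> elems (pol_gens n) \<Longrightarrow> act_letter n l g \<in> elems (pol_gens n)"
    and "g \<in> pol_idl n \<Longrightarrow> act_letter n l g \<in> pol_idl n"
proof -
  have "(g \<in> elems (pol_gens n) \<longrightarrow> act_letter n l g \<in> elems (pol_gens n)) \<and>
      (g \<in> pol_idl n \<longrightarrow> act_letter n l g \<in> pol_idl n)"
    using assms
  proof (cases rule: nh_gens_cases)
    case (x i)
    then show ?thesis
      using idl_mult_left[OF pol_rels_elems, of "gx i" n g] by (auto simp: pol_gens_def)
  next
    case (t j)
    then show ?thesis
      using der_twist_pol_idl[of g n j] elems_der[of 1 j n g] by (auto simp: pol_gens_def)
  qed
  then show "g \<in> elems (pol_gens n) \<Longrightarrow> act_letter n l g \<in> elems (pol_gens n)"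
    and "g \<in> pol_idl n \<Longrightarrow> act_letter n l g \<in> pol_idl n" by auto
qed

lemma act_pol:
  assumes "1 \<le> n" "f \<in> elems (nh_gens n)"
  shows "g \<in> elems (pol_gens n) \<Longrightarrow> act n f g \<in> elems (pol_gens n)"
    and "g \<in> pol_idl n \<Longrightarrow> act n f g \<in> pol_idl n"
proof -
  show "act n f g \<in> elems (pol_gens n)" if "g \<in> elems (pol_gens n)"
    using assms(2)
  proof (induction f rule: elems_induct)
    case (word w)
    then show ?case
      by (induction w) (simp_all add: word_Nil word_Cons act_gen_mult act_letter_pol[OF assms(1)] that)
  qed simp_all
  show "act n f g \<in> pol_idl n" if "g \<in> pol_idl n"
    using assms(2)
  proof (induction f rule: elems_induct)
    case (word w)
    then show ?case
      by (induction w) (simp_all add: word_Nil word_Cons act_gen_mult act_letter_pol[OF assms(1)] that)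
  qed (simp_all add: idl_0[OF pol_rels_elems] idl_diff[OF pol_rels_elems])
qed

lemma act_nh_rels:
  assumes "1 \<le> n" "r \<in> nh_rels n" "g \<in> elems (pol_gens n)"
  shows "act n r g \<in> pol_idl n"
proof -
  have g: "g \<in> elems (range GX)" by (rule elems_mono[OF _ assms(3)]) (auto simp: pol_gens_def)
  have "r \<in> pol_rels n \<or> act n r g = 0"
    using assms(2) unfolding nh_rels_def
    by (elim UnE CollectE exE conjE singletonE)
      (auto simp: act_mult hits_def swap_index_def der_square[OF g] der_far[OF _ _ g] der_braid3[OF _ g]
        der_braid4[OF _ g] abs_if split: if_splits)
  then show ?thesis
  proof
    assume "r \<in> pol_rels n"
    moreover from this have "act n r g = r * g"
      by (auto simp: pol_rels_def act_mult distrib_right mult.assoc)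
    ultimately show ?thesis
      using assms(3) by (simp add: idl_rel[OF pol_rels_elems] idl_mult_right[OF pol_rels_elems])
  qed (simp add: idl_0[OF pol_rels_elems])
qed

lemma act_nh_idl:
  assumes "1 \<le> n" "f \<in> nh_idl n"
  shows "g \<in> elems (pol_gens n) \<Longrightarrow> act n f g \<in> pol_idl n"
  using nh_rels_elems[OF assms(1)] assms(2)
proof (induction f arbitrary: g rule: idl_induct)
  case (rel u r v)
  then show ?case
    by (simp add: act_mult act_pol[OF assms(1)] act_nh_rels[OF assms(1)])
qed (simp_all add: idl_0[OF pol_rels_elems] idl_diff[OF pol_rels_elems])

subsection \<open>Spanning\<close>

context
  fixes n :: nat
  assumes n: "1 \<le> n"
begin

text \<open>
  Only words over the generators can be compared in the algebra.  Demanding equal sets of letters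
  keeps the relation transitive although it imposes no condition on other words; all relations in
  question preserve the set of letters.
\<close>

definition nh_sim :: "letter list \<Rightarrow> letter list \<Rightarrow> bool" where
  "nh_sim u v \<longleftrightarrow> set u = set v \<and>
     (set u \<subseteq> nh_gens n \<longrightarrow> word u - word v \<in> nh_idl n \<or> word u + word v \<in> nh_idl n)"

definition nh_vanishing :: "letter list \<Rightarrow> bool" where
  "nh_vanishing u \<longleftrightarrow> (set u \<subseteq> nh_gens n \<longrightarrow> word u \<in> nh_idl n)"

private lemmas idl_rules = idl_0[OF nh_rels_elems[OF n]] idl_add[OF nh_rels_elems[OF n]]
  idl_minus[OF nh_rels_elems[OF n]] idl_diff[OF nh_rels_elems[OF n]]
  idl_mult_left[OF nh_rels_elems[OF n]] idl_mult_right[OF nh_rels_elems[OF n]]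
  idl_rel[OF nh_rels_elems[OF n]]

lemma nh_word_congruence: "word_congruence nh_sim nh_vanishing"
proof
  show "nh_sim u u" for u by (simp add: nh_sim_def idl_rules)
  show "nh_sim v u" if "nh_sim u v" for u v
    using that idl_rules(3)[of "word u - word v"] by (auto simp: nh_sim_def add.commute)
  show "nh_sim u w" if uv: "nh_sim u v" and vw: "nh_sim v w" for u v w
    unfolding nh_sim_def
  proof (intro conjI impI)
    show "set u = set w" using uv vw by (simp add: nh_sim_def)
    assume "set u \<subseteq> nh_gens n"
    then have 1: "word u - word v \<in> nh_idl n \<or> word u + word v \<in> nh_idl n"
      and 2: "word v - word w \<in> nh_idl n \<or> word v + word w \<in> nh_idl n"
      using uv vw by (simp_all add: nh_sim_def)
    show "word u - word w \<in> nh_idl n \<or> word u + word w \<in> nh_idl n"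
      using 1
    proof
      assume "word u - word v \<in> nh_idl n"
      then show ?thesis using 2 idl_rules(2)[of "word u - word v"] by fastforce
    next
      assume "word u + word v \<in> nh_idl n"
      then show ?thesis using 2 idl_rules(4)[of "word u + word v"] by fastforce
    qed
  qed
  show "nh_sim (a @ u @ b) (a @ v @ b)" if "nh_sim u v" for u v a b
    unfolding nh_sim_def
  proof (intro conjI impI)
    show "set (a @ u @ b) = set (a @ v @ b)" using that by (simp add: nh_sim_def)
    assume S: "set (a @ u @ b) \<subseteq> nh_gens n"
    then have "word a * f * word b \<in> nh_idl n" if "f \<in> nh_idl n" for f
      using that by (simp add: idl_rules)
    from this[of "word u - word v"] this[of "word u + word v"]
    show "word (a @ u @ b) - word (a @ v @ b) \<in> nh_idl n \<or> word (a @ u @ b) + word (a @ v @ b) \<in> nh_idl n"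
      using that S by (auto simp: nh_sim_def word_append algebra_simps)
  qed
  show "nh_vanishing (a @ u @ b)" if "nh_vanishing u" for u a b
    using that by (simp add: nh_vanishing_def word_append idl_rules)
  show "nh_vanishing u" if "nh_sim u v" "nh_vanishing v" for u v
    using that idl_rules(2)[of "word u - word v" "word v"] idl_rules(4)[of "word u + word v" "word v"]
    by (auto simp: nh_sim_def nh_vanishing_def)
qed

interpretation word_congruence nh_sim nh_vanishing by (rule nh_word_congruence)

lemma nh_sim_x: "i \<noteq> j \<Longrightarrow> nh_sim [GX i, GX j] [GX j, GX i]"
proof -
  assume "i \<noteq> j"
  then have "gx i * gx j + gx j * gx i \<in> pol_rels n" if "i \<in> {1..n}" "j \<in> {1..n}"
    using that unfolding pol_rels_def by blast
  then have "gx i * gx j + gx j * gx i \<in> nh_idl n" if "i \<in> {1..n}" "j \<in> {1..n}"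
    using that by (intro idl_rules) (simp add: nh_rels_def)
  then show ?thesis
    by (auto simp: nh_sim_def word_Cons word_Nil)
qed

interpretation T: type_B_words "\<lambda>u v. nh_sim (map (tletter n) u) (map (tletter n) v)"
  "\<lambda>u. nh_vanishing (map (tletter n) u)" n
proof
  show "nh_vanishing (map (tletter n) [i, i])" if "i \<in> {1..n}" for i
    using rel_square[OF that] by (simp add: nh_vanishing_def word_Cons word_Nil idl_rel[OF nh_rels_elems[OF n]])
  show "nh_sim (map (tletter n) [i, j]) (map (tletter n) [j, i])"
    if "i \<in> {1..n}" "j \<in> {1..n}" "Suc i < j" for i j
    using rel_far[OF that] by (auto simp: nh_sim_def word_Cons word_Nil idl_rel[OF nh_rels_elems[OF n]])
  show "nh_sim (map (tletter n) [i, Suc i, i]) (map (tletter n) [Suc i, i, Suc i])"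
    if "1 \<le> i" "Suc i < n" for i
    using rel_braid3[OF that] by (auto simp: nh_sim_def word_Cons word_Nil idl_rel[OF nh_rels_elems[OF n]] mult.assoc)
  show "nh_sim (map (tletter n) [Suc i, i, Suc i, i]) (map (tletter n) [i, Suc i, i, Suc i])"
    if "1 \<le> i" "Suc i = n" for i
    using rel_braid4[OF that] that(2) by (auto simp: nh_sim_def word_Cons word_Nil idl_rel[OF nh_rels_elems[OF n]] mult.assoc)
qed (auto intro: sim_sym sim_trans sim_context vanishing_context vanishing_sim)

definition nh_span :: "index set \<Rightarrow> letter free_ring set" where
  "nh_span K = {f. \<exists>c. Poly_Mapping.keys c \<subseteq> K \<and> f - frag_extend (word \<circ> nh_word n) c \<in> nh_idl n}"

lemma nh_span_0: "0 \<in> nh_span K"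
  unfolding nh_span_def by (intro CollectI exI[of _ 0]) (simp add: idl_rules)

lemma nh_span_diff:
  assumes "a \<in> nh_span K" "b \<in> nh_span K"
  shows "a - b \<in> nh_span K"
proof -
  obtain c d where cd: "Poly_Mapping.keys c \<subseteq> K" "a - frag_extend (word \<circ> nh_word n) c \<in> nh_idl n"
     "Poly_Mapping.keys d \<subseteq> K" "b - frag_extend (word \<circ> nh_word n) d \<in> nh_idl n"
    using assms unfolding nh_span_def by blast
  have "a - b - frag_extend (word \<circ> nh_word n) (c - d)
    = (a - frag_extend (word \<circ> nh_word n) c) - (b - frag_extend (word \<circ> nh_word n) d)"
    by (simp add: frag_extend_diff)
  then have "a - b - frag_extend (word \<circ> nh_word n) (c - d) \<in> nh_idl n"
    using idl_rules(4)[OF cd(2,4)] by (rule ssubst)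
  moreover have "Poly_Mapping.keys (c - d) \<subseteq> K" using keys_diff[of c d] cd by blast
  ultimately show ?thesis
    unfolding nh_span_def by blast
qed

lemma nh_span_minus: "a \<in> nh_span K \<Longrightarrow> - a \<in> nh_span K"
  using nh_span_diff[OF nh_span_0, of a] by simp

lemma nh_span_add: "a \<in> nh_span K \<Longrightarrow> b \<in> nh_span K \<Longrightarrow> a + b \<in> nh_span K"
  using nh_span_diff[of a K "- b"] nh_span_minus by simp

lemma nh_span_idl: "a \<in> nh_idl n \<Longrightarrow> a \<in> nh_span K"
  unfolding nh_span_def by (intro CollectI exI[of _ 0]) simp

lemma nh_span_word: "b \<in> K \<Longrightarrow> word (nh_word n b) \<in> nh_span K"
  unfolding nh_span_def by (intro CollectI exI[of _ "frag_of b"]) (simp add: idl_rules)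

lemma nh_span_vanishing_or_sim:
  assumes "set u \<subseteq> nh_gens n" "nh_vanishing u \<or> (\<exists>b\<in>K. nh_sim u (nh_word n b))"
  shows "word u \<in> nh_span K"
  using assms(2)
proof
  assume "nh_vanishing u"
  then show ?thesis using assms(1) nh_span_idl by (simp add: nh_vanishing_def)
next
  assume "\<exists>b\<in>K. nh_sim u (nh_word n b)"
  then obtain b where b: "b \<in> K" "nh_sim u (nh_word n b)" by blast
  then have "word u - word (nh_word n b) \<in> nh_span K \<or> word u + word (nh_word n b) \<in> nh_span K"
    using assms(1) nh_span_idl unfolding nh_sim_def by blast
  then show ?thesis
    using nh_span_add[OF _ nh_span_word[OF b(1)]] nh_span_diff[OF _ nh_span_word[OF b(1)]] by fastforce
qed

definition nc_index :: "index set" where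
  "nc_index = {(replicate n 0, ms) | ms. length ms = n \<and> is_code ms}"

lemma nc_index_subset: "nc_index \<subseteq> nh_index n"
  by (auto simp: nc_index_def nh_index_def)

lemma sort_x:
  assumes "set u \<subseteq> {1..n}"
  shows "\<exists>as. length as = n \<and> nh_sim (map GX u) (map GX (xword 1 as))"
  using assms
proof (induction u)
  case Nil
  show ?case by (intro exI[of _ "replicate n 0"]) (simp add: xword_zeros)
next
  case (Cons i u)
  then obtain as where as: "length as = n" "nh_sim (map GX u) (map GX (xword 1 as))" by auto
  then obtain as' where "length as' = n" "nh_sim (GX i # map GX (xword 1 as)) (map GX (xword 1 as'))"
    using sort_xword[of GX i 1 as] nh_sim_x Cons.prems by auto
  then show ?case
    using sim_trans[OF sim_Cons[OF as(2)]] by (intro exI[of _ as']) simp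
qed

lemma nc_words_span:
  assumes "set t \<subseteq> {1..n}"
  shows "word (map (tletter n) t) \<in> nh_span nc_index"
proof (rule nh_span_vanishing_or_sim)
  show "set (map (tletter n) t) \<subseteq> nh_gens n" using assms tletter_nh_gens by auto
  show "nh_vanishing (map (tletter n) t) \<or> (\<exists>b\<in>nc_index. nh_sim (map (tletter n) t) (nh_word n b))"
    using T.word_nf[OF assms]
  proof (elim disjE exE conjE)
    fix ms assume "length ms = n" "is_code ms" "nh_sim (map (tletter n) t) (map (tletter n) (nf_word 1 ms))"
    then show ?thesis
      by (intro disjI2 bexI[of _ "(replicate n 0, ms)"]) (auto simp: nc_index_def nh_word_def xword_zeros)
  qed simp
qed

lemma xt_words_span:
  assumes "set u \<subseteq> {1..n}" "set t \<subseteq> {1..n}"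
  shows "word (map GX u @ map (tletter n) t) \<in> nh_span (nh_index n)"
proof (rule nh_span_vanishing_or_sim)
  let ?w = "map GX u @ map (tletter n) t"
  show "set ?w \<subseteq> nh_gens n" using assms tletter_nh_gens by auto
  obtain as where as: "length as = n" "nh_sim (map GX u) (map GX (xword 1 as))"
    using sort_x[OF assms(1)] by blast
  show "nh_vanishing ?w \<or> (\<exists>b\<in>nh_index n. nh_sim ?w (nh_word n b))"
    using T.word_nf[OF assms(2)]
  proof (elim disjE exE conjE)
    assume "nh_vanishing (map (tletter n) t)"
    then show ?thesis using vanishing_context[of "map (tletter n) t" "map GX u" "[]"] by simp
  next
    fix ms assume ms: "length ms = n" "is_code ms" "nh_sim (map (tletter n) t) (map (tletter n) (nf_word 1 ms))"
    then have "nh_sim ?w (nh_word n (as, ms))"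
      using sim_trans[OF sim_append_right[OF as(2)] sim_append_left[OF ms(3)]] by (simp add: nh_word_def)
    then show ?thesis
      using as(1) ms by (intro disjI2 bexI[of _ "(as, ms)"]) (auto simp: nh_index_def)
  qed
qed

lemma set_nh_word: "b \<in> nh_index n \<Longrightarrow> set (xword 1 (fst b)) \<subseteq> {1..n} \<and> set (nf_word 1 (snd b)) \<subseteq> {1..n}"
  using set_xword[of 1 "fst b"] set_nf_word[of 1 "snd b"] by (auto simp: nh_index_def)

lemma nh_span_mult_left:
  assumes "f \<in> nh_span (nh_index n)" "a \<in> elems (nh_gens n)"
    and words: "\<And>b. b \<in> nh_index n \<Longrightarrow> a * word (nh_word n b) \<in> nh_span (nh_index n)"
  shows "a * f \<in> nh_span (nh_index n)"
proof -
  obtain c where c: "Poly_Mapping.keys c \<subseteq> nh_index n" "f - frag_extend (word \<circ> nh_word n) c \<in> nh_idl n"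
    using assms(1) unfolding nh_span_def by blast
  have "a * frag_extend (word \<circ> nh_word n) c \<in> nh_span (nh_index n)"
    using c(1)
    by (induction c rule: frag_induction)
      (simp_all add: nh_span_0 words frag_extend_diff right_diff_distrib nh_span_diff)
  moreover have "a * (f - frag_extend (word \<circ> nh_word n) c) \<in> nh_span (nh_index n)"
    using c(2) assms(2) by (simp add: nh_span_idl idl_rules)
  ultimately show ?thesis
    using nh_span_add by (fastforce simp: right_diff_distrib)
qed

lemma x_mult_span:
  assumes "i \<in> {1..n}" "f \<in> nh_span (nh_index n)"
  shows "gx i * f \<in> nh_span (nh_index n)"
proof (rule nh_span_mult_left[OF assms(2)])
  fix b assume "b \<in> nh_index n"
  then show "gx i * word (nh_word n b) \<in> nh_span (nh_index n)"
    using xt_words_span[of "i # xword 1 (fst b)" "nf_word 1 (snd b)"] set_nh_word[of b] assms(1)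
    by (simp add: nh_word_def word_Cons)
qed (use assms in simp)

text \<open>
  Moving $t_j$ to the right past one variable leaves a word without both letters, which is already
  in sorted form with respect to the two kinds of letters.
\<close>

lemma t_mult_span:
  assumes "j \<in> {1..n}" "f \<in> nh_span (nh_index n)"
  shows "tgen n j * f \<in> nh_span (nh_index n)"
proof (rule nh_span_mult_left[OF assms(2)])
  show "tgen n j \<in> elems (nh_gens n)" using tletter_nh_gens assms(1) by simp
  have "tgen n j * word (map GX u @ map (tletter n) t) \<in> nh_span (nh_index n)"
    if "set u \<subseteq> {1..n}" "set t \<subseteq> {1..n}" for u t
    using that(1)
  proof (induction u)
    case Nil
    then show ?case
      using xt_words_span[of "[]" "j # t"] that assms(1) by (simp add: word_Cons)
  next
    case (Cons i u)
    let ?w = "word (map GX u @ map (tletter n) t)"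
    let ?d = "if hits n j i then 1 else 0"
    have i: "i \<in> {1..n}" "swap_index n j i \<in> {1..n}"
      using Cons assms by (auto simp: swap_index_def)
    have "(tgen n j * gx i - ?d + gx (swap_index n j i) * tgen n j) * ?w \<in> nh_idl n"
      using rel_xt[OF i(1) assms(1)] Cons.prems that tletter_nh_gens
      by (intro idl_rules) auto
    then have "(tgen n j * gx i - ?d + gx (swap_index n j i) * tgen n j) * ?w \<in> nh_span (nh_index n)"
      by (rule nh_span_idl)
    moreover have "?d * ?w \<in> nh_span (nh_index n)"
      using xt_words_span[of u t] Cons.prems that nh_span_0 by auto
    moreover have "gx (swap_index n j i) * (tgen n j * ?w) \<in> nh_span (nh_index n)"
      using Cons i by (intro x_mult_span) auto
    moreover have "tgen n j * word (map GX (i # u) @ map (tletter n) t) =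
        (tgen n j * gx i - ?d + gx (swap_index n j i) * tgen n j) * ?w
        + ?d * ?w - gx (swap_index n j i) * (tgen n j * ?w)"
      by (simp add: word_Cons distrib_right left_diff_distrib mult.assoc)
    ultimately show ?case
      using nh_span_add nh_span_diff by metis
  qed
  then show "tgen n j * word (nh_word n b) \<in> nh_span (nh_index n)" if "b \<in> nh_index n" for b
    using set_nh_word[OF that] by (simp add: nh_word_def)
qed

theorem nh_words_span:
  assumes "f \<in> elems (nh_gens n)"
  shows "f \<in> nh_span (nh_index n)"
  using assms
proof (induction f rule: elems_induct)
  case (word w)
  then show ?case
  proof (induction w)
    case Nil
    then show ?case using xt_words_span[of "[]" "[]"] by simp
  next
    case (Cons l w)
    then have l: "l \<in> nh_gens n" by simp
    show ?case
      using n l Cons by (cases rule: nh_gens_cases) (auto simp: word_Cons x_mult_span t_mult_span)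
  qed
qed (simp_all add: nh_span_0 nh_span_diff)

theorem nc_span:
  assumes "f \<in> elems (nc_gens n)"
  shows "f \<in> nh_span nc_index"
  using assms
proof (induction f rule: elems_induct)
  case (word w)
  then have "w \<in> lists (tletter n ` {1..n})" using nc_gens_eq[OF n] by auto
  then obtain t where "w = map (tletter n) t" "t \<in> lists {1..n}"
    unfolding lists_image by blast
  then show ?case using nc_words_span[of t] by auto
qed (simp_all add: nh_span_0 nh_span_diff)

lemma set_nh_word_nh_gens: "b \<in> nh_index n \<Longrightarrow> set (nh_word n b) \<subseteq> nh_gens n"
  using set_nh_word[of b] tletter_nh_gens by (auto simp: nh_word_def)

text \<open>
  Modulo the ideal the element is a combination of normal forms, which acts in the same way; it is
  zero because the normal forms act independently.
\<close>

theorem nh_act_faithful: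
  assumes "f \<in> elems (nh_gens n)" "\<And>g. g \<in> elems (pol_gens n) \<Longrightarrow> act n f g \<in> pol_idl n"
  shows "f \<in> nh_idl n"
proof -
  obtain c where c: "Poly_Mapping.keys c \<subseteq> nh_index n" "f - frag_extend (word \<circ> nh_word n) c \<in> nh_idl n"
    using nh_words_span[OF assms(1)] unfolding nh_span_def by blast
  have "c = 0"
  proof (rule nh_words_independent[OF c(1)])
    fix g assume g: "g \<in> elems (pol_gens n)"
    then show "act n (frag_extend (word \<circ> nh_word n) c) g \<in> pol_idl n"
      using idl_diff[OF pol_rels_elems assms(2)[OF g] act_nh_idl[OF n c(2) g]] by simp
  qed
  then show ?thesis using c(2) by simp
qed

theorem nh_combination_unique:
  assumes "Poly_Mapping.keys c \<subseteq> nh_index n" "frag_extend (word \<circ> nh_word n) c \<in> nh_idl n"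
  shows "c = 0"
  using assms(1) by (rule nh_words_independent) (rule act_nh_idl[OF n assms(2)])

end

section \<open>The polynomial representation\<close>

text \<open>
  Additive maps are compared with maps on representatives by induction over the free ring; this is
  the step for differences.
\<close>

lemma residue_hom_diff:
  assumes "R \<subseteq> elems S" "R' \<subseteq> elems S'"
    and h: "h \<in> hom (add_monoid (presented_alg S R)) (add_monoid (presented_alg S' R'))"
    and "a \<in> elems S" "b \<in> elems S" "a' \<in> elems S'" "b' \<in> elems S'"
    and "h (residue_class S R a) = residue_class S' R' a'" "h (residue_class S R b) = residue_class S' R' b'"
  shows "h (residue_class S R (a - b)) = residue_class S' R' (a' - b')"
proof -
  interpret Q: ring "presented_alg S' R'" using assms(2) by (rule ring_presented_alg)
  let ?x = "h (residue_class S R (a - b))"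
  have closed: "?x \<in> carrier (presented_alg S' R')"
    using hom_in_carrier[OF h] residue_class_closed[OF assms(1), of "a - b"] assms by simp
  have "h (residue_class S R (a - b) \<oplus>\<^bsub>presented_alg S R\<^esub> residue_class S R b) = ?x \<oplus>\<^bsub>presented_alg S' R'\<^esub> h (residue_class S R b)"
    using hom_mult[OF h, of "residue_class S R (a - b)" "residue_class S R b"]
      residue_class_closed[OF assms(1)] assms by simp
  then have "?x \<oplus>\<^bsub>presented_alg S' R'\<^esub> residue_class S' R' b' =
      residue_class S' R' (a' - b') \<oplus>\<^bsub>presented_alg S' R'\<^esub> residue_class S' R' b'"
    using assms by (simp add: residue_class_add)
  then show ?thesis
    using closed residue_class_closed[OF assms(2)] assms by (subst (asm) Q.add.right_cancel) simp_all
qed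

context
  fixes n :: nat
  assumes n: "1 \<le> n"
begin

definition pol :: "letter free_ring \<Rightarrow> letter free_ring set" where
  "pol g = residue_class (pol_gens n) (pol_rels n) g"

lemma nh_rels: "nh_rels n \<subseteq> elems (nh_gens n)"
  using n by (rule nh_rels_elems)

lemma carrier_Pol: "carrier (Pol n) = pol ` elems (pol_gens n)"
  using carrier_presented_alg[OF pol_rels_elems] by (simp add: Pol_def pol_def image_def)

lemma carrier_NH: "carrier (NH n) = nh n ` elems (nh_gens n)"
  using carrier_presented_alg[OF nh_rels] by (simp add: NH_def nh_def image_def)

lemma NH_ring: "ring (NH n)"
  using ring_presented_alg[OF nh_rels] by (simp add: NH_def)

lemma pol_ops:
  assumes "a \<in> elems (pol_gens n)" "b \<in> elems (pol_gens n)"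
  shows "pol a \<oplus>\<^bsub>Pol n\<^esub> pol b = pol (a + b)" "pol a \<otimes>\<^bsub>Pol n\<^esub> pol b = pol (a * b)"
    "pol a = pol b \<longleftrightarrow> a - b \<in> pol_idl n"
  using assms residue_class_add[OF pol_rels_elems] residue_class_mult[OF pol_rels_elems]
    residue_class_eq_iff[OF pol_rels_elems]
  by (simp_all add: Pol_def pol_def)

lemma pol_minus: "a \<in> elems (pol_gens n) \<Longrightarrow> \<ominus>\<^bsub>Pol n\<^esub> pol a = pol (- a)"
  using residue_class_minus[OF pol_rels_elems] by (simp add: Pol_def pol_def)

lemma pol_consts: "\<zero>\<^bsub>Pol n\<^esub> = pol 0" "\<one>\<^bsub>Pol n\<^esub> = pol 1" "pol_x n i = pol (gx i)"
  using residue_class_zero[OF pol_rels_elems] residue_class_one[OF pol_rels_elems]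
  by (simp_all add: Pol_def pol_def pol_x_def)

lemma pol_closed [simp]: "a \<in> elems (pol_gens n) \<Longrightarrow> pol a \<in> carrier (Pol n)"
  by (simp add: carrier_Pol)

lemma nh_ops:
  assumes "a \<in> elems (nh_gens n)" "b \<in> elems (nh_gens n)"
  shows "nh n a \<oplus>\<^bsub>NH n\<^esub> nh n b = nh n (a + b)" "nh n a \<otimes>\<^bsub>NH n\<^esub> nh n b = nh n (a * b)"
    "nh n a = nh n b \<longleftrightarrow> a - b \<in> nh_idl n"
  using assms residue_class_add[OF nh_rels] residue_class_mult[OF nh_rels]
    residue_class_eq_iff[OF nh_rels]
  by (simp_all add: NH_def nh_def)

lemma nh_minus: "a \<in> elems (nh_gens n) \<Longrightarrow> \<ominus>\<^bsub>NH n\<^esub> nh n a = nh n (- a)"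
  using residue_class_minus[OF nh_rels] by (simp add: NH_def nh_def)

lemma nh_consts: "\<zero>\<^bsub>NH n\<^esub> = nh n 0" "\<one>\<^bsub>NH n\<^esub> = nh n 1"
  using residue_class_zero[OF nh_rels] residue_class_one[OF nh_rels]
  by (simp_all add: NH_def nh_def)

lemma nh_closed [simp]: "a \<in> elems (nh_gens n) \<Longrightarrow> nh n a \<in> carrier (NH n)"
  by (simp add: carrier_NH)

lemma gx_pol [simp]: "GX i \<in> pol_gens n \<longleftrightarrow> i \<in> {1..n}"
  by (auto simp: pol_gens_def)

text \<open>
  The arbitrary choice of a representative is harmless for additive maps that preserve the ideal.
\<close>

definition induced :: "(letter free_ring \<Rightarrow> letter free_ring) \<Rightarrow> letter free_ring set \<Rightarrow> letter free_ring set" where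
  "induced \<phi> = (\<lambda>G\<in>carrier (Pol n). pol (\<phi> (SOME g. g \<in> elems (pol_gens n) \<and> pol g = G)))"

lemma induced_pol:
  assumes "\<And>a b. \<phi> (a - b) = \<phi> a - \<phi> b"
    and "\<And>g. g \<in> elems (pol_gens n) \<Longrightarrow> \<phi> g \<in> elems (pol_gens n)"
    and "\<And>g. g \<in> pol_idl n \<Longrightarrow> \<phi> g \<in> pol_idl n"
    and "g \<in> elems (pol_gens n)"
  shows "induced \<phi> (pol g) = pol (\<phi> g)"
proof -
  let ?g = "SOME g'. g' \<in> elems (pol_gens n) \<and> pol g' = pol g"
  have g: "?g \<in> elems (pol_gens n) \<and> pol ?g = pol g"
    by (rule someI[of "\<lambda>g'. g' \<in> elems (pol_gens n) \<and> pol g' = pol g" g]) (simp add: assms(4))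
  then have "?g - g \<in> pol_idl n" using pol_ops(3)[of ?g g] assms(4) by simp
  then have "\<phi> ?g - \<phi> g \<in> pol_idl n" unfolding assms(1)[symmetric] by (rule assms(3))
  then have "pol (\<phi> ?g) = pol (\<phi> g)"
    using pol_ops(3)[OF assms(2)[OF conjunct1[OF g]] assms(2)[OF assms(4)]] by (rule iffD2[rotated])
  then show ?thesis
    unfolding induced_def using pol_closed[OF assms(4)] by simp
qed

lemma induced_act:
  "f \<in> elems (nh_gens n) \<Longrightarrow> g \<in> elems (pol_gens n) \<Longrightarrow> induced (act n f) (pol g) = pol (act n f g)"
  by (intro induced_pol) (simp_all add: act_pol[OF n])

lemma twist_pol [simp]: "j \<in> {1..n} \<Longrightarrow> g \<in> elems (pol_gens n) \<Longrightarrow> twist n j g \<in> elems (pol_gens n)"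
  and der_pol [simp]: "j \<in> {1..n} \<Longrightarrow> g \<in> elems (pol_gens n) \<Longrightarrow> der n j g \<in> elems (pol_gens n)"
  using elems_twist[of 1 j n g] elems_der[of 1 j n g] by (simp_all add: pol_gens_def)

lemma induced_twist:
  "j \<in> {1..n} \<Longrightarrow> g \<in> elems (pol_gens n) \<Longrightarrow> induced (twist n j) (pol g) = pol (twist n j g)"
  by (intro induced_pol) (simp_all add: der_twist_pol_idl)

definition pol_rep :: "letter free_ring set \<Rightarrow> letter free_ring set \<Rightarrow> letter free_ring set" where
  "pol_rep a = induced (act n (SOME f. f \<in> elems (nh_gens n) \<and> nh n f = a))"

lemma pol_rep_nh:
  assumes "f \<in> elems (nh_gens n)" "g \<in> elems (pol_gens n)"
  shows "pol_rep (nh n f) (pol g) = pol (act n f g)"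
proof -
  let ?f = "SOME f'. f' \<in> elems (nh_gens n) \<and> nh n f' = nh n f"
  have f: "?f \<in> elems (nh_gens n) \<and> nh n ?f = nh n f"
    by (rule someI[of "\<lambda>f'. f' \<in> elems (nh_gens n) \<and> nh n f' = nh n f" f]) (simp add: assms(1))
  then have "?f - f \<in> nh_idl n" using assms(1) nh_ops(3)[of ?f f] by simp
  then have "act n ?f g - act n f g \<in> pol_idl n"
    using act_nh_idl[OF n _ assms(2), of "?f - f"] by simp
  then show ?thesis
    unfolding pol_rep_def using assms f by (simp add: induced_act pol_ops(3) act_pol[OF n])
qed

lemma pol_rep_extensional: "pol_rep a \<in> extensional (carrier (Pol n))"
  by (simp add: pol_rep_def induced_def)

lemma pol_rep_eqI:
  assumes "h \<in> extensional (carrier (Pol n))" "h' \<in> extensional (carrier (Pol n))"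
    "\<And>g. g \<in> elems (pol_gens n) \<Longrightarrow> h (pol g) = h' (pol g)"
  shows "h = h'"
  using assms by (intro extensionalityI[of _ "carrier (Pol n)"]) (auto simp: carrier_Pol)

lemma pol_rep_hom: "pol_rep \<in> ring_hom (NH n) (End_ring (Pol n))"
proof (rule ring_hom_memI)
  fix a assume "a \<in> carrier (NH n)"
  then obtain f where f: "f \<in> elems (nh_gens n)" "a = nh n f" by (auto simp: carrier_NH)
  have "pol_rep a \<in> hom (add_monoid (Pol n)) (add_monoid (Pol n))"
  proof (rule homI)
    fix G assume "G \<in> carrier (add_monoid (Pol n))"
    then show "pol_rep a G \<in> carrier (add_monoid (Pol n))"
      using f by (auto simp: carrier_Pol pol_rep_nh act_pol[OF n])
  next
    fix G H assume "G \<in> carrier (add_monoid (Pol n))" "H \<in> carrier (add_monoid (Pol n))"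
    then obtain g h where gh: "g \<in> elems (pol_gens n)" "G = pol g" "h \<in> elems (pol_gens n)" "H = pol h"
      by (auto simp: carrier_Pol)
    have "act n f (g + h) = act n f g + act n f h"
      using act_right_simps(2)[of n f "g + h" h] by simp
    then show "pol_rep a (G \<otimes>\<^bsub>add_monoid (Pol n)\<^esub> H) = pol_rep a G \<otimes>\<^bsub>add_monoid (Pol n)\<^esub> pol_rep a H"
      using f gh by (simp add: pol_ops pol_rep_nh act_pol[OF n])
  qed
  then show "pol_rep a \<in> carrier (End_ring (Pol n))"
    using pol_rep_extensional by (simp add: End_ring_def)
  fix b assume "b \<in> carrier (NH n)"
  then obtain f' where f': "f' \<in> elems (nh_gens n)" "b = nh n f'" by (auto simp: carrier_NH)
  show "pol_rep (a \<otimes>\<^bsub>NH n\<^esub> b) = pol_rep a \<otimes>\<^bsub>End_ring (Pol n)\<^esub> pol_rep b"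
    using f f' by (intro pol_rep_eqI pol_rep_extensional)
      (simp_all add: End_ring_def nh_ops pol_rep_nh act_mult act_pol[OF n] compose_eq)
  show "pol_rep (a \<oplus>\<^bsub>NH n\<^esub> b) = pol_rep a \<oplus>\<^bsub>End_ring (Pol n)\<^esub> pol_rep b"
    using f f' by (intro pol_rep_eqI pol_rep_extensional)
      (simp_all add: End_ring_def nh_ops pol_ops pol_rep_nh act_pol[OF n])
next
  show "pol_rep \<one>\<^bsub>NH n\<^esub> = \<one>\<^bsub>End_ring (Pol n)\<^esub>"
    by (intro pol_rep_eqI pol_rep_extensional) (simp_all add: End_ring_def nh_consts pol_rep_nh)
qed

lemma twist_ring_hom:
  assumes "j \<in> {1..n}"
  shows "induced (twist n j) \<in> ring_hom (Pol n) (Pol n)"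
  using assms
  by (intro ring_hom_memI) (auto simp: carrier_Pol pol_consts pol_ops induced_twist twist_mult)

lemma induced_twist_x:
  assumes "j \<in> {1..n}" "i \<in> {1..n}"
  shows "induced (twist n j) (pol_x n i) = \<ominus>\<^bsub>Pol n\<^esub> pol_x n (swap_index n j i)"
proof -
  have "swap_index n j i \<in> {1..n}" using assms by (auto simp: swap_index_def)
  then show ?thesis
    using assms by (simp add: pol_consts pol_minus induced_twist twist_x)
qed

lemma der_gx: "der n j (gx i) = (if hits n j i then 1 else 0)"
  using der_x[of n j i 1] by simp

lemma pol_rep_twisted_derivation:
  assumes "j \<in> {1..n}" "\<And>i. i \<in> {1..n} \<Longrightarrow> i \<in> J \<longleftrightarrow> hits n j i"
  shows "is_twisted_derivation n (induced (twist n j)) J (pol_rep (nh n (tgen n j)))"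
proof -
  have t: "tgen n j \<in> elems (nh_gens n)" using tletter_nh_gens[OF assms(1)] by simp
  have rep: "pol_rep (nh n (tgen n j)) (pol g) = pol (der n j g)" if "g \<in> elems (pol_gens n)" for g
    using pol_rep_nh[OF t that] by simp
  have "pol_rep (nh n (tgen n j)) \<in> hom (add_monoid (Pol n)) (add_monoid (Pol n))"
    using ring_hom_closed[OF pol_rep_hom, of "nh n (tgen n j)"] t by (simp add: End_ring_def)
  then show ?thesis
    unfolding is_twisted_derivation_def
    using assms by (auto simp: pol_consts carrier_Pol pol_ops rep induced_twist der_mult der_gx)
qed

lemma pol_rep_is_pol_rep: "is_pol_rep n pol_rep"
  unfolding is_pol_rep_def
proof (intro conjI ballI)
  show "pol_rep \<in> ring_hom (NH n) (End_ring (Pol n))" by (rule pol_rep_hom)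
  show "pol_rep (nh n (gx i)) f = pol_x n i \<otimes>\<^bsub>Pol n\<^esub> f" if "i \<in> {1..n}" "f \<in> carrier (Pol n)" for i f
    using that by (auto simp: carrier_Pol pol_rep_nh pol_consts pol_ops)
  show "\<exists>s. is_s n i s \<and> is_twisted_derivation n s {i, i+1} (pol_rep (nh n (gd i)))" if "i \<in> {1..<n}" for i
  proof (intro exI conjI)
    have i: "i \<in> {1..n}" "i + 1 \<in> {1..n}" "i \<noteq> n" using that by auto
    show "is_s n i (induced (twist n i))"
      using i by (auto simp: is_s_def twist_ring_hom induced_twist_x swap_index_def)
    show "is_twisted_derivation n (induced (twist n i)) {i, i+1} (pol_rep (nh n (gd i)))"
      using pol_rep_twisted_derivation[OF i(1), of "{i, i+1}"] i by (simp add: hits_def tletter_def)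
  qed
  show "\<exists>s. is_sB n s \<and> is_twisted_derivation n s {n} (pol_rep (nh n gB))"
  proof (intro exI conjI)
    show "is_sB n (induced (twist n n))"
      using n by (auto simp: is_sB_def twist_ring_hom induced_twist_x swap_index_def)
    show "is_twisted_derivation n (induced (twist n n)) {n} (pol_rep (nh n gB))"
      using pol_rep_twisted_derivation[of n "{n}"] n by (simp add: hits_def tletter_def)
  qed
qed

text \<open>
  The twisted product rule determines the value on $x_i g$ from the value on $g$, and it involves the
  endomorphism \<open>s\<close> only at $x_i$.
\<close>

lemma twisted_derivation_unique:
  assumes D: "is_twisted_derivation n s J D" and j: "j \<in> {1..n}"
    and J: "\<And>i. i \<in> {1..n} \<Longrightarrow> i \<in> J \<longleftrightarrow> hits n j i"
    and s: "\<And>i. i \<in> {1..n} \<Longrightarrow> s (pol_x n i) = \<ominus>\<^bsub>Pol n\<^esub> pol_x n (swap_index n j i)"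
  shows "g \<in> elems (pol_gens n) \<Longrightarrow> D (pol g) = pol (der n j g)"
proof -
  have hom: "D \<in> hom (add_monoid (Pol n)) (add_monoid (Pol n))"
    and D_1: "D (pol 1) = pol 0"
    and D_x: "\<And>i. i \<in> {1..n} \<Longrightarrow> D (pol (gx i)) = pol (if i \<in> J then 1 else 0)"
    and D_mult: "\<And>f g. f \<in> elems (pol_gens n) \<Longrightarrow> g \<in> elems (pol_gens n) \<Longrightarrow>
      D (pol (f * g)) = (D (pol f) \<otimes>\<^bsub>Pol n\<^esub> pol g) \<oplus>\<^bsub>Pol n\<^esub> (s (pol f) \<otimes>\<^bsub>Pol n\<^esub> D (pol g))"
    using D unfolding is_twisted_derivation_def by (auto simp: pol_consts carrier_Pol pol_ops)
  have diff: "D (pol (a - b)) = pol (der n j (a - b))"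
    if "a \<in> elems (pol_gens n)" "b \<in> elems (pol_gens n)" "D (pol a) = pol (der n j a)" "D (pol b) = pol (der n j b)" for a b
    using residue_hom_diff[OF pol_rels_elems pol_rels_elems hom[unfolded Pol_def], of a b "der n j a" "der n j b"] that j
    by (simp add: pol_def)
  show "g \<in> elems (pol_gens n) \<Longrightarrow> D (pol g) = pol (der n j g)"
  proof (induction g rule: elems_induct)
    case zero
    show ?case using diff[of 1 1] D_1 by simp
  next
    case (word w)
    then show ?case
    proof (induction w)
      case Nil
      then show ?case using D_1 by (simp add: word_Nil)
    next
      case (Cons l w)
      then obtain i where i: "l = GX i" "i \<in> {1..n}" by (auto simp: pol_gens_def)
      have sw: "swap_index n j i \<in> {1..n}" using i j by (auto simp: swap_index_def)
      have w: "word w \<in> elems (pol_gens n)" using Cons by simp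
      have "D (pol (gx i * word w)) = (pol (if i \<in> J then 1 else 0) \<otimes>\<^bsub>Pol n\<^esub> pol (word w))
          \<oplus>\<^bsub>Pol n\<^esub> (pol (- gx (swap_index n j i)) \<otimes>\<^bsub>Pol n\<^esub> pol (der n j (word w)))"
        using Cons i sw s[OF i(2)] D_mult[of "gx i" "word w"] w D_x[OF i(2)]
        by (simp add: pol_consts pol_minus)
      also have "\<dots> = pol (der n j (gx i * word w))"
        using i sw w j J[OF i(2)] by (auto simp: pol_ops idl_0[OF pol_rels_elems])
      finally show ?case by (simp only: word_Cons i)
    qed
  qed (use diff in auto)
qed

theorem pol_rep_unique:
  assumes "is_pol_rep n \<rho>" "f \<in> elems (nh_gens n)" "g \<in> elems (pol_gens n)"
  shows "\<rho> (nh n f) (pol g) = pol (act n f g)"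
proof -
  have hom: "\<rho> \<in> ring_hom (NH n) (End_ring (Pol n))"
    and x: "\<And>i g. i \<in> {1..n} \<Longrightarrow> g \<in> elems (pol_gens n) \<Longrightarrow> \<rho> (nh n (gx i)) (pol g) = pol (gx i * g)"
    and d: "\<And>i. i \<in> {1..<n} \<Longrightarrow> \<exists>s. is_s n i s \<and> is_twisted_derivation n s {i, i+1} (\<rho> (nh n (gd i)))"
    and B: "\<exists>s. is_sB n s \<and> is_twisted_derivation n s {n} (\<rho> (nh n gB))"
    using assms(1) unfolding is_pol_rep_def by (auto simp: pol_consts pol_ops)
  have letter: "\<rho> (nh n (gen l)) (pol g) = pol (act_letter n l g)"
    if "l \<in> nh_gens n" "g \<in> elems (pol_gens n)" for l g
    using n that(1)
  proof (cases rule: nh_gens_cases)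
    case (x i)
    then show ?thesis using \<open>\<And>i g. _ \<Longrightarrow> _ \<Longrightarrow> \<rho> (nh n (gx i)) (pol g) = _\<close> that by simp
  next
    case (t j)
    have "\<rho> (nh n (tgen n j)) (pol g) = pol (der n j g)"
    proof (cases "j = n")
      case True
      obtain s where s: "is_sB n s" "is_twisted_derivation n s {n} (\<rho> (nh n gB))" using B by blast
      have "\<rho> (nh n gB) (pol g) = pol (der n n g)"
        by (rule twisted_derivation_unique[OF s(2) _ _ _ that(2)])
          (use s(1) n in \<open>auto simp: hits_def swap_index_def is_sB_def\<close>)
      then show ?thesis using True by (simp add: tletter_def)
    next
      case False
      then have "j \<in> {1..<n}" using t by simp
      then obtain s where s: "is_s n j s" "is_twisted_derivation n s {j, j+1} (\<rho> (nh n (gd j)))"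
        using d by blast
      have "\<rho> (nh n (gd j)) (pol g) = pol (der n j g)"
        by (rule twisted_derivation_unique[OF s(2) _ _ _ that(2)])
          (use s(1) t False in \<open>auto simp: hits_def swap_index_def is_s_def\<close>)
      then show ?thesis using False by (simp add: tletter_def)
    qed
    then show ?thesis using t by simp
  qed
  have eval: "(\<lambda>a. \<rho> a (pol g)) \<in> hom (add_monoid (NH n)) (add_monoid (Pol n))" if g: "g \<in> elems (pol_gens n)" for g
  proof (rule homI)
    fix x assume "x \<in> carrier (add_monoid (NH n))"
    then show "\<rho> x (pol g) \<in> carrier (add_monoid (Pol n))"
      using ring_hom_closed[OF hom, of x] g by (auto simp: End_ring_def hom_def)
  next
    fix x y assume "x \<in> carrier (add_monoid (NH n))" "y \<in> carrier (add_monoid (NH n))"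
    then show "\<rho> (x \<otimes>\<^bsub>add_monoid (NH n)\<^esub> y) (pol g) = \<rho> x (pol g) \<otimes>\<^bsub>add_monoid (Pol n)\<^esub> \<rho> y (pol g)"
      using ring_hom_add[OF hom, of x y] g by (simp add: End_ring_def)
  qed
  have diff: "\<rho> (nh n (a - b)) (pol g) = pol (act n (a - b) g)"
    if "a \<in> elems (nh_gens n)" "b \<in> elems (nh_gens n)" "g \<in> elems (pol_gens n)"
      "\<rho> (nh n a) (pol g) = pol (act n a g)" "\<rho> (nh n b) (pol g) = pol (act n b g)" for a b g
    using residue_hom_diff[OF nh_rels pol_rels_elems eval[OF that(3), unfolded Pol_def NH_def],
        of a b "act n a g" "act n b g"] that
    by (simp add: pol_def nh_def act_pol[OF n])
  have one: "\<rho> (nh n 1) (pol g) = pol (act n 1 g)" if "g \<in> elems (pol_gens n)" for g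
    using ring_hom_one[OF hom] that by (simp add: nh_consts End_ring_def)
  have "\<forall>g\<in>elems (pol_gens n). \<rho> (nh n f) (pol g) = pol (act n f g)"
    using assms(2)
  proof (induction f rule: elems_induct)
    case zero
    show ?case using diff[of 1 1] one by simp
  next
    case (word w)
    then show ?case
    proof (induction w)
      case Nil
      then show ?case
        using one by (simp add: word_Nil)
    next
      case (Cons l w)
      have lw: "gen l \<in> elems (nh_gens n)" "word w \<in> elems (nh_gens n)" using Cons by auto
      have "\<rho> (nh n (gen l * word w)) = \<rho> (nh n (gen l)) \<otimes>\<^bsub>End_ring (Pol n)\<^esub> \<rho> (nh n (word w))"
        using ring_hom_mult[OF hom, of "nh n (gen l)" "nh n (word w)"] lw by (simp add: nh_ops)
      then have "\<rho> (nh n (gen l * word w)) (pol g) = \<rho> (nh n (gen l)) (\<rho> (nh n (word w)) (pol g))"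
        if "g \<in> elems (pol_gens n)" for g
        using that by (simp add: End_ring_def compose_eq)
      then have "\<rho> (nh n (gen l * word w)) (pol g) = pol (act n (gen l * word w) g)"
        if "g \<in> elems (pol_gens n)" for g
        using that Cons letter[of l "act n (word w) g"] lw by (simp add: act_gen_mult act_pol[OF n])
      then show ?case by (simp only: word_Cons) blast
    qed
  qed (use diff in blast)
  then show ?thesis using assms(3) by blast
qed

theorem pol_rep_faithful:
  assumes "is_pol_rep n \<rho>"
  shows "inj_on \<rho> (carrier (NH n))"
proof (rule inj_onI)
  fix a b assume "a \<in> carrier (NH n)" "b \<in> carrier (NH n)" and eq: "\<rho> a = \<rho> b"
  then obtain f f' where f: "f \<in> elems (nh_gens n)" "a = nh n f" and f': "f' \<in> elems (nh_gens n)" "b = nh n f'"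
    by (auto simp: carrier_NH)
  have "f - f' \<in> nh_idl n"
  proof (rule nh_act_faithful[OF n])
    fix g assume g: "g \<in> elems (pol_gens n)"
    then have "pol (act n f g) = pol (act n f' g)"
      using pol_rep_unique[OF assms f(1) g] pol_rep_unique[OF assms f'(1) g] eq f f' by simp
    then show "act n (f - f') g \<in> pol_idl n"
      using pol_ops(3) act_pol(1)[OF n f(1) g] act_pol(1)[OF n f'(1) g] by simp
  qed (use f f' in simp)
  then show "a = b" using f f' nh_ops(3) by simp
qed

end

section \<open>Gradings and ranks\<close>

definition word_deg :: "letter list \<Rightarrow> int" where
  "word_deg w = (\<Sum>l\<leftarrow>w. letter_deg l)"

definition bihom :: "int \<Rightarrow> nat \<Rightarrow> letter free_ring \<Rightarrow> bool" where
  "bihom d p f \<longleftrightarrow> (\<forall>w\<in>Poly_Mapping.keys f. word_deg (letters w) = d \<and> length (letters w) mod 2 = p mod 2)"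

text \<open>
  The projection onto a component; it maps the ideal into itself because the relations are
  homogeneous.
\<close>

definition bicomp :: "int \<Rightarrow> nat \<Rightarrow> letter free_ring \<Rightarrow> letter free_ring" where
  "bicomp d p f = frag_extend
     (\<lambda>w. if word_deg (letters w) = d \<and> length (letters w) mod 2 = p mod 2 then frag_of w else 0) f"

lemma bicomp_simps [simp]:
  "bicomp d p 0 = 0" "bicomp d p (a - b) = bicomp d p a - bicomp d p b"
  by (simp_all add: bicomp_def frag_extend_diff)

lemma bihom_word [simp]: "bihom d p (word w) \<longleftrightarrow> word_deg w = d \<and> length w mod 2 = p mod 2"
  by (simp add: bihom_def)

lemma bihom_0 [simp]: "bihom d p 0"
  by (simp add: bihom_def)

lemma bihom_diff: "bihom d p a \<Longrightarrow> bihom d p b \<Longrightarrow> bihom d p (a - b)"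
  using keys_diff[of a b] unfolding bihom_def by blast

lemma bihom_add: "bihom d p a \<Longrightarrow> bihom d p b \<Longrightarrow> bihom d p (a + b)"
  using keys_add[of a b] unfolding bihom_def by blast

lemma bihom_gen: "bihom (letter_deg l) 1 (gen l)"
  by (simp add: gen_eq_word word_deg_def)

lemma bihom_1: "bihom 0 0 1"
  using bihom_word[of 0 0 "[]"] by (simp add: word_Nil word_deg_def)

lemma bihom_mult:
  assumes "bihom d p a" "bihom e q b"
  shows "bihom (d + e) (p + q) (a * b)"
  unfolding bihom_def
proof
  fix w assume "w \<in> Poly_Mapping.keys (a * b)"
  then obtain u v where uv: "u \<in> Poly_Mapping.keys a" "v \<in> Poly_Mapping.keys b" "w = u + v"
    using keys_mult[of a b] by blast
  then have "word_deg (letters u) = d" "word_deg (letters v) = e"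
    and m: "length (letters u) mod 2 = p mod 2" "length (letters v) mod 2 = q mod 2"
    using assms by (auto simp: bihom_def)
  moreover have "(length (letters u) + length (letters v)) mod 2 = (p + q) mod 2"
    using m by (rule mod_add_cong)
  ultimately show "word_deg (letters w) = d + e \<and> length (letters w) mod 2 = (p + q) mod 2"
    using uv(3) by (simp add: plus_free_monoid_def word_deg_def)
qed

lemma bihom_cong: "bihom d p f \<Longrightarrow> d = d' \<Longrightarrow> p mod 2 = p' mod 2 \<Longrightarrow> bihom d' p' f"
  by (simp add: bihom_def)

lemma bicomp_bihom:
  assumes "bihom e q f"
  shows "bicomp d p f = (if e = d \<and> q mod 2 = p mod 2 then f else 0)"
proof -
  have "bicomp d p f = frag_extend (\<lambda>w. if e = d \<and> q mod 2 = p mod 2 then frag_of w else 0) f"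
    unfolding bicomp_def by (rule frag_extend_eq) (use assms in \<open>auto simp: bihom_def\<close>)
  also have "\<dots> = (if e = d \<and> q mod 2 = p mod 2 then f else 0)"
    using frag_expansion[of f] by (auto simp: frag_extend_eq_0)
  finally show ?thesis .
qed

lemma bihom_induct [consumes 2, case_names zero word diff]:
  assumes "f \<in> elems S" "bihom d p f" and "P 0"
    and "\<And>w. set w \<subseteq> S \<Longrightarrow> word_deg w = d \<Longrightarrow> length w mod 2 = p mod 2 \<Longrightarrow> P (word w)"
    and "\<And>a b. a \<in> elems S \<Longrightarrow> b \<in> elems S \<Longrightarrow> P a \<Longrightarrow> P b \<Longrightarrow> P (a - b)"
  shows "P f"
proof -
  have "Poly_Mapping.keys f \<subseteq> {w. set (letters w) \<subseteq> S \<and> word_deg (letters w) = d \<and> length (letters w) mod 2 = p mod 2}"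
    using assms(1,2) by (auto simp: elems_def bihom_def)
  then have "f \<in> elems S \<and> P f"
  proof (induction f rule: frag_induction)
    case (one w)
    then show ?case using assms(4)[of "letters w"] by (simp add: elems_def)
  next
    case (diff a b)
    then show ?case using assms(5) by simp
  qed (use assms(3) in simp)
  then show ?thesis ..
qed

lemma bihom_pol_rels: "r \<in> pol_rels n \<Longrightarrow> bihom 4 2 r"
  unfolding pol_rels_def
  by (auto intro!: bihom_add intro: bihom_cong[OF bihom_mult[OF bihom_gen bihom_gen]])

lemma bihom_nh_rels: "r \<in> nh_rels n \<Longrightarrow> \<exists>d p. bihom d p r"
proof -
  have g2: "bihom (letter_deg l + letter_deg l') 0 (gen l * gen l')" for l l'
    by (rule bihom_cong[OF bihom_mult[OF bihom_gen bihom_gen]]) auto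
  have g3: "bihom (letter_deg l + letter_deg l' + letter_deg l'') 1 (gen l * gen l' * gen l'')" for l l' l''
    by (rule bihom_cong[OF bihom_mult[OF g2 bihom_gen]]) auto
  have g4: "bihom (letter_deg l + letter_deg l' + letter_deg l'' + letter_deg l''') 0 (gen l * gen l' * gen l'' * gen l''')"
    for l l' l'' l'''
    by (rule bihom_cong[OF bihom_mult[OF g3 bihom_gen]]) auto
  note gs = g2[of "GD _" "GD _", simplified] g2[of "GX _" "GD _", simplified] g2[of "GD _" "GX _", simplified]
    g2[of GB GB, simplified] g2[of "GD _" GB, simplified] g2[of GB "GD _", simplified]
    g2[of "GX _" GB, simplified] g2[of GB "GX _", simplified]
    g3[of "GD _" "GD _" "GD _", simplified]
    g4[of "GD _" GB "GD _" GB, simplified] g4[of GB "GD _" GB "GD _", simplified]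
  assume "r \<in> nh_rels n"
  then show ?thesis
    unfolding nh_rels_def
    by (elim UnE CollectE exE conjE singletonE)
      (blast intro: bihom_pol_rels gs bihom_add bihom_diff bihom_1)+
qed

definition half_deg :: "index \<Rightarrow> int" where
  "half_deg b = int (sum_list (fst b)) - int (sum_list (snd b))"

text \<open>
  The generating function of a family of elements of degrees \<open>2 * wt b\<close>.  As every generator is odd
  of degree $\pm 2$, the parity is the one of half the degree.
\<close>

definition weight_series :: "'a set \<Rightarrow> ('a \<Rightarrow> int) \<Rightarrow> zpi fls \<Rightarrow> bool" where
  "weight_series K wt F \<longleftrightarrow> (\<forall>e. finite {b \<in> K. wt b = e} \<and>
     fls_nth F (2 * e) = of_nat (card {b \<in> K. wt b = e}) * zpi_pi ^ nat (e mod 2) \<and> fls_nth F (2 * e + 1) = 0)"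

context
  fixes n :: nat
  assumes n: "1 \<le> n"
begin

lemma bicomp_nh_idl:
  assumes "f \<in> nh_idl n"
  shows "bicomp d p f \<in> nh_idl n"
  using nh_rels[OF n] assms
proof (induction f rule: idl_induct)
  case (rel u r v)
  obtain e q where "bihom e q r" using bihom_nh_rels[OF rel(3)] by blast
  then have "bihom (word_deg u + e + word_deg v) (length u + q + length v) (word u * r * word v)"
    by (intro bihom_mult) simp_all
  moreover have "word u * r * word v \<in> nh_idl n"
    using rel by (simp add: idl_mult_left[OF nh_rels[OF n]] idl_mult_right[OF nh_rels[OF n]] idl_rel[OF nh_rels[OF n]])
  ultimately show ?case
    by (simp add: bicomp_bihom idl_0[OF nh_rels[OF n]])
qed (simp_all add: idl_0[OF nh_rels[OF n]] idl_diff[OF nh_rels[OF n]])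

interpretation NH: ring "NH n" by (rule NH_ring[OF n])

lemma nh_diff:
  assumes "a \<in> elems (nh_gens n)" "b \<in> elems (nh_gens n)"
  shows "nh n a \<oplus>\<^bsub>NH n\<^esub> (\<ominus>\<^bsub>NH n\<^esub> nh n b) = nh n (a - b)"
  using assms by (simp add: nh_minus[OF n] nh_ops[OF n])

lemma NH_comp_eq:
  assumes "p \<in> {0, 1}"
  shows "NH_comp n d p = nh n ` {f \<in> elems (nh_gens n). bihom d p f}" (is "_ = ?C")
proof
  let ?W = "{nh n (word w) | w. set (letters (FM w)) \<subseteq> nh_gens n \<and> word_deg w = d \<and> length w mod 2 = p}"
  have comp: "NH_comp n d p = generate (add_monoid (NH n)) ?W"
    unfolding NH_comp_def word_deg_def
    by (rule arg_cong[where f = "generate (add_monoid (NH n))"]) (metis (no_types, opaque_lifting) free_monoid.exhaust_sel free_monoid.sel)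
  have p: "p mod 2 = p" using assms by auto
  show "NH_comp n d p \<subseteq> ?C"
    unfolding comp
  proof
    fix x assume "x \<in> generate (add_monoid (NH n)) ?W"
    then show "x \<in> ?C"
    proof (induction x rule: generate.induct)
      case one
      show ?case by (rule image_eqI[of _ _ 0]) (simp_all add: nh_consts[OF n])
    next
      case (incl h)
      then obtain w where "h = nh n (word w)" "set w \<subseteq> nh_gens n" "word_deg w = d" "length w mod 2 = p" by auto
      then show ?case using p by (intro image_eqI[of _ _ "word w"]) simp_all
    next
      case (inv h)
      then obtain w where w: "h = nh n (word w)" "set w \<subseteq> nh_gens n" "word_deg w = d" "length w mod 2 = p" by auto
      then have "inv\<^bsub>add_monoid (NH n)\<^esub> h = nh n (0 - word w)"
        using nh_minus[OF n, of "word w"] by (simp add: a_inv_def)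
      moreover have "bihom d p (0 - word w)" using w p by (intro bihom_diff) simp_all
      ultimately show ?case using w by (intro image_eqI[of _ _ "0 - word w"]) simp_all
    next
      case (eng h1 h2)
      then obtain f g where "h1 = nh n f" "h2 = nh n g" "f \<in> elems (nh_gens n)" "g \<in> elems (nh_gens n)"
        "bihom d p f" "bihom d p g" by auto
      then show ?case
        by (intro image_eqI[of _ _ "f + g"]) (simp_all add: nh_ops[OF n] bihom_add)
    qed
  qed
  show "?C \<subseteq> NH_comp n d p"
  proof
    have W: "?W \<subseteq> carrier (NH n)" using nh_closed[OF n] by auto
    interpret S: subgroup "NH_comp n d p" "add_monoid (NH n)"
      unfolding comp by (rule NH.add.generate_is_subgroup[OF W])
    fix x assume "x \<in> ?C"
    then obtain f where f: "x = nh n f" "f \<in> elems (nh_gens n)" "bihom d p f" by blast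
    from f(2,3) have "nh n f \<in> NH_comp n d p"
    proof (induction f rule: bihom_induct)
      case zero
      show ?case using S.one_closed by (simp add: nh_consts[OF n])
    next
      case (word w)
      then show ?case using p unfolding comp by (intro generate.incl) auto
    next
      case (diff a b)
      then show ?case
        using S.m_closed[OF diff(3) S.m_inv_closed[OF diff(4)]] nh_diff[OF diff(1,2)]
        by (simp add: a_inv_def)
    qed
    then show "x \<in> NH_comp n d p" using f by simp
  qed
qed

subsection \<open>Linear combinations of residue classes\<close>

text \<open>
  Choosing representatives turns combinations of residue classes into combinations in the free ring,
  where finite sums are those of a type class.
\<close>

definition rep :: "letter free_ring set \<Rightarrow> letter free_ring" where
  "rep b = (SOME f. f \<in> elems (nh_gens n) \<and> nh n f = b)"

lemma rep: "b \<in> carrier (NH n) \<Longrightarrow> rep b \<in> elems (nh_gens n) \<and> nh n (rep b) = b"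
  unfolding rep_def carrier_NH[OF n]
  by (rule someI_ex[of "\<lambda>f. f \<in> elems (nh_gens n) \<and> nh n f = b"]) auto

definition comb :: "(letter free_ring set \<Rightarrow>\<^sub>0 int) \<Rightarrow> letter free_ring" where
  "comb c = frag_extend rep c"

lemma comb_simps [simp]: "comb 0 = 0" "comb (a + b) = comb a + comb b" "comb (a - b) = comb a - comb b"
    "comb (frag_of x) = rep x"
  by (simp_all add: comb_def frag_extend_add frag_extend_diff)

lemma comb_elems: "Poly_Mapping.keys c \<subseteq> carrier (NH n) \<Longrightarrow> comb c \<in> elems (nh_gens n)"
  by (induction c rule: frag_induction) (simp_all add: rep)

text \<open>
  The structure \<open>A\<close> is the algebra itself or its nilCoxeter subalgebra.  Sums are formed relative to
  the carrier, so it has to be checked that they agree.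
\<close>

lemma finsum_eq_comb:
  assumes A: "ring A" "carrier A \<subseteq> carrier (NH n)" and ops: "\<zero>\<^bsub>A\<^esub> = \<zero>\<^bsub>NH n\<^esub>" "\<And>x y. x \<oplus>\<^bsub>A\<^esub> y = x \<oplus>\<^bsub>NH n\<^esub> y"
    and c: "Poly_Mapping.keys c \<subseteq> carrier A"
  shows "(\<Oplus>\<^bsub>A\<^esub>b\<in>Poly_Mapping.keys c. [Poly_Mapping.lookup c b] \<cdot>\<^bsub>A\<^esub> b) = nh n (comb c)"
proof -
  interpret A: ring A by (rule A(1))
  have rep_A: "rep b \<in> elems (nh_gens n)" "nh n (rep b) = b" if "b \<in> carrier A" for b
    using rep that A(2) by blast+
  have nat: "[k] \<cdot>\<^bsub>A\<^esub> b = nh n (frag_cmul (int k) (rep b))" if "b \<in> carrier A" for k :: nat and b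
  proof (induction k)
    case 0
    then show ?case by (simp add: ops nh_consts[OF n])
  next
    case (Suc k)
    have "frag_cmul (int (Suc k)) (rep b) = frag_cmul (int k) (rep b) + rep b"
      using frag_cmul_distrib[of "int k" 1 "rep b"] by (simp add: add.commute)
    then show ?case
      using Suc nh_ops(1)[OF n, of "frag_cmul (int k) (rep b)" "rep b"] rep_A[OF that]
      by (simp add: ops)
  qed
  have int: "[k] \<cdot>\<^bsub>A\<^esub> b = nh n (frag_cmul k (rep b))" if b: "b \<in> carrier A" for k :: int and b
  proof (cases "k \<ge> 0")
    case True
    then show ?thesis using nat[OF b, of "nat k"] by (simp add: add_pow_int_ge)
  next
    case False
    have k: "[nat (- k)] \<cdot>\<^bsub>A\<^esub> b = nh n (frag_cmul (- k) (rep b))" using nat[OF b, of "nat (- k)"] False by simp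
    have kA: "[nat (- k)] \<cdot>\<^bsub>A\<^esub> b \<in> carrier A" using b by (rule A.add.nat_pow_closed)
    then have "\<ominus>\<^bsub>A\<^esub> ([nat (- k)] \<cdot>\<^bsub>A\<^esub> b) \<oplus>\<^bsub>NH n\<^esub> [nat (- k)] \<cdot>\<^bsub>A\<^esub> b = \<zero>\<^bsub>NH n\<^esub>"
      using A.l_neg[OF kA] ops by simp
    then have "\<ominus>\<^bsub>NH n\<^esub> ([nat (- k)] \<cdot>\<^bsub>A\<^esub> b) = \<ominus>\<^bsub>A\<^esub> ([nat (- k)] \<cdot>\<^bsub>A\<^esub> b)"
      using kA A(2) A.a_inv_closed[OF kA] by (intro NH.minus_equality) auto
    then have "[k] \<cdot>\<^bsub>A\<^esub> b = \<ominus>\<^bsub>NH n\<^esub> nh n (frag_cmul (- k) (rep b))"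
      using False k by (simp add: add_pow_int_lt)
    also have "\<dots> = nh n (- frag_cmul (- k) (rep b))"
      using rep_A[OF b] by (intro nh_minus[OF n]) simp
    finally show ?thesis by simp
  qed
  have "finsum A (\<lambda>b. [Poly_Mapping.lookup c b] \<cdot>\<^bsub>A\<^esub> b) K = nh n (\<Sum>b\<in>K. frag_cmul (Poly_Mapping.lookup c b) (rep b))
      \<and> (\<Sum>b\<in>K. frag_cmul (Poly_Mapping.lookup c b) (rep b)) \<in> elems (nh_gens n)"
    if "finite K" "K \<subseteq> carrier A" for K
    using that
  proof (induction K rule: finite_induct)
    case empty
    then show ?case by (simp add: ops nh_consts[OF n])
  next
    case (insert b K)
    have "finsum A (\<lambda>b. [Poly_Mapping.lookup c b] \<cdot>\<^bsub>A\<^esub> b) (insert b K) =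
        [Poly_Mapping.lookup c b] \<cdot>\<^bsub>A\<^esub> b \<oplus>\<^bsub>A\<^esub> finsum A (\<lambda>b. [Poly_Mapping.lookup c b] \<cdot>\<^bsub>A\<^esub> b) K"
      using insert by (intro A.finsum_insert) (auto intro!: A.add.int_pow_closed)
    then show ?case
      using insert int[of b] rep_A[of b] by (simp add: ops nh_ops[OF n])
  qed
  from this[OF finite_keys c] show ?thesis
    by (simp add: comb_def frag_extend_def)
qed

definition is_basis :: "letter free_ring set set \<Rightarrow> letter free_ring set set \<Rightarrow> bool" where
  "is_basis M B \<longleftrightarrow> B \<subseteq> M \<and> (\<forall>a\<in>M. \<exists>!c. Poly_Mapping.keys c \<subseteq> B \<and> a = nh n (comb c))"

lemma is_Z_basis_iff:
  assumes A: "ring A" "carrier A \<subseteq> carrier (NH n)" and ops: "\<zero>\<^bsub>A\<^esub> = \<zero>\<^bsub>NH n\<^esub>" "\<And>x y. x \<oplus>\<^bsub>A\<^esub> y = x \<oplus>\<^bsub>NH n\<^esub> y"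
  shows "is_Z_basis A B \<longleftrightarrow> is_basis (carrier A) B"
proof -
  have "Poly_Mapping.keys c \<subseteq> B \<and> a = (\<Oplus>\<^bsub>A\<^esub>b\<in>Poly_Mapping.keys c. [Poly_Mapping.lookup c b] \<cdot>\<^bsub>A\<^esub> b)
      \<longleftrightarrow> Poly_Mapping.keys c \<subseteq> B \<and> a = nh n (comb c)" if "B \<subseteq> carrier A" for a c
    using finsum_eq_comb[OF A ops, of c] that by auto
  then show ?thesis
    unfolding is_Z_basis_def is_basis_def by (intro conj_cong refl) simp
qed

lemma nh_comb_bicomp:
  assumes "b \<in> NH_comp n e q" "p \<in> {0, 1}" "q \<in> {0, 1}"
  shows "bicomp d p (rep b) - (if b \<in> NH_comp n d p then rep b else 0) \<in> nh_idl n"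
proof -
  obtain f where f: "f \<in> elems (nh_gens n)" "bihom e q f" "b = nh n f"
    using assms(1) NH_comp_eq[OF assms(3)] by auto
  have b: "rep b \<in> elems (nh_gens n)" "nh n (rep b) = b"
    using rep[of b] f nh_closed[OF n] by auto
  show ?thesis
  proof (cases "b \<in> NH_comp n d p")
    case True
    then obtain g where g: "g \<in> elems (nh_gens n)" "bihom d p g" "b = nh n g"
      using NH_comp_eq[OF assms(2)] by auto
    then have I: "rep b - g \<in> nh_idl n" using b nh_ops(3)[OF n, of "rep b" g] by simp
    have "bicomp d p (rep b - g) - (rep b - g) \<in> nh_idl n"
      using bicomp_nh_idl[OF I] I by (rule idl_diff[OF nh_rels[OF n]])
    then show ?thesis using True g by (simp add: bicomp_bihom)
  next
    case False
    then have "\<not> (e = d \<and> q mod 2 = p mod 2)" using assms by auto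
    then have "bicomp d p f = 0" unfolding bicomp_bihom[OF f(2), of d p] by (rule if_not_P)
    moreover have "rep b - f \<in> nh_idl n" using b f nh_ops(3)[OF n, of "rep b" f] by simp
    ultimately show ?thesis using bicomp_nh_idl[of "rep b - f" d p] False by simp
  qed
qed

text \<open>
  Projecting the combination onto the component leaves its value unchanged and deletes the terms
  outside the component.  By uniqueness of coefficients there were none.
\<close>

lemma component_combination:
  assumes B: "is_basis M B" and hom: "\<forall>b\<in>B. \<exists>d. \<exists>p\<in>{0, 1}. b \<in> NH_comp n d p"
    and M: "M \<subseteq> carrier (NH n)"
    and p: "p \<in> {0, 1}" and c: "Poly_Mapping.keys c \<subseteq> B" "nh n (comb c) \<in> M \<inter> NH_comp n d p"
  shows "Poly_Mapping.keys c \<subseteq> B \<inter> NH_comp n d p"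
proof -
  define r where "r c = frag_extend (\<lambda>b. if b \<in> NH_comp n d p then frag_of b else 0) c" for c :: "letter free_ring set \<Rightarrow>\<^sub>0 int"
  have BM: "B \<subseteq> carrier (NH n)" using B M unfolding is_basis_def by blast
  have r: "bicomp d p (comb c) - comb (r c) \<in> nh_idl n \<and> Poly_Mapping.keys (r c) \<subseteq> B \<inter> NH_comp n d p"
    if "Poly_Mapping.keys c \<subseteq> B" for c
    using that
  proof (induction c rule: frag_induction)
    case (one b)
    then obtain e q where "q \<in> {0, 1}" "b \<in> NH_comp n e q" using hom by blast
    then show ?case using nh_comb_bicomp[OF _ p, of b e q d] one by (auto simp: r_def)
  next
    case (diff a b)
    have "bicomp d p (comb (a - b)) - comb (r (a - b)) =
        (bicomp d p (comb a) - comb (r a)) - (bicomp d p (comb b) - comb (r b))"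
      by (simp add: r_def frag_extend_diff)
    then have "bicomp d p (comb (a - b)) - comb (r (a - b)) \<in> nh_idl n"
      using diff idl_diff[OF nh_rels[OF n]] by metis
    moreover have "Poly_Mapping.keys (r (a - b)) \<subseteq> B \<inter> NH_comp n d p"
      using diff keys_diff[of "r a" "r b"] by (auto simp: r_def frag_extend_diff)
    ultimately show ?case ..
  qed (simp add: r_def idl_0[OF nh_rels[OF n]])
  have elems: "comb c \<in> elems (nh_gens n)" "comb (r c) \<in> elems (nh_gens n)"
    using comb_elems c(1) r[OF c(1)] BM by blast+
  obtain f where f: "f \<in> elems (nh_gens n)" "bihom d p f" "nh n (comb c) = nh n f"
    using c(2) NH_comp_eq[OF p] by auto
  then have I: "comb c - f \<in> nh_idl n" using nh_ops(3)[OF n elems(1) f(1)] by simp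
  have "(comb c - f) - bicomp d p (comb c - f) + (bicomp d p (comb c) - comb (r c)) \<in> nh_idl n"
    by (rule idl_add[OF nh_rels[OF n] idl_diff[OF nh_rels[OF n] I bicomp_nh_idl[OF I]] conjunct1[OF r[OF c(1)]]])
  then have "comb c - comb (r c) \<in> nh_idl n" using f by (simp add: bicomp_bihom)
  then have "nh n (comb c) = nh n (comb (r c))" using nh_ops(3)[OF n elems] by simp
  moreover have "\<exists>!c'. Poly_Mapping.keys c' \<subseteq> B \<and> nh n (comb c) = nh n (comb c')"
    using B c(2) unfolding is_basis_def by blast
  ultimately have "r c = c" using c(1) r[OF c(1)] by blast
  then show ?thesis using r[OF c(1)] by simp
qed

lemma component_iso:
  assumes B: "is_basis (nh n ` elems S) B" and hom: "\<forall>b\<in>B. \<exists>d. \<exists>p\<in>{0, 1}. b \<in> NH_comp n d p"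
    and S: "S \<subseteq> nh_gens n" and p: "p \<in> {0, 1}"
  shows "free_Abelian_group (B \<inter> NH_comp n d p) \<cong>
    \<lparr>carrier = nh n ` elems S \<inter> NH_comp n d p, monoid.mult = add (NH n), one = \<zero>\<^bsub>NH n\<^esub>\<rparr>"
    (is "_ \<cong> ?G")
proof (rule is_isoI[OF isoI])
  let ?B = "B \<inter> NH_comp n d p" and ?M = "nh n ` elems S"
  let ?h = "\<lambda>c. nh n (comb c)"
  have SM: "?M \<subseteq> carrier (NH n)"
    using elems_mono[OF S] by (auto simp: carrier_NH[OF n])
  have BM: "B \<subseteq> ?M" using B unfolding is_basis_def by blast
  have comb: "comb c \<in> elems (nh_gens n)" if "Poly_Mapping.keys c \<subseteq> ?B" for c
    using comb_elems that BM SM by blast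
  have M_diff: "x \<oplus>\<^bsub>NH n\<^esub> (\<ominus>\<^bsub>NH n\<^esub> y) \<in> ?M" if xy: "x \<in> ?M" "y \<in> ?M" for x y
  proof -
    obtain f g where "f \<in> elems S" "x = nh n f" "g \<in> elems S" "y = nh n g" using xy by blast
    then show ?thesis
      using nh_diff[of f g] elems_mono[OF S] by (intro image_eqI[of _ _ "f - g"]) auto
  qed
  have C_diff: "x \<oplus>\<^bsub>NH n\<^esub> (\<ominus>\<^bsub>NH n\<^esub> y) \<in> NH_comp n d p" if xy: "x \<in> NH_comp n d p" "y \<in> NH_comp n d p" for x y
  proof -
    obtain f g where "f \<in> elems (nh_gens n)" "bihom d p f" "x = nh n f"
      "g \<in> elems (nh_gens n)" "bihom d p g" "y = nh n g" using xy NH_comp_eq[OF p] by auto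
    then show ?thesis
      unfolding NH_comp_eq[OF p] using nh_diff[of f g] bihom_diff
      by (intro image_eqI[of _ _ "f - g"]) auto
  qed
  have h_closed: "?h c \<in> ?M \<inter> NH_comp n d p" if "Poly_Mapping.keys c \<subseteq> ?B" for c
  proof -
    have "?h c \<in> ?M \<inter> NH_comp n d p \<and> Poly_Mapping.keys c \<subseteq> ?B"
      using that
    proof (induction c rule: frag_induction)
      case zero
      have "nh n 0 \<in> NH_comp n d p" unfolding NH_comp_eq[OF p] by (intro imageI) simp
      then show ?case by simp
    next
      case (one b)
      then have "b \<in> carrier (NH n)" "b \<in> ?M" using BM SM by blast+
      then show ?case using rep[of b] one by simp
    next
      case (diff a b)
      have "?h (a - b) = ?h a \<oplus>\<^bsub>NH n\<^esub> (\<ominus>\<^bsub>NH n\<^esub> ?h b)"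
        using comb diff nh_diff by simp
      moreover have "Poly_Mapping.keys (a - b) \<subseteq> ?B" using diff keys_diff[of a b] by blast
      ultimately show ?case using diff M_diff C_diff by simp
    qed
    then show ?thesis ..
  qed
  show "?h \<in> hom (free_Abelian_group ?B) ?G"
  proof (rule homI)
    fix x assume "x \<in> carrier (free_Abelian_group ?B)"
    then show "?h x \<in> carrier ?G" using h_closed by simp
  next
    fix x y assume "x \<in> carrier (free_Abelian_group ?B)" "y \<in> carrier (free_Abelian_group ?B)"
    then show "?h (x \<otimes>\<^bsub>free_Abelian_group ?B\<^esub> y) = ?h x \<otimes>\<^bsub>?G\<^esub> ?h y"
      using comb by (simp add: nh_ops[OF n])
  qed
  have unique: "\<exists>!c. Poly_Mapping.keys c \<subseteq> B \<and> a = ?h c" if "a \<in> ?M" for a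
    by (rule bspec[OF conjunct2[OF B[unfolded is_basis_def]] that])
  show "bij_betw ?h (carrier (free_Abelian_group ?B)) (carrier ?G)"
    unfolding bij_betw_def
  proof
    show "inj_on ?h (carrier (free_Abelian_group ?B))"
    proof (rule inj_onI)
      fix x y assume xy: "x \<in> carrier (free_Abelian_group ?B)" "y \<in> carrier (free_Abelian_group ?B)" "?h x = ?h y"
      then have "?h x \<in> ?M" "Poly_Mapping.keys x \<subseteq> B" "Poly_Mapping.keys y \<subseteq> B" using h_closed[of x] by auto
      then show "x = y" using unique[of "?h x"] xy(3) by blast
    qed
    have "?h c \<in> carrier ?G" if "c \<in> carrier (free_Abelian_group ?B)" for c
      using h_closed that by simp
    moreover have "a \<in> ?h ` carrier (free_Abelian_group ?B)" if "a \<in> carrier ?G" for a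
    proof -
      have a: "a \<in> ?M \<inter> NH_comp n d p" using that by simp
      then obtain c where c: "Poly_Mapping.keys c \<subseteq> B" "a = ?h c" using unique[of a] by blast
      then have "Poly_Mapping.keys c \<subseteq> ?B"
        using component_combination[OF B hom SM p c(1)] a by simp
      then show ?thesis using c(2) by (intro image_eqI[of _ _ c]) simp_all
    qed
    ultimately show "?h ` carrier (free_Abelian_group ?B) = carrier ?G" by blast
  qed
qed

text \<open>
  Free Abelian groups are isomorphic only if their sets of generators are equipollent, and both sets
  freely generate the component.
\<close>

lemma component_eqpoll:
  assumes "is_basis (nh n ` elems S) B" "\<forall>b\<in>B. \<exists>d. \<exists>p\<in>{0, 1}. b \<in> NH_comp n d p"
    and "is_basis (nh n ` elems S) B'" "\<forall>b\<in>B'. \<exists>d. \<exists>p\<in>{0, 1}. b \<in> NH_comp n d p"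
    and "S \<subseteq> nh_gens n" "p \<in> {0, 1}"
  shows "B \<inter> NH_comp n d p \<approx> B' \<inter> NH_comp n d p"
  using iso_trans[OF component_iso[OF assms(1,2,5,6)]
      group.iso_sym[OF group_free_Abelian_group component_iso[OF assms(3,4,5,6)]]]
  unfolding isomorphic_free_Abelian_groups .

subsection \<open>The bases of normal forms\<close>

definition nf_class :: "index \<Rightarrow> letter free_ring set" where
  "nf_class b = nh n (word (nh_word n b))"

lemma rep_nf_class:
  assumes "b \<in> nh_index n"
  shows "rep (nf_class b) - word (nh_word n b) \<in> nh_idl n" "nf_class b \<in> carrier (NH n)"
proof -
  have w: "word (nh_word n b) \<in> elems (nh_gens n)"
    using set_nh_word_nh_gens[OF n assms] by simp
  then show carr: "nf_class b \<in> carrier (NH n)" unfolding nf_class_def by (rule nh_closed[OF n])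
  have "nh n (rep (nf_class b)) = nh n (word (nh_word n b))"
    using rep[OF carr] by (simp add: nf_class_def)
  then show "rep (nf_class b) - word (nh_word n b) \<in> nh_idl n"
    using nh_ops(3)[OF n _ w] rep[OF carr] by blast
qed

lemma comb_nf_class:
  assumes "Poly_Mapping.keys c \<subseteq> nh_index n"
  shows "comb (frag_extend (frag_of \<circ> nf_class) c) - frag_extend (word \<circ> nh_word n) c \<in> nh_idl n"
  using assms
proof (induction c rule: frag_induction)
  case (diff a b)
  have "comb (frag_extend (frag_of \<circ> nf_class) (a - b)) - frag_extend (word \<circ> nh_word n) (a - b) =
     (comb (frag_extend (frag_of \<circ> nf_class) a) - frag_extend (word \<circ> nh_word n) a) -
     (comb (frag_extend (frag_of \<circ> nf_class) b) - frag_extend (word \<circ> nh_word n) b)"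
    by (simp add: frag_extend_diff)
  then show ?case using idl_diff[OF nh_rels[OF n] diff] by (simp only:)
qed (simp_all add: idl_0[OF nh_rels[OF n]] rep_nf_class)

lemma inj_nf_class: "inj_on nf_class (nh_index n)"
proof (rule inj_onI)
  fix a b assume ab: "a \<in> nh_index n" "b \<in> nh_index n" "nf_class a = nf_class b"
  then have "word (nh_word n a) - word (nh_word n b) \<in> nh_idl n"
    using nh_ops(3)[OF n] set_nh_word_nh_gens[OF n] unfolding nf_class_def by simp
  then have "frag_of a - frag_of b = 0"
    using keys_diff[of "frag_of a" "frag_of b"] ab
    by (intro nh_combination_unique[OF n]) (auto simp: frag_extend_diff)
  then show "a = b" by (simp add: frag_of_eq)
qed

text \<open>
  Coefficients with respect to residue classes and coefficients with respect to indices correspond to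
  each other, since different normal forms have different classes.
\<close>

lemma nf_class_basis:
  assumes K: "K \<subseteq> nh_index n" and S: "S \<subseteq> nh_gens n"
    and words: "\<And>b. b \<in> K \<Longrightarrow> set (nh_word n b) \<subseteq> S"
    and span: "\<And>f. f \<in> elems S \<Longrightarrow> f \<in> nh_span n K"
  shows "is_basis (nh n ` elems S) (nf_class ` K)"
  unfolding is_basis_def
proof (intro conjI ballI)
  show "nf_class ` K \<subseteq> nh n ` elems S" using words by (auto simp: nf_class_def)
  fix a assume "a \<in> nh n ` elems S"
  then obtain f where f: "f \<in> elems S" "a = nh n f" by blast
  then have f': "f \<in> elems (nh_gens n)" using elems_mono[OF S] by blast
  have comb: "comb c \<in> elems (nh_gens n)" if "Poly_Mapping.keys c \<subseteq> nf_class ` K" for c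
    using comb_elems[of c] that K rep_nf_class(2) by blast
  obtain c0 where c0: "Poly_Mapping.keys c0 \<subseteq> K" "f - frag_extend (word \<circ> nh_word n) c0 \<in> nh_idl n"
    using span[OF f(1)] unfolding nh_span_def[OF n] by blast
  let ?c = "frag_extend (frag_of \<circ> nf_class) c0"
  have keys: "Poly_Mapping.keys ?c \<subseteq> nf_class ` K"
    using keys_frag_extend[of "frag_of \<circ> nf_class" c0] c0(1) by auto
  have "f - frag_extend (word \<circ> nh_word n) c0 - (comb ?c - frag_extend (word \<circ> nh_word n) c0) \<in> nh_idl n"
    using c0 K by (intro idl_diff[OF nh_rels[OF n] c0(2)] comb_nf_class) auto
  then have a_eq: "a = nh n (comb ?c)"
    using nh_ops(3)[OF n f' comb[OF keys]] f by simp
  show "\<exists>!c. Poly_Mapping.keys c \<subseteq> nf_class ` K \<and> a = nh n (comb c)"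
  proof (rule ex1I[of _ ?c])
    show "Poly_Mapping.keys ?c \<subseteq> nf_class ` K \<and> a = nh n (comb ?c)"
      using keys a_eq by simp
    fix c assume c: "Poly_Mapping.keys c \<subseteq> nf_class ` K \<and> a = nh n (comb c)"
    let ?d = "c - ?c"
    have d: "Poly_Mapping.keys ?d \<subseteq> nf_class ` K" using c keys keys_diff[of c ?c] by blast
    have I: "comb ?d \<in> nh_idl n"
      using nh_ops(3)[OF n comb comb, of c ?c] c keys a_eq by simp
    let ?e = "frag_extend (frag_of \<circ> inv_into K nf_class) ?d"
    have inj: "inj_on nf_class K" using inj_nf_class K by (rule inj_on_subset)
    have "Poly_Mapping.keys ?e \<subseteq> inv_into K nf_class ` Poly_Mapping.keys ?d"
      using keys_frag_extend[of "frag_of \<circ> inv_into K nf_class" ?d] by auto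
    also have "\<dots> \<subseteq> inv_into K nf_class ` nf_class ` K" using d by (rule image_mono)
    also have "\<dots> \<subseteq> K" using inj by (simp add: inv_into_image_cancel)
    finally have e: "Poly_Mapping.keys ?e \<subseteq> K" .
    have "frag_extend (frag_of \<circ> nf_class) ?e = frag_extend (frag_of \<circ> nf_class \<circ> inv_into K nf_class) ?d"
      by (rule frag_extend_compose)
    also have "\<dots> = frag_extend frag_of ?d"
      by (rule frag_extend_eq) (use d in \<open>auto simp: f_inv_into_f\<close>)
    also have "\<dots> = ?d" by (rule frag_expansion[symmetric])
    finally have d_e: "frag_extend (frag_of \<circ> nf_class) ?e = ?d" .
    have "comb ?d - (comb ?d - frag_extend (word \<circ> nh_word n) ?e) \<in> nh_idl n"
      using comb_nf_class[OF order_trans[OF e K]] unfolding d_e by (rule idl_diff[OF nh_rels[OF n] I])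
    then have "frag_extend (word \<circ> nh_word n) ?e \<in> nh_idl n" by simp
    then have "?e = 0" using e K by (intro nh_combination_unique[OF n]) auto
    then show "c = ?c" using d_e by simp
  qed
qed

lemma nh_word_degree:
  assumes "b \<in> nh_index n"
  shows "word_deg (nh_word n b) = 2 * half_deg b"
    and "length (nh_word n b) mod 2 = nat (half_deg b mod 2)"
proof -
  have x: "word_deg (map GX u) = 2 * int (length u)" and t: "word_deg (map (tletter n) u) = - 2 * int (length u)" for u
    by (induction u) (auto simp: word_deg_def tletter_def)
  have len: "length (nf_word 1 (snd b)) = sum_list (snd b)"
    using assms by (intro length_nf_word) (auto simp: nh_index_def)
  have "word_deg (nh_word n b) = word_deg (map GX (xword 1 (fst b))) + word_deg (map (tletter n) (nf_word 1 (snd b)))"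
    by (simp add: nh_word_def word_deg_def)
  then show "word_deg (nh_word n b) = 2 * half_deg b"
    unfolding x t len length_xword half_deg_def by simp
  have "length (nh_word n b) = sum_list (fst b) + sum_list (snd b)"
    unfolding nh_word_def length_append length_map length_xword len ..
  then have "int (length (nh_word n b) mod 2) = half_deg b mod 2"
    unfolding half_deg_def by presburger
  then show "length (nh_word n b) mod 2 = nat (half_deg b mod 2)" by simp
qed

text \<open>
  A class that lay in two components would be equal to its projection onto either of them, hence zero.
\<close>

lemma nf_class_comp:
  assumes b: "b \<in> nh_index n" and p: "p \<in> {0, 1}"
  shows "nf_class b \<in> NH_comp n d p \<longleftrightarrow> d = 2 * half_deg b \<and> p = nat (half_deg b mod 2)"
proof
  let ?w = "word (nh_word n b)"
  have w: "?w \<in> elems (nh_gens n)" using set_nh_word_nh_gens[OF n b] by simp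
  have p2: "p mod 2 = p" using p by auto
  have bihom: "bihom (2 * half_deg b) (nat (half_deg b mod 2)) ?w"
    using nh_word_degree[OF b] by simp
  show "nf_class b \<in> NH_comp n d p" if "d = 2 * half_deg b \<and> p = nat (half_deg b mod 2)"
    unfolding NH_comp_eq[OF p] nf_class_def using that w bihom by (intro imageI) simp
  assume "nf_class b \<in> NH_comp n d p"
  then obtain f where f: "f \<in> elems (nh_gens n)" "bihom d p f" "nh n ?w = nh n f"
    using NH_comp_eq[OF p] by (auto simp: nf_class_def)
  then have I: "f - ?w \<in> nh_idl n" using nh_ops(3)[OF n f(1) w] by simp
  show "d = 2 * half_deg b \<and> p = nat (half_deg b mod 2)"
  proof (rule ccontr)
    assume "\<not> (d = 2 * half_deg b \<and> p = nat (half_deg b mod 2))"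
    then have "bicomp (2 * half_deg b) (nat (half_deg b mod 2)) (f - ?w) = - ?w"
      using bicomp_bihom[OF f(2), of "2 * half_deg b" "nat (half_deg b mod 2)"]
        bicomp_bihom[OF bihom, of "2 * half_deg b" "nat (half_deg b mod 2)"] p2 nh_word_degree(2)[OF b]
      by (auto split: if_splits)
    then have "- ?w \<in> nh_idl n" using bicomp_nh_idl[OF I] by metis
    then have "frag_extend (word \<circ> nh_word n) (frag_of b) \<in> nh_idl n"
      using idl_minus[OF nh_rels[OF n]] by fastforce
    then have "frag_of b = 0" using b by (intro nh_combination_unique[OF n]) auto
    then show False by simp
  qed
qed

text \<open>
  The cardinality of the part of a homogeneous basis in a component does not depend on the basis, so
  the rank series of the basis of normal forms is the one of all bases.
\<close>

theorem graded_rank: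
  assumes A: "ring A" and carrier: "carrier A = nh n ` elems S"
    and ops: "\<zero>\<^bsub>A\<^esub> = \<zero>\<^bsub>NH n\<^esub>" "\<And>x y. x \<oplus>\<^bsub>A\<^esub> y = x \<oplus>\<^bsub>NH n\<^esub> y"
    and K: "K \<subseteq> nh_index n" and S: "S \<subseteq> nh_gens n"
    and words: "\<And>b. b \<in> K \<Longrightarrow> set (nh_word n b) \<subseteq> S"
    and span: "\<And>f. f \<in> elems S \<Longrightarrow> f \<in> nh_span n K"
    and C: "\<And>d p. p \<in> {0, 1} \<Longrightarrow> C d p = carrier A \<inter> NH_comp n d p"
    and F: "weight_series K half_deg F"
  shows "has_graded_rank A C F"
proof -
  have AN: "carrier A \<subseteq> carrier (NH n)"
    using elems_mono[OF S] by (auto simp: carrier carrier_NH[OF n])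
  have iff: "is_homogeneous_Z_basis A C B \<longleftrightarrow> is_basis (nh n ` elems S) B \<and> (\<forall>b\<in>B. \<exists>d. \<exists>p\<in>{0, 1}. b \<in> NH_comp n d p)" for B
  proof -
    have "is_Z_basis A B \<longleftrightarrow> is_basis (nh n ` elems S) B"
      using is_Z_basis_iff[OF A AN ops] carrier by simp
    moreover have "b \<in> nh n ` elems S" if "is_basis (nh n ` elems S) B" "b \<in> B" for b
      using that unfolding is_basis_def by blast
    ultimately show ?thesis
      unfolding is_homogeneous_Z_basis_def using C carrier by (metis (no_types, lifting) IntD2 IntI)
  qed
  let ?B = "nf_class ` K"
  have parity: "nat (e mod 2) \<in> {0, 1}" for e :: int by auto
  have comp: "nf_class b \<in> NH_comp n (2 * half_deg b) (nat (half_deg b mod 2))" if "b \<in> K" for b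
    using nf_class_comp[OF subsetD[OF K that] parity] by blast
  have B: "is_homogeneous_Z_basis A C ?B"
    unfolding iff using nf_class_basis[OF K S words span] comp parity by blast
  have count: "finite (?B \<inter> NH_comp n d p) \<and>
      card (?B \<inter> NH_comp n d p) = (if even d \<and> p = nat (d div 2 mod 2) then card {b \<in> K. half_deg b = d div 2} else 0)"
    if p: "p \<in> {0, 1}" for d p
  proof -
    have "?B \<inter> NH_comp n d p = nf_class ` {b \<in> K. d = 2 * half_deg b \<and> p = nat (half_deg b mod 2)}"
      using nf_class_comp[OF _ p] K by auto
    also have "{b \<in> K. d = 2 * half_deg b \<and> p = nat (half_deg b mod 2)} =
        (if even d \<and> p = nat (d div 2 mod 2) then {b \<in> K. half_deg b = d div 2} else {})"
      by auto
    finally have eq: "?B \<inter> NH_comp n d p = nf_class ` \<dots>" .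
    have "inj_on nf_class {b \<in> K. half_deg b = d div 2}"
      using inj_nf_class K by (auto intro: inj_on_subset)
    moreover have "finite {b \<in> K. half_deg b = d div 2}" using F unfolding weight_series_def by blast
    ultimately show ?thesis unfolding eq by (auto simp: card_image)
  qed
  have "is_rank_series C B F" if "is_homogeneous_Z_basis A C B" for B
    unfolding is_rank_series_def
  proof (intro allI conjI)
    fix d
    have eqpoll: "B \<inter> NH_comp n d p \<approx> ?B \<inter> NH_comp n d p" if "p \<in> {0, 1}" for p
      using \<open>is_homogeneous_Z_basis A C B\<close> B that unfolding iff by (intro component_eqpoll[OF _ _ _ _ S]) auto
    have BA: "B \<subseteq> carrier A"
      using \<open>is_homogeneous_Z_basis A C B\<close> by (simp add: iff is_basis_def carrier)
    have BC: "B \<inter> C d p = B \<inter> NH_comp n d p" if "p \<in> {0, 1}" for p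
      unfolding C[OF that] using BA by blast
    show fin: "\<forall>p\<in>{0, 1}. finite (B \<inter> C d p)"
    proof
      fix p :: nat assume p: "p \<in> {0, 1}"
      show "finite (B \<inter> C d p)"
        using eqpoll_finite_iff[OF eqpoll[OF p]] count[OF p, of d] unfolding BC[OF p] by simp
    qed
    have card: "card (B \<inter> C d p) = (if even d \<and> p = nat (d div 2 mod 2) then card {b \<in> K. half_deg b = d div 2} else 0)"
      if "p \<in> {0, 1}" for p
    proof -
      have "finite (B \<inter> NH_comp n d p)" using fin that unfolding BC[OF that, symmetric] by blast
      then have "card (B \<inter> NH_comp n d p) = card (?B \<inter> NH_comp n d p)"
        using eqpoll_iff_card eqpoll[OF that] count[OF that, of d] by blast
      then show ?thesis using count[OF that, of d] BC[OF that] by simp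
    qed
    have "(\<Sum>p\<in>{0, 1}. \<Sum>b\<in>B \<inter> C d p. zpi_pi ^ p) = (\<Sum>p\<in>{0, 1}. of_nat (card (B \<inter> C d p)) * zpi_pi ^ p)"
      by simp
    also have "\<dots> = (\<Sum>p\<in>{0, 1}. if even d \<and> p = nat (d div 2 mod 2) then of_nat (card {b \<in> K. half_deg b = d div 2}) * zpi_pi ^ p else 0)"
      by (intro sum.cong refl) (simp add: card)
    also have "\<dots> = fls_nth F d"
    proof (cases "even d")
      case True
      then obtain e where d: "d = 2 * e" by blast
      have "fls_nth F d = of_nat (card {b \<in> K. half_deg b = e}) * zpi_pi ^ nat (e mod 2)"
        using F d by (simp add: weight_series_def)
      moreover have "e mod 2 = 0 \<or> e mod 2 = 1" by auto
      ultimately show ?thesis by (elim disjE) (simp_all add: d)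
    next
      case False
      then obtain e where d: "d = 2 * e + 1" by (rule oddE)
      have "fls_nth F d = 0" using F unfolding weight_series_def d by simp
      then show ?thesis using False by simp
    qed
    finally show "fls_nth F d = (\<Sum>p\<in>{0, 1}. \<Sum>b\<in>B \<inter> C d p. zpi_pi ^ p)" by simp
  qed
  then show ?thesis unfolding has_graded_rank_def using B by blast
qed

lemma NC_carrier: "carrier (NC n) = nh n ` elems (nc_gens n)"
proof -
  let ?H = "(\<lambda>g. nh n (gen g)) ` nc_gens n"
  have nc: "f \<in> elems (nc_gens n) \<Longrightarrow> f \<in> elems (nh_gens n)" for f
    by (rule elems_mono[OF nc_gens_nh_gens])
  have "x \<in> nh n ` elems (nc_gens n)" if "x \<in> generate_ring (NH n) ?H" for x
    using that
  proof (induction x rule: generate_ring.induct)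
    case one
    show ?case by (rule image_eqI[of _ _ 1]) (simp_all add: nh_consts[OF n])
  next
    case (incl h)
    then show ?case by auto
  next
    case (a_inv h)
    then obtain f where "f \<in> elems (nc_gens n)" "h = nh n f" by blast
    then show ?case by (intro image_eqI[of _ _ "- f"]) (simp_all add: nh_minus[OF n] nc)
  next
    case (eng_add g h)
    then obtain f f' where "f \<in> elems (nc_gens n)" "g = nh n f" "f' \<in> elems (nc_gens n)" "h = nh n f'" by blast
    then show ?case by (intro image_eqI[of _ _ "f + f'"]) (simp_all add: nh_ops[OF n] nc)
  next
    case (eng_mult g h)
    then obtain f f' where "f \<in> elems (nc_gens n)" "g = nh n f" "f' \<in> elems (nc_gens n)" "h = nh n f'" by blast
    then show ?case by (intro image_eqI[of _ _ "f * f'"]) (simp_all add: nh_ops[OF n] nc)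
  qed
  moreover have "nh n f \<in> generate_ring (NH n) ?H" if "f \<in> elems (nc_gens n)" for f
    using that
  proof (induction f rule: elems_induct)
    case zero
    show ?case using NH.zero_in_generate by (simp add: nh_consts[OF n])
  next
    case (word w)
    then show ?case
    proof (induction w)
      case Nil
      show ?case using generate_ring.one[of "NH n"] by (simp add: nh_consts[OF n] word_Nil)
    next
      case (Cons l w)
      then have "nh n (gen l * word w) = nh n (gen l) \<otimes>\<^bsub>NH n\<^esub> nh n (word w)"
        using nc_gens_nh_gens by (subst nh_ops(2)[OF n]) auto
      then show ?case
        unfolding word_Cons using Cons by (simp add: generate_ring.eng_mult generate_ring.incl)
    qed
  next
    case (diff a b)
    then show ?case
      using generate_ring.eng_add[OF diff(3) generate_ring.a_inv[OF diff(4)]] nh_diff[OF nc nc] by simp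
  qed
  ultimately show ?thesis by (auto simp: NC_def)
qed

lemma nc_index_words:
  assumes "b \<in> nc_index n"
  shows "set (nh_word n b) \<subseteq> nc_gens n"
proof -
  have "xword 1 (fst b) = []" "set (nf_word 1 (snd b)) \<subseteq> {1..n}"
    using assms set_nf_word[of 1 "snd b"] by (auto simp: nc_index_def[OF n] xword_zeros)
  then show ?thesis unfolding nh_word_def nc_gens_eq[OF n] by auto
qed

theorem NH_graded_rank:
  assumes "weight_series (nh_index n) half_deg F"
  shows "has_graded_rank (NH n) (NH_comp n) F"
proof (rule graded_rank[where S = "nh_gens n", OF NH.ring_axioms carrier_NH[OF n] _ _ subset_refl subset_refl _ _ _ assms])
  show "NH_comp n d p = carrier (NH n) \<inter> NH_comp n d p" if "p \<in> {0, 1}" for d p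
    unfolding NH_comp_eq[OF that] carrier_NH[OF n] by blast
qed (simp_all add: set_nh_word_nh_gens[OF n] nh_words_span[OF n])

theorem NC_graded_rank:
  assumes "weight_series (nc_index n) half_deg F"
  shows "has_graded_rank (NC n) (NC_comp n) F"
proof (rule graded_rank[where S = "nc_gens n", OF _ NC_carrier _ _ nc_index_subset[OF n] nc_gens_nh_gens _ _ _ assms])
  have "(\<lambda>g. nh n (gen g)) ` nc_gens n \<subseteq> carrier (NH n)"
    using nc_gens_nh_gens nh_closed[OF n] by (auto simp: subset_iff)
  then show "ring (NC n)" unfolding NC_def by (rule NH.generate_ring_is_ring)
qed (simp_all add: nc_index_words nc_span[OF n] NC_def NC_comp_def)

end

section \<open>The generating functions\<close>

subsection \<open>Division of Laurent series over the ring of parities\<close>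

lemma zpi_pi_square: "zpi_pi * zpi_pi = 1"
  by (simp add: zpi_pi_def one_zpi_def times_zpi_def)

lemma ppi_square: "ppi * ppi = 1"
  by (simp add: ppi_def fls_const_mult_const zpi_pi_square)

text \<open>
  The coefficients form a ring with zero divisors, so only division by series with a unit as leading
  coefficient behaves as in a field.
\<close>

lemma zpi_mult_inverse:
  fixes u :: zpi
  assumes "u dvd 1"
  shows "u * inverse u = 1"
proof -
  obtain v where v: "u * v = 1" using assms by (metis dvdE)
  have "\<exists>!v. u * v = 1"
  proof (rule ex1I[of _ v])
    show "w = v" if "u * w = 1" for w
    proof -
      have "w = w * (u * v)" using v by simp
      also have "\<dots> = (u * w) * v" by (simp add: ac_simps)
      finally show ?thesis using that by simp
    qed
  qed (rule v)
  then show ?thesis using assms theI'[of "\<lambda>v. u * v = 1"] by (simp add: inverse_zpi_def)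
qed

lemma fls_mult_inverse_unit:
  fixes f :: "zpi fls"
  assumes "fls_nth f (fls_subdegree f) dvd 1"
  shows "f * inverse f = 1"
  unfolding fls_inverse_def' using zpi_mult_inverse[OF assms] by (rule fls_right_inverse)

lemma fls_inverse_unique:
  fixes f g :: "zpi fls"
  assumes "fls_nth f (fls_subdegree f) dvd 1" "f * g = 1"
  shows "inverse f = g"
proof -
  have "inverse f = inverse f * (f * g)" using assms(2) by simp
  also have "\<dots> = (f * inverse f) * g" by (simp add: ac_simps)
  finally show ?thesis using fls_mult_inverse_unit[OF assms(1)] by simp
qed

lemma fls_divide_eqI:
  fixes f g h :: "zpi fls"
  assumes "fls_nth g (fls_subdegree g) dvd 1" "h * g = f"
  shows "f / g = h"
proof -
  have "f / g = h * (g * inverse g)"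
    unfolding assms(2)[symmetric] by (simp only: fls_divide_convert_times_inverse mult.assoc)
  then show ?thesis using fls_mult_inverse_unit[OF assms(1)] by simp
qed

lemma zpi_pi_dvd_1: "zpi_pi dvd 1"
  using zpi_pi_square by (metis dvdI)

lemma zpi_pi_nonzero: "zpi_pi \<noteq> 0"
  by (simp add: zpi_pi_def zero_zpi_def)

lemma of_nat_zpi: "of_nat k = ZPi (int k) 0"
  by (induction k) (simp_all add: zero_zpi_def one_zpi_def plus_zpi_def)

lemma of_nat_mult_zpi_pi_pow_eq_0: "of_nat k * zpi_pi ^ l = 0 \<Longrightarrow> k = 0"
proof -
  assume "of_nat k * zpi_pi ^ l = 0"
  then have "of_nat k * (zpi_pi * zpi_pi) ^ l = 0"
    by (metis mult.assoc mult_zero_left power_mult_distrib)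
  then show "k = 0" by (simp add: zpi_pi_square of_nat_zpi zero_zpi_def)
qed

lemma qq_mult_X_inv: "qq * fls_X_inv = 1"
  by (simp add: fls_X_inv_times_conv_shift(2) fls_X_conv_shift_1)

lemma inverse_qq: "inverse qq = fls_X_inv"
  by (rule fls_inverse_unique) (simp_all add: qq_mult_X_inv)

lemma ppi_qq_mult_inverse: "ppi * qq * (ppi * fls_X_inv) = 1"
proof -
  have "ppi * qq * (ppi * fls_X_inv) = (ppi * ppi) * (qq * fls_X_inv)" by (simp only: ac_simps)
  then show ?thesis by (simp add: ppi_square qq_mult_X_inv)
qed

lemma ppi_mult_nth: "fls_nth (ppi * F) k = zpi_pi * fls_nth F k"
  by (simp add: ppi_def)

lemma qint_sum: "qint m = (\<Sum>i<m. fls_X_inv ^ (m - Suc i) * (ppi * qq) ^ i)"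
  unfolding qint_def inverse_qq
proof (rule fls_divide_eqI)
  have "fls_subdegree (ppi * qq - fls_X_inv) = -1"
    by (rule fls_subdegree_eqI) (simp_all add: ppi_mult_nth)
  then show "fls_nth (ppi * qq - fls_X_inv) (fls_subdegree (ppi * qq - fls_X_inv)) dvd 1"
    by (simp add: ppi_mult_nth)
  have "qq powi (- int m) = fls_X_inv ^ m"
    by (cases "m = 0") (simp_all add: power_int_def inverse_qq)
  then show "(\<Sum>i<m. fls_X_inv ^ (m - Suc i) * (ppi * qq) ^ i) * (ppi * qq - fls_X_inv) = ppi ^ m * qq ^ m - qq powi (- int m)"
    using power_diff_sumr2[of "ppi * qq" m fls_X_inv] by (simp add: power_mult_distrib mult.commute)
qed

text \<open>
  The contribution $\pi q^{-2}$ of one operator to the rank.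
\<close>

abbreviation der_weight :: "zpi fls" where
  "der_weight \<equiv> ppi * fls_X_inv ^ 2"

text \<open>
  Each $[m]_\pi$ is a geometric sum; the factor makes it start with 1.
\<close>

lemma qint_scaled:
  assumes "1 \<le> m"
  shows "(ppi * fls_X_inv) ^ (m - 1) * qint m = (\<Sum>i<m. der_weight ^ i)"
proof -
  have one: "ppi * fls_X_inv * (ppi * qq) = 1"
    using ppi_qq_mult_inverse by (simp only: mult.commute)
  have "(ppi * fls_X_inv) ^ (m - 1) * qint m = (\<Sum>i<m. der_weight ^ (m - Suc i))"
    unfolding qint_sum sum_distrib_left
  proof (intro sum.cong refl)
    fix i assume "i \<in> {..<m}"
    then have "m - 1 = (m - Suc i) + i" by simp
    then have "(ppi * fls_X_inv) ^ (m - 1) * (fls_X_inv ^ (m - Suc i) * (ppi * qq) ^ i) =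
        (ppi * fls_X_inv) ^ (m - Suc i) * fls_X_inv ^ (m - Suc i) * ((ppi * fls_X_inv) ^ i * (ppi * qq) ^ i)"
      by (simp only: power_add ac_simps)
    also have "\<dots> = (ppi * fls_X_inv * fls_X_inv) ^ (m - Suc i) * (ppi * fls_X_inv * (ppi * qq)) ^ i"
      by (simp only: power_mult_distrib)
    finally show "(ppi * fls_X_inv) ^ (m - 1) * (fls_X_inv ^ (m - Suc i) * (ppi * qq) ^ i) = der_weight ^ (m - Suc i)"
      unfolding one by (simp add: power2_eq_square mult.assoc)
  qed
  then show ?thesis by (simp add: sum.nat_diff_reindex)
qed

text \<open>
  The exponent is distributed over the factors by $n^2 = \sum_{k=1}^n (2k - 1)$.
\<close>

lemma NC_rank_product:
  "(ppi * qq) powi (- int (n^2)) * qint_even_dfact n = (\<Prod>k=1..n. \<Sum>i<2 * k. der_weight ^ i)"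
proof -
  have inv: "inverse (ppi * qq) = ppi * fls_X_inv"
  proof (rule fls_inverse_unique)
    have "fls_subdegree (ppi * qq) = 1"
      by (rule fls_subdegree_eqI) (simp_all add: ppi_mult_nth zpi_pi_nonzero)
    then show "fls_nth (ppi * qq) (fls_subdegree (ppi * qq)) dvd 1"
      by (simp add: ppi_mult_nth zpi_pi_dvd_1)
    show "ppi * qq * (ppi * fls_X_inv) = 1"
      by (rule ppi_qq_mult_inverse)
  qed
  have "(ppi * qq) powi (- int (n^2)) = (ppi * fls_X_inv) ^ (n^2)"
    by (cases "n = 0") (simp_all add: power_int_def inv nat_power_eq)
  moreover have "(ppi * fls_X_inv) ^ (n^2) * qint_even_dfact n = (\<Prod>k=1..n. \<Sum>i<2 * k. der_weight ^ i)"
  proof (induction n)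
    case 0
    then show ?case by (simp add: qint_even_dfact_def)
  next
    case (Suc n)
    have square: "(Suc n)^2 = n^2 + (2 * Suc n - 1)" by (simp add: power2_eq_square)
    have step: "qint_even_dfact (Suc n) = qint_even_dfact n * qint (2 * Suc n)"
      by (simp add: qint_even_dfact_def mult.commute)
    have "(ppi * fls_X_inv) ^ ((Suc n)^2) * qint_even_dfact (Suc n) =
        ((ppi * fls_X_inv) ^ (n^2) * qint_even_dfact n) * ((ppi * fls_X_inv) ^ (2 * Suc n - 1) * qint (2 * Suc n))"
      unfolding square step power_add by (simp only: ac_simps)
    then show ?case using Suc qint_scaled[of "2 * Suc n"] by (simp add: mult.commute)
  qed
  ultimately show ?thesis by simp
qed

subsection \<open>Weight series\<close>

lemma zpi_pi_parity: "zpi_pi * zpi_pi ^ nat ((e + 1) mod 2) = zpi_pi ^ nat (e mod 2)"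
proof (cases "even e")
  case True
  then have "(e + 1) mod 2 = 1" "e mod 2 = 0" by presburger+
  then show ?thesis by (simp add: zpi_pi_square)
next
  case False
  then have "(e + 1) mod 2 = 0" "e mod 2 = 1" by presburger+
  then show ?thesis by simp
qed

lemma weight_series_lower:
  assumes "weight_series K wt F"
  shows "weight_series K (\<lambda>b. wt b - 1) (F * der_weight)"
proof -
  have "F * der_weight = ppi * fls_shift 2 F"
  proof -
    have "F * der_weight = ppi * (fls_X_inv * (fls_X_inv * F))" by (simp only: power2_eq_square ac_simps)
    then show ?thesis by (simp add: fls_X_inv_times_conv_shift(1))
  qed
  then have nth: "fls_nth (F * der_weight) k = zpi_pi * fls_nth F (k + 2)" for k
    by (simp add: ppi_mult_nth)
  show ?thesis
    unfolding weight_series_def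
  proof (intro allI conjI)
    fix e
    have eq: "{b \<in> K. wt b - 1 = e} = {b \<in> K. wt b = e + 1}" by auto
    show "finite {b \<in> K. wt b - 1 = e}" unfolding eq using assms by (simp add: weight_series_def)
    have "fls_nth F (2 * (e + 1)) = of_nat (card {b \<in> K. wt b = e + 1}) * zpi_pi ^ nat ((e + 1) mod 2)"
      using assms unfolding weight_series_def by blast
    then have "fls_nth (F * der_weight) (2 * e) = of_nat (card {b \<in> K. wt b = e + 1}) * (zpi_pi * zpi_pi ^ nat ((e + 1) mod 2))"
      unfolding nth by (simp add: distrib_left mult.left_commute)
    then show "fls_nth (F * der_weight) (2 * e) = of_nat (card {b \<in> K. wt b - 1 = e}) * zpi_pi ^ nat (e mod 2)"
      unfolding eq zpi_pi_parity .
    have "fls_nth F (2 * (e + 1) + 1) = 0" using assms unfolding weight_series_def by blast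
    then show "fls_nth (F * der_weight) (2 * e + 1) = 0"
      unfolding nth by (simp add: distrib_left add.commute add.left_commute)
  qed
qed

lemma weight_series_lower_pow:
  "weight_series K wt F \<Longrightarrow> weight_series K (\<lambda>b. wt b - int m) (F * der_weight ^ m)"
proof (induction m)
  case (Suc m)
  then show ?case
    using weight_series_lower[OF Suc.IH[OF Suc.prems]] by (simp add: algebra_simps)
qed simp

lemma weight_series_union:
  assumes "weight_series K wt F" "weight_series K' wt F'" "K \<inter> K' = {}"
  shows "weight_series (K \<union> K') wt (F + F')"
  unfolding weight_series_def
proof (intro allI conjI)
  fix e
  have eq: "{b \<in> K \<union> K'. wt b = e} = {b \<in> K. wt b = e} \<union> {b \<in> K'. wt b = e}" by auto
  have fin: "finite {b \<in> K. wt b = e}" "finite {b \<in> K'. wt b = e}"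
    using assms unfolding weight_series_def by auto
  then show "finite {b \<in> K \<union> K'. wt b = e}" unfolding eq by blast
  have "card {b \<in> K \<union> K'. wt b = e} = card {b \<in> K. wt b = e} + card {b \<in> K'. wt b = e}"
    unfolding eq using assms(3) by (intro card_Un_disjoint fin) auto
  then show "fls_nth (F + F') (2 * e) = of_nat (card {b \<in> K \<union> K'. wt b = e}) * zpi_pi ^ nat (e mod 2)"
    using assms(1,2) unfolding weight_series_def by (simp add: distrib_right)
  show "fls_nth (F + F') (2 * e + 1) = 0"
    using assms(1,2) unfolding weight_series_def by simp
qed

lemma weight_series_bij:
  assumes "weight_series K wt F" "bij_betw g K K'" "\<And>b. b \<in> K \<Longrightarrow> wt' (g b) = wt b"
  shows "weight_series K' wt' F"
proof -
  have bij: "bij_betw g {b \<in> K. wt b = e} {b \<in> K'. wt' b = e}" for e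
    using assms(2,3) unfolding bij_betw_def by (auto intro: inj_on_subset)
  show ?thesis
    using assms(1) bij_betw_finite[OF bij] bij_betw_same_card[OF bij]
    by (simp add: weight_series_def)
qed

lemma weight_series_times_bounded:
  assumes "weight_series K wt F"
  shows "weight_series (K \<times> {..<m}) (\<lambda>(b, j). wt b - int j) (F * (\<Sum>j<m. der_weight ^ j))"
proof (induction m)
  case 0
  show ?case by (simp add: weight_series_def)
next
  case (Suc m)
  have "bij_betw (\<lambda>b. (b, m)) K (K \<times> {m})" by (auto simp: bij_betw_def inj_on_def)
  then have "weight_series (K \<times> {m}) (\<lambda>(b, j). wt b - int j) (F * der_weight ^ m)"
    using weight_series_bij[OF weight_series_lower_pow[OF assms, of m]] by fastforce
  then have "weight_series (K \<times> {..<m} \<union> K \<times> {m}) (\<lambda>(b, j). wt b - int j) (F * (\<Sum>j<m. der_weight ^ j) + F * der_weight ^ m)"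
    by (intro weight_series_union Suc) auto
  moreover have "K \<times> {..<m} \<union> K \<times> {m} = K \<times> {..<Suc m}" by auto
  ultimately show ?case by (simp add: distrib_left)
qed

text \<open>
  A pair either has second component 0, or arises from a pair of weight one less.  This is the
  recursion satisfied by the coefficients of \<open>G\<close>, and both sides vanish in low degrees.
\<close>

lemma weight_series_times_nat:
  assumes F: "weight_series K wt F" and G: "G * (1 - ppi * qq ^ 2) = F"
  shows "weight_series (K \<times> UNIV) (\<lambda>(b, j). wt b + int j) G"
proof -
  let ?T = "\<lambda>e. {x \<in> K \<times> UNIV. (\<lambda>(b, j). wt b + int j) x = e}"
  have "G * qq ^ 2 = fls_shift (- 2) G"
  proof -
    have "G * qq ^ 2 = G * qq * qq" by (simp only: power2_eq_square mult.assoc)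
    then show ?thesis by (simp add: fls_X_times_conv_shift(2))
  qed
  then have "F = G - ppi * fls_shift (- 2) G"
    unfolding G[symmetric] by (simp add: algebra_simps)
  then have G_nth: "fls_nth G k = fls_nth F k + zpi_pi * fls_nth G (k - 2)" for k
    by (simp add: ppi_mult_nth)
  define N where "N = min (fls_subdegree F) (fls_subdegree G)"
  \<comment> \<open>Below this weight \<open>2 * e \<le> e\<close>, so that degree \<open>2 * e\<close> lies below both series.\<close>
  define N' where "N' = - \<bar>N\<bar>"
  have low: "fls_nth F k = 0" "fls_nth G k = 0" if "k < N" for k
    using that by (simp_all add: N_def)
  have K_low: "e \<ge> N'" if "b \<in> K" "wt b = e" for b e
  proof (rule ccontr)
    assume "\<not> e \<ge> N'"
    then have "2 * e < N" by (simp add: N'_def)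
    then have "card {b \<in> K. wt b = e} = 0"
      using low(1) of_nat_mult_zpi_pi_pow_eq_0 F unfolding weight_series_def by metis
    then show False using that F unfolding weight_series_def by auto
  qed
  have T_step: "?T e = (\<lambda>b. (b, 0)) ` {b \<in> K. wt b = e} \<union> apsnd Suc ` ?T (e - 1)" for e
  proof
    show "?T e \<subseteq> (\<lambda>b. (b, 0)) ` {b \<in> K. wt b = e} \<union> apsnd Suc ` ?T (e - 1)"
    proof
      fix x assume x: "x \<in> ?T e"
      obtain b j where bj: "x = (b, j)" by (cases x)
      show "x \<in> (\<lambda>b. (b, 0)) ` {b \<in> K. wt b = e} \<union> apsnd Suc ` ?T (e - 1)"
      proof (cases j)
        case 0
        then show ?thesis using x bj by auto
      next
        case (Suc j')
        then have "x = apsnd Suc (b, j')" "(b, j') \<in> ?T (e - 1)" using x bj by auto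
        then show ?thesis by blast
      qed
    qed
  qed auto
  have main: "finite (?T e) \<and> fls_nth G (2 * e) = of_nat (card (?T e)) * zpi_pi ^ nat (e mod 2) \<and> fls_nth G (2 * e + 1) = 0"
    if "e \<ge> N' - 1" for e
    using that
  proof (induction e rule: int_ge_induct)
    case base
    have empty: "?T (N' - 1) = {}" using K_low by fastforce
    have "2 * (N' - 1) + 1 < N" unfolding N'_def by arith
    then have "fls_nth G (2 * (N' - 1)) = 0" "fls_nth G (2 * (N' - 1) + 1) = 0" by (simp_all add: low(2))
    then show ?case unfolding empty by simp
  next
    case (step e)
    have fin: "finite {b \<in> K. wt b = e + 1}" using F by (simp add: weight_series_def)
    have T: "?T (e + 1) = (\<lambda>b. (b, 0)) ` {b \<in> K. wt b = e + 1} \<union> apsnd Suc ` ?T e"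
      using T_step[of "e + 1"] by simp
    have "finite (?T (e + 1))" unfolding T using fin step by blast
    have card: "card (?T (e + 1)) = card {b \<in> K. wt b = e + 1} + card (?T e)"
      unfolding T using fin step
      by (subst card_Un_disjoint) (auto simp: card_image inj_on_def)
    let ?\<pi> = "\<lambda>e. zpi_pi ^ nat (e mod 2)"
    have \<pi>: "zpi_pi * ?\<pi> e = ?\<pi> (e + 1)"
    proof -
      have "zpi_pi * ?\<pi> e = (zpi_pi * zpi_pi) * ?\<pi> (e + 1)"
        using zpi_pi_parity[of e] by (simp only: mult.assoc)
      then show ?thesis by (simp add: zpi_pi_square)
    qed
    have "fls_nth G (2 * (e + 1)) = fls_nth F (2 * (e + 1)) + zpi_pi * fls_nth G (2 * e)"
      using G_nth[of "2 * (e + 1)"] by simp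
    also have "fls_nth F (2 * (e + 1)) = of_nat (card {b \<in> K. wt b = e + 1}) * ?\<pi> (e + 1)"
      using F unfolding weight_series_def by blast
    also have "zpi_pi * fls_nth G (2 * e) = of_nat (card (?T e)) * (zpi_pi * ?\<pi> e)"
      using step by (simp only: mult.left_commute)
    finally have even: "fls_nth G (2 * (e + 1)) = of_nat (card (?T (e + 1))) * ?\<pi> (e + 1)"
      unfolding \<pi> card by (simp only: of_nat_add distrib_right)
    have "fls_nth F (2 * (e + 1) + 1) = 0" using F unfolding weight_series_def by blast
    then have "fls_nth G (2 * (e + 1) + 1) = 0"
      using G_nth[of "2 * (e + 1) + 1"] step by (simp add: add.commute)
    then show ?case using even \<open>finite (?T (e + 1))\<close> by blast
  qed
  show ?thesis
    unfolding weight_series_def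
  proof
    fix e
    show "finite (?T e) \<and> fls_nth G (2 * e) = of_nat (card (?T e)) * zpi_pi ^ nat (e mod 2) \<and> fls_nth G (2 * e + 1) = 0"
    proof (cases "e \<ge> N' - 1")
      case False
      then have empty: "?T e = {}" using K_low by fastforce
      have "2 * e + 1 < N" using False unfolding N'_def by arith
      then have "fls_nth G (2 * e) = 0" "fls_nth G (2 * e + 1) = 0" by (simp_all add: low(2))
      then show ?thesis unfolding empty by simp
    qed (rule main)
  qed
qed

lemma weight_series_singleton:
  assumes "wt x = 0"
  shows "weight_series {x} wt 1"
proof -
  have eq: "{b \<in> {x}. wt b = e} = (if e = 0 then {x} else {})" for e
    using assms by auto
  have odd: "2 * e + 1 \<noteq> 0" for e :: int by presburger
  show ?thesis unfolding weight_series_def eq by (simp add: odd)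
qed

text \<open>
  The entry that is added in front of a code of length $n$ takes the values $0, \dots, 2n + 1$.
\<close>

lemma weight_series_codes:
  "weight_series {ms. length ms = n \<and> is_code ms} (\<lambda>ms. - int (sum_list ms)) (\<Prod>k=1..n. \<Sum>i<2 * k. der_weight ^ i)"
proof (induction n)
  case 0
  have "{ms. length ms = 0 \<and> is_code ms} = {[]}" by auto
  then show ?case using weight_series_singleton[of _ "[] :: nat list"] by simp
next
  case (Suc n)
  have "bij_betw (\<lambda>(ms, m). m # ms) ({ms. length ms = n \<and> is_code ms} \<times> {..<2 * Suc n}) {ms. length ms = Suc n \<and> is_code ms}"
    by (rule bij_betwI[where g = "\<lambda>ms. (tl ms, hd ms)"]) (auto simp: length_Suc_conv)
  then show ?case
    using weight_series_bij[OF weight_series_times_bounded[OF Suc, of "2 * Suc n"]]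
    by (fastforce simp: prod.nat_ivl_Suc')
qed

lemma unit_one_minus:
  fixes k :: nat
  shows "fls_nth ((1 - ppi * qq ^ 2) ^ k) (fls_subdegree ((1 - ppi * qq ^ 2) ^ k)) dvd 1"
proof -
  have "(1 - ppi * qq ^ 2) = fps_to_fls (1 - fps_const zpi_pi * fps_X ^ 2)"
    by (simp add: ppi_def fls_times_fps_to_fls fps_to_fls_power fps_to_fls_minus)
  then have "(1 - ppi * qq ^ 2) ^ k = fps_to_fls ((1 - fps_const zpi_pi * fps_X ^ 2) ^ k)"
    by (simp add: fps_to_fls_power)
  then have 0: "fls_nth ((1 - ppi * qq ^ 2) ^ k) 0 = 1" and low: "\<And>j. j < 0 \<Longrightarrow> fls_nth ((1 - ppi * qq ^ 2) ^ k) j = 0"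
    by (simp_all add: fps_power_zeroth)
  then have "fls_subdegree ((1 - ppi * qq ^ 2) ^ k) = 0"
    by (intro fls_subdegree_eqI) simp_all
  then show ?thesis using 0 by simp
qed

lemma weight_series_nh:
  assumes "P = (\<Prod>k=1..n. \<Sum>i<2 * k. der_weight ^ i)"
  shows "weight_series {(as, ms). length as = k \<and> length ms = n \<and> is_code ms} half_deg (P / (1 - ppi * qq ^ 2) ^ k)"
proof (induction k)
  case 0
  have "bij_betw (Pair []) {ms. length ms = n \<and> is_code ms} {(as, ms). length as = 0 \<and> length ms = n \<and> is_code ms}"
    by (auto simp: bij_betw_def inj_on_def)
  then have "weight_series {(as, ms). length as = 0 \<and> length ms = n \<and> is_code ms} half_deg P"
    unfolding assms by (rule weight_series_bij[OF weight_series_codes]) (simp add: half_deg_def)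
  moreover have "P / (1 - ppi * qq ^ 2) ^ 0 = P"
    by (rule fls_divide_eqI[OF unit_one_minus]) simp
  ultimately show ?case by (simp only:)
next
  case (Suc k)
  let ?u = "1 - ppi * qq ^ 2"
  have "P / ?u ^ Suc k * ?u * ?u ^ k = P"
  proof -
    have "P / ?u ^ Suc k * ?u * ?u ^ k = P * (?u ^ Suc k * inverse (?u ^ Suc k))"
      by (simp only: fls_divide_convert_times_inverse power_Suc ac_simps)
    then show ?thesis using fls_mult_inverse_unit[OF unit_one_minus, of "Suc k"] by simp
  qed
  then have "P / ?u ^ k = P / ?u ^ Suc k * ?u"
    by (rule fls_divide_eqI[OF unit_one_minus])
  then have "weight_series ({(as, ms). length as = k \<and> length ms = n \<and> is_code ms} \<times> UNIV)
      (\<lambda>(b, j). half_deg b + int j) (P / ?u ^ Suc k)"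
    by (intro weight_series_times_nat[OF Suc]) simp
  moreover have "bij_betw (\<lambda>((as, ms), a). (a # as, ms)) ({(as, ms). length as = k \<and> length ms = n \<and> is_code ms} \<times> UNIV)
      {(as, ms). length as = Suc k \<and> length ms = n \<and> is_code ms}"
    by (rule bij_betwI[where g = "\<lambda>(as, ms). ((tl as, ms), hd as)"]) (auto simp: length_Suc_conv)
  ultimately show ?case
    by (rule weight_series_bij) (auto simp: half_deg_def)
qed

section \<open>Faithfulness and graded ranks\<close>

theorem corollary4p5:
  fixes n :: nat
  assumes "n \<ge> 1"
  shows "((\<exists>\<rho>. is_pol_rep n \<rho>) \<and> (\<forall>\<rho>. is_pol_rep n \<rho> \<longrightarrow> inj_on \<rho> (carrier (NH n)))) \<and>
         has_graded_rank (NC n) (NC_comp n) ((ppi * qq) powi (- int (n^2)) * qint_even_dfact n) \<and>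
         has_graded_rank (NH n) (NH_comp n)
           (((ppi * qq) powi (- int (n^2)) * qint_even_dfact n) / (1 - ppi * qq^2) ^ n)"
proof (intro conjI)
  show "\<exists>\<rho>. is_pol_rep n \<rho>" using pol_rep_is_pol_rep[OF assms] by blast
  show "\<forall>\<rho>. is_pol_rep n \<rho> \<longrightarrow> inj_on \<rho> (carrier (NH n))" using pol_rep_faithful[OF assms] by blast
  have "bij_betw (Pair (replicate n 0)) {ms. length ms = n \<and> is_code ms} (nc_index n)"
    by (auto simp: bij_betw_def inj_on_def nc_index_def[OF assms])
  then have "weight_series (nc_index n) half_deg (\<Prod>k=1..n. \<Sum>i<2 * k. der_weight ^ i)"
    by (rule weight_series_bij[OF weight_series_codes]) (simp add: half_deg_def)
  then show "has_graded_rank (NC n) (NC_comp n) ((ppi * qq) powi (- int (n^2)) * qint_even_dfact n)"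
    unfolding NC_rank_product by (rule NC_graded_rank[OF assms])
  show "has_graded_rank (NH n) (NH_comp n)
           (((ppi * qq) powi (- int (n^2)) * qint_even_dfact n) / (1 - ppi * qq^2) ^ n)"
    unfolding NC_rank_product
    by (rule NH_graded_rank[OF assms weight_series_nh[OF refl, of n n, folded nh_index_def]])
qed

end
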